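(* Let $(\phi_1,\dots,\phi_n)$, $n\ge2$, be a Chebyshev asymptotic scale on $[T,x_0[$ with $\phi_i\in AC^{n-1}[T,x_0[$, and let $f\in AC^{n-1}[T,x_0[$. The following integral conditions are equivalent: (a) $\int_T^{x_0}\frac{dt_1}{p_1(t_1)}\int_{t_1}^{x_0}\frac{dt_2}{p_2(t_2)}\cdots\int_{t_{n-2}}^{x_0}\frac{dt_{n-1}}{p_{n-1}(t_{n-1})}\int_{t_{n-1}}^{x_0}\frac{|L[f](t)|}{p_n(t)}dt<+\infty$; (b) $\int_T^{x_0}P(t)\,|L[f](t)|\,dt<+\infty$, where $P(t):=\frac1{p_n(t)}\int_T^t\frac{dt_{n-1}}{p_{n-1}(t_{n-1})}\int_T^{t_{n-1}}\frac{dt_{n-2}}{p_{n-2}(t_{n-2})}\cdots\int_T^{t_2}\frac{dt_1}{p_1(t_1)}$; (c) $\int_T^{x_0}\frac{|L[f](t)|}{q_n(t)}dt=\int_T^{x_0}\left|\frac{W(\phi_1,\dots,\phi_{n-1})(t)}{W(\phi_1,\dots,\phi_n)(t)}L[f](t)\right|dt<+\infty$. Each of them implies that there are $a_1,\dots,a_n\in\mathbb R$ such that, as $x\to x_0^-$, $f(x)=\sum_{j=1}^na_j\phi_j(x)+o(\phi_n(x))$, $L_k[f(x)]=\sum_{j=1}^{n-k}a_jL_k[\phi_j(x)]+o(1)$ for $1\le k\le n-1$, and $M_k[f(x)]=\sum_{j=k+1}^na_jM_k[\phi_j(x)]+o(M_k[\phi_n(x)])$ for $1\le k\le n-1$.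
   Context: $T\in\mathbb R$, $x_0\in\mathbb R\cup\{+\infty\}$, $T<x_0$. $AC^k(I)$: functions whose $k$-th derivative is absolutely continuous on every compact subinterval of $I$. $W(\cdot)$ is the Wronskian; $g\gg h$ as $x\to x_0^-$ means $h/g\to0$. A Chebyshev asymptotic scale on $[T,x_0[$: real $\phi_i\in C^{n-1}[T,x_0[$, each nonzero on a left deleted neighbourhood of $x_0$, $\phi_1\gg\dots\gg\phi_n$ as $x\to x_0^-$, $W(\phi_1,\dots,\phi_i)\neq0$ on $[T,x_0[$ (no sign assumption). $Lu:=W(\phi_1,\dots,\phi_n,u)/W(\phi_1,\dots,\phi_n)$ (defined a.e.). With $W_i:=W(\phi_1,\dots,\phi_i)$, $W_0:=1$: $q_0:=1/|\phi_1|$, $q_i:=W_i^2/|W_{i-1}W_{i+1}|$ ($1\le i\le n-1$), $q_n:=|W_n/W_{n-1}|$; $M_0u:=q_0u$, $M_ku:=q_k(M_{k-1}u)'$. With $\widetilde W_i:=W(\phi_n,\dots,\phi_{n-i+1})$, $\widetilde W_0:=1$ (nonvanishing): $p_0:=1/|\phi_n|$, $p_i:=\widetilde W_i^2/|\widetilde W_{i-1}\widetilde W_{i+1}|$ ($1\le i\le n-1$), $p_n:=|\widetilde W_n/\widetilde W_{n-1}|$; $L_0u:=p_0u$, $L_ku:=p_k(L_{k-1}u)'$. *)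

theory Defs
  imports "HOL-Analysis.Analysis" "HOL-Library.Landau_Symbols" "Jordan_Normal_Form.Determinant"
begin

definition ivl :: "real \<Rightarrow> ereal \<Rightarrow> real set" where
  "ivl T x0 = {t. T \<le> t \<and> ereal t < x0}"

definition at_end :: "ereal \<Rightarrow> real filter" where
  "at_end x0 = (if x0 = \<infinity> then at_top else at_left (real_of_ereal x0))"

definition deriv_within :: "real set \<Rightarrow> (real \<Rightarrow> real) \<Rightarrow> real \<Rightarrow> real" where
  "deriv_within S g x = (SOME D. (g has_real_derivative D) (at x within S))"

fun hder :: "real set \<Rightarrow> nat \<Rightarrow> (real \<Rightarrow> real) \<Rightarrow> real \<Rightarrow> real" where
  "hder S 0 g = g"
| "hder S (Suc k) g = deriv_within S (hder S k g)"

definition abs_cont_on :: "real \<Rightarrow> real \<Rightarrow> (real \<Rightarrow> real) \<Rightarrow> bool" where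
  "abs_cont_on a b g \<longleftrightarrow> (\<forall>\<epsilon>>0. \<exists>\<delta>>0. \<forall>(m::nat) (u::nat \<Rightarrow> real) v.
      (\<forall>i<m. a \<le> u i \<and> u i \<le> v i \<and> v i \<le> b) \<and>
      (\<forall>i<m. \<forall>j<m. i \<noteq> j \<longrightarrow> v i \<le> u j \<or> v j \<le> u i) \<and>
      (\<Sum>i<m. v i - u i) < \<delta> \<longrightarrow> (\<Sum>i<m. \<bar>g (v i) - g (u i)\<bar>) < \<epsilon>)"

definition AC_on :: "real set \<Rightarrow> nat \<Rightarrow> (real \<Rightarrow> real) \<Rightarrow> bool" where
  "AC_on S k g \<longleftrightarrow> (\<forall>j<k. \<forall>x\<in>S. hder S j g differentiable (at x within S)) \<and>
      (\<forall>a b. a \<le> b \<and> {a..b} \<subseteq> S \<longrightarrow> abs_cont_on a b (hder S k g))"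

definition C_on :: "real set \<Rightarrow> nat \<Rightarrow> (real \<Rightarrow> real) \<Rightarrow> bool" where
  "C_on S k g \<longleftrightarrow> (\<forall>j<k. \<forall>x\<in>S. hder S j g differentiable (at x within S)) \<and>
      continuous_on S (hder S k g)"

definition wronskian :: "real set \<Rightarrow> (real \<Rightarrow> real) list \<Rightarrow> real \<Rightarrow> real" where
  "wronskian S gs x = (if gs = [] then 1 else
     det (mat (length gs) (length gs) (\<lambda>(i,j). hder S i (gs ! j) x)))"

definition Wf :: "real set \<Rightarrow> (nat \<Rightarrow> real \<Rightarrow> real) \<Rightarrow> nat \<Rightarrow> real \<Rightarrow> real" where
  "Wf S \<phi> i x = wronskian S (map \<phi> [1..<Suc i]) x"

definition Wr :: "real set \<Rightarrow> (nat \<Rightarrow> real \<Rightarrow> real) \<Rightarrow> nat \<Rightarrow> nat \<Rightarrow> real \<Rightarrow> real" where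
  "Wr S \<phi> n i x = wronskian S (map (\<lambda>j. \<phi> (n - j)) [0..<i]) x"

definition cheb_scale :: "real \<Rightarrow> ereal \<Rightarrow> nat \<Rightarrow> (nat \<Rightarrow> real \<Rightarrow> real) \<Rightarrow> bool" where
  "cheb_scale T x0 n \<phi> \<longleftrightarrow>
     (\<forall>i\<in>{1..n}. C_on (ivl T x0) (n - 1) (\<phi> i) \<and> (\<forall>\<^sub>F x in at_end x0. \<phi> i x \<noteq> 0)) \<and>
     (\<forall>i\<in>{1..<n}. ((\<lambda>x. \<phi> (Suc i) x / \<phi> i x) \<longlongrightarrow> 0) (at_end x0)) \<and>
     (\<forall>i\<in>{1..n}. \<forall>x\<in>ivl T x0. Wf (ivl T x0) \<phi> i x \<noteq> 0)"

definition Lop :: "real set \<Rightarrow> (nat \<Rightarrow> real \<Rightarrow> real) \<Rightarrow> nat \<Rightarrow> (real \<Rightarrow> real) \<Rightarrow> real \<Rightarrow> real" where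
  "Lop S \<phi> n u x = wronskian S (map \<phi> [1..<Suc n] @ [u]) x / Wf S \<phi> n x"

definition qw :: "real set \<Rightarrow> (nat \<Rightarrow> real \<Rightarrow> real) \<Rightarrow> nat \<Rightarrow> nat \<Rightarrow> real \<Rightarrow> real" where
  "qw S \<phi> n i x = (if i = 0 then 1 / \<bar>\<phi> 1 x\<bar>
     else if i < n then (Wf S \<phi> i x)\<^sup>2 / \<bar>Wf S \<phi> (i - 1) x * Wf S \<phi> (i + 1) x\<bar>
     else \<bar>Wf S \<phi> n x / Wf S \<phi> (n - 1) x\<bar>)"

definition pw :: "real set \<Rightarrow> (nat \<Rightarrow> real \<Rightarrow> real) \<Rightarrow> nat \<Rightarrow> nat \<Rightarrow> real \<Rightarrow> real" where
  "pw S \<phi> n i x = (if i = 0 then 1 / \<bar>\<phi> n x\<bar>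
     else if i < n then (Wr S \<phi> n i x)\<^sup>2 / \<bar>Wr S \<phi> n (i - 1) x * Wr S \<phi> n (i + 1) x\<bar>
     else \<bar>Wr S \<phi> n n x / Wr S \<phi> n (n - 1) x\<bar>)"

text \<open>Weighted iterated differential operators: D_0 u = w_0 u, D_k u = w_k (D_{k-1} u)'.
  With w = qw this is M_k, with w = pw this is L_k.\<close>
fun wop :: "real set \<Rightarrow> (nat \<Rightarrow> real \<Rightarrow> real) \<Rightarrow> nat \<Rightarrow> (real \<Rightarrow> real) \<Rightarrow> real \<Rightarrow> real" where
  "wop S w 0 u = (\<lambda>x. w 0 x * u x)"
| "wop S w (Suc k) u = (\<lambda>x. w (Suc k) x * deriv_within S (wop S w k u) x)"

fun iterA :: "(nat \<Rightarrow> real \<Rightarrow> real) \<Rightarrow> (real \<Rightarrow> real) \<Rightarrow> nat \<Rightarrow> ereal \<Rightarrow> nat \<Rightarrow> real \<Rightarrow> ennreal" where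
  "iterA p g n x0 0 s = (\<integral>\<^sup>+ t. ennreal (\<bar>g t\<bar> / p n t) * indicator {t. s \<le> t \<and> ereal t < x0} t \<partial>lborel)"
| "iterA p g n x0 (Suc m) s =
     (\<integral>\<^sup>+ t. (ennreal (1 / p (n - Suc m) t) * iterA p g n x0 m t) * indicator {t. s \<le> t \<and> ereal t < x0} t \<partial>lborel)"

fun iterB :: "(nat \<Rightarrow> real \<Rightarrow> real) \<Rightarrow> real \<Rightarrow> nat \<Rightarrow> real \<Rightarrow> ennreal" where
  "iterB p T 0 t = 1"
| "iterB p T (Suc j) t = (\<integral>\<^sup>+ s. (iterB p T j s * ennreal (1 / p (Suc j) s)) * indicator {T..t} s \<partial>lborel)"

end

theory Submission
  imports Defs
begin

text \<open>
  Both chains of operators have the form \<open>v\<^sub>k = \<plusminus> W(\<psi>\<^sub>1, \<dots>, \<psi>\<^sub>k, u) / W(\<psi>\<^sub>1, \<dots>, \<psi>\<^sub>k\<^sub>+\<^sub>1)\<close>, where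
  \<open>\<psi>\<close> is the list \<open>\<phi>\<^sub>1, \<dots>, \<phi>\<^sub>n\<close> for \<open>M\<^sub>k\<close> and the reversed list for \<open>L\<^sub>k\<close>. They satisfy
  \<open>v\<^sub>k' = v\<^sub>k\<^sub>+\<^sub>1 / w\<^sub>k\<^sub>+\<^sub>1\<close>, and \<open>\<bar>v\<^sub>n\<^sub>-\<^sub>1'\<bar> = \<bar>L[f]\<bar> / w\<^sub>n\<close> almost everywhere. The Wronskians of the reversed list
  do not vanish: a combination of the last \<open>i\<close> functions with a zero of order \<open>i\<close> would have \<open>n\<close> zeros,
  counting those at \<open>x\<^sub>0\<close>, and Rolle's theorem excludes this.

  If the iterated integral of \<open>\<bar>L[f]\<bar>\<close> for the weights \<open>w\<close> converges, then \<open>v\<^sub>n\<^sub>-\<^sub>1, \<dots>, v\<^sub>0\<close> successively have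
  limits after subtraction of suitable multiples of the \<open>\<psi>\<^sub>j\<close>, so that a remainder with \<open>v\<^sub>k \<rightarrow> 0\<close> for all
  \<open>k\<close> is left. The coefficients obtained from the two chains agree, because both remainders are
  \<open>o(\<phi>\<^sub>n)\<close>.

  By Tonelli's theorem the iterated integral is the integral of \<open>\<bar>L[f]\<bar>\<close> against a kernel. The kernels of the two
  chains are proportional: both give the value at \<open>T\<close> of the solution whose jet at \<open>t\<close> is
  \<open>(0, \<dots>, 0, 1)\<close>. For the weights \<open>q\<close> the kernel is \<open>1 / q\<^sub>n\<close> times an increasing bounded function, since
  \<open>1 / q\<^sub>i = \<bar>(M\<^sub>i\<^sub>-\<^sub>1 \<phi>\<^sub>i\<^sub>+\<^sub>1)'\<bar>\<close> is integrable.
\<close>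

subsection \<open>Functions of bounded variation\<close>

text \<open>\<open>L[f]\<close> contains derivatives of order n, which exist only almost everywhere;
  elsewhere \<open>hder\<close> takes whatever value the choice operator gives, so
  \<open>L[f]\<close> is not known to be measurable. Each integral of it is therefore handled
  through a Borel function h with \<open>\<bar>h\<bar> = \<bar>L[f]\<bar> / w_n\<close> almost
  everywhere. That increments of the last member of a chain are bounded by integrals of
  \<open>\<bar>h\<bar>\<close> has to come from the epsilon-delta form of absolute continuity; this
  is the purpose of Lebesgue's theorem on monotone functions and of the fundamental theorem for
  absolutely continuous functions. A second obstacle: growth relations are given for the \<phi>
  themselves, but limits of their images under M_k are needed. Passing from a quotient to the
  quotient of the derivatives is the direction in which L'Hopital's rule fails in general. It is
  saved by the fact that M_{n-1} maps every combination of the \<phi> to a constant: integrating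
  back from there, each M_k of a combination has eventually one sign, so the quotients cannot
  oscillate.\<close>

definition interval_family :: "real \<Rightarrow> real \<Rightarrow> nat \<Rightarrow> (nat \<Rightarrow> real) \<Rightarrow> (nat \<Rightarrow> real) \<Rightarrow> bool" where
  "interval_family a b m u v \<longleftrightarrow>
     (\<forall>i<m. a \<le> u i \<and> u i \<le> v i \<and> v i \<le> b) \<and>
     (\<forall>i<m. \<forall>j<m. i \<noteq> j \<longrightarrow> v i \<le> u j \<or> v j \<le> u i)"

definition variation_sum :: "(real \<Rightarrow> real) \<Rightarrow> nat \<Rightarrow> (nat \<Rightarrow> real) \<Rightarrow> (nat \<Rightarrow> real) \<Rightarrow> real" where
  "variation_sum g m u v = (\<Sum>i<m. \<bar>g (v i) - g (u i)\<bar>)"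

text \<open>The families need not exhaust \<open>{a..x}\<close>; filling the gaps only enlarges the
  sum, so this is the usual variation, expressed with the same families as
  \<open>abs_cont_on\<close>.\<close>

definition total_variation :: "(real \<Rightarrow> real) \<Rightarrow> real \<Rightarrow> real \<Rightarrow> real" where
  "total_variation g a x = Sup {variation_sum g m u v | m u v. interval_family a x m u v}"

lemma abs_cont_on_iff_variation_sum:
  "abs_cont_on a b g \<longleftrightarrow> (\<forall>\<epsilon>>0. \<exists>\<delta>>0. \<forall>m u v.
      interval_family a b m u v \<and> (\<Sum>i<m. v i - u i) < \<delta> \<longrightarrow> variation_sum g m u v < \<epsilon>)"
  unfolding abs_cont_on_def interval_family_def variation_sum_def by (simp add: conj_assoc)

lemma interval_family_0: "interval_family a b 0 u v"
  by (simp add: interval_family_def)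

lemma interval_family_mono:
  "interval_family x y m u v \<Longrightarrow> a \<le> x \<Longrightarrow> y \<le> b \<Longrightarrow> interval_family a b m u v"
  unfolding interval_family_def by force

text \<open>The open intervals are pairwise disjoint, so their lengths add up to the measure of a
  subset of \<open>{a..b}\<close>.\<close>

lemma interval_family_length:
  assumes f: "interval_family a b m u v" and "a \<le> b"
  shows "(\<Sum>i<m. v i - u i) \<le> b - a"
proof -
  have "(\<Sum>i<m. v i - u i) = (\<Sum>i<m. measure lborel {u i<..<v i})"
    using f by (intro sum.cong) (auto simp: interval_family_def)
  also have "\<dots> = measure lborel (\<Union>i<m. {u i<..<v i})"
  proof (rule measure_finite_Union[symmetric])
    show "disjoint_family_on (\<lambda>i. {u i<..<v i}) {..<m}"
      using f unfolding interval_family_def disjoint_family_on_def by force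
  next
    fix i assume "i \<in> {..<m}"
    then have "u i \<le> v i" using f by (auto simp: interval_family_def)
    then show "emeasure lborel {u i<..<v i} \<noteq> \<infinity>" by simp
  qed auto
  also have "\<dots> \<le> measure lborel {a..b}"
  proof (rule measure_mono_fmeasurable)
    show "(\<Union>i<m. {u i<..<v i}) \<subseteq> {a..b}"
      using f unfolding interval_family_def by force
  qed (use \<open>a \<le> b\<close> in \<open>auto simp: fmeasurable_def\<close>)
  finally show ?thesis using \<open>a \<le> b\<close> by simp
qed

text \<open>Clipping with \<open>min\<close> and \<open>max\<close> keeps the index set: an interval
  across y is cut in two, and one on a single side of y collapses to the point y on the other side,
  where it contributes nothing. Only a cut interval needs the triangle inequality.\<close>

lemma interval_family_split:
  assumes f: "interval_family a b m u v" and y: "a \<le> y" "y \<le> b"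
  shows "interval_family a y m (\<lambda>i. min (u i) y) (\<lambda>i. min (v i) y)"
    and "interval_family y b m (\<lambda>i. max (u i) y) (\<lambda>i. max (v i) y)"
    and "variation_sum g m u v \<le> variation_sum g m (\<lambda>i. min (u i) y) (\<lambda>i. min (v i) y)
           + variation_sum g m (\<lambda>i. max (u i) y) (\<lambda>i. max (v i) y)"
proof -
  show "interval_family a y m (\<lambda>i. min (u i) y) (\<lambda>i. min (v i) y)"
    unfolding interval_family_def
  proof (intro conjI allI impI)
    fix i assume "i < m"
    then have "a \<le> u i" "u i \<le> v i" "v i \<le> b" using f unfolding interval_family_def by auto
    then show "a \<le> min (u i) y" "min (u i) y \<le> min (v i) y" "min (v i) y \<le> y" using y by auto
  next
    fix i j assume "i < m" "j < m" "i \<noteq> j"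
    then have "v i \<le> u j \<or> v j \<le> u i" using f unfolding interval_family_def by blast
    then show "min (v i) y \<le> min (u j) y \<or> min (v j) y \<le> min (u i) y" by (auto simp: min_def max_def)
  qed
  show "interval_family y b m (\<lambda>i. max (u i) y) (\<lambda>i. max (v i) y)"
    unfolding interval_family_def
  proof (intro conjI allI impI)
    fix i assume "i < m"
    then have "a \<le> u i" "u i \<le> v i" "v i \<le> b" using f unfolding interval_family_def by auto
    then show "y \<le> max (u i) y" "max (u i) y \<le> max (v i) y" "max (v i) y \<le> b" using y by auto
  next
    fix i j assume "i < m" "j < m" "i \<noteq> j"
    then have "v i \<le> u j \<or> v j \<le> u i" using f unfolding interval_family_def by blast
    then show "max (v i) y \<le> max (u j) y \<or> max (v j) y \<le> max (u i) y" by (auto simp: min_def max_def)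
  qed
  show "variation_sum g m u v \<le> variation_sum g m (\<lambda>i. min (u i) y) (\<lambda>i. min (v i) y)
           + variation_sum g m (\<lambda>i. max (u i) y) (\<lambda>i. max (v i) y)"
    unfolding variation_sum_def sum.distrib[symmetric]
    by (rule sum_mono) (auto simp: min_def max_def)
qed

lemma interval_family_append:
  assumes f: "interval_family a x m u v" and xy: "a \<le> x" "x \<le> y"
  shows "interval_family a y (Suc m) (u(m := x)) (v(m := y))"
    and "variation_sum g (Suc m) (u(m := x)) (v(m := y)) = variation_sum g m u v + \<bar>g y - g x\<bar>"
proof -
  show "interval_family a y (Suc m) (u(m := x)) (v(m := y))"
    using f xy unfolding interval_family_def by (auto simp: less_Suc_eq)
  show "variation_sum g (Suc m) (u(m := x)) (v(m := y)) = variation_sum g m u v + \<bar>g y - g x\<bar>"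
    by (simp add: variation_sum_def)
qed

text \<open>Turns sums over a division, which is a finite set of intervals, into sums over an
  indexed family, so that absolute continuity applies to them.\<close>

lemma interval_family_of_finite_set:
  fixes U V :: "'i \<Rightarrow> real"
  assumes "finite P" and UV: "\<And>i. i \<in> P \<Longrightarrow> a \<le> U i \<and> U i \<le> V i \<and> V i \<le> b"
    and no: "\<And>i j. i \<in> P \<Longrightarrow> j \<in> P \<Longrightarrow> i \<noteq> j \<Longrightarrow> V i \<le> U j \<or> V j \<le> U i"
  obtains m u v where "interval_family a b m u v"
    "variation_sum g m u v = (\<Sum>i\<in>P. \<bar>g (V i) - g (U i)\<bar>)"
    "(\<Sum>i<m. v i - u i) = (\<Sum>i\<in>P. V i - U i)"
proof -
  obtain h where h: "bij_betw h {..<card P} P"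
    using ex_bij_betw_nat_finite[OF \<open>finite P\<close>] by (auto simp: atLeast0LessThan)
  have hP: "h i \<in> P" if "i < card P" for i
    using h that by (auto simp: bij_betw_def)
  have inj: "h i \<noteq> h j" if "i < card P" "j < card P" "i \<noteq> j" for i j
    using h that by (auto simp: bij_betw_def inj_on_def)
  show ?thesis
  proof (rule that[of "card P" "\<lambda>i. U (h i)" "\<lambda>i. V (h i)"])
    show "interval_family a b (card P) (\<lambda>i. U (h i)) (\<lambda>i. V (h i))"
      unfolding interval_family_def using UV[OF hP] no[OF hP hP inj] by simp
    show "variation_sum g (card P) (\<lambda>i. U (h i)) (\<lambda>i. V (h i)) = (\<Sum>i\<in>P. \<bar>g (V i) - g (U i)\<bar>)"
      unfolding variation_sum_def by (rule sum.reindex_bij_betw[OF h])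
    show "(\<Sum>i<card P. V (h i) - U (h i)) = (\<Sum>i\<in>P. V i - U i)"
      by (rule sum.reindex_bij_betw[OF h])
  qed
qed

lemma abs_cont_on_short_intervals:
  assumes "abs_cont_on a b g" "\<epsilon> > 0"
  obtains \<delta> where "\<delta> > 0"
    "\<And>x y m u v. \<lbrakk>a \<le> x; x \<le> y; y \<le> b; y - x < \<delta>; interval_family x y m u v\<rbrakk>
      \<Longrightarrow> variation_sum g m u v < \<epsilon>"
proof -
  obtain \<delta> where d: "\<delta> > 0" "\<And>m u v. interval_family a b m u v \<Longrightarrow> (\<Sum>i<m. v i - u i) < \<delta>
      \<Longrightarrow> variation_sum g m u v < \<epsilon>"
    using assms(1)[unfolded abs_cont_on_iff_variation_sum, rule_format, OF assms(2)] by auto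
  show ?thesis
  proof (rule that[OF d(1)])
    fix x y m u v
    assume "a \<le> x" "x \<le> y" "y \<le> b" "y - x < \<delta>" "interval_family x y m u v"
    then show "variation_sum g m u v < \<epsilon>"
      using d(2)[of m u v] interval_family_mono[of x y m u v a b] interval_family_length[of x y m u v]
      by linarith
  qed
qed

text \<open>For \<epsilon> = 1, a piece of length below \<delta> contributes less than 1 to a
  variation sum, and finitely many such pieces exhaust \<open>{a..b}\<close>.\<close>

lemma abs_cont_on_bounded_variation:
  assumes ac: "abs_cont_on a b g"
  obtains B where "\<And>m u v. interval_family a b m u v \<Longrightarrow> variation_sum g m u v \<le> B"
proof -
  obtain \<delta> where d: "\<delta> > 0"
    "\<And>x y m u v. \<lbrakk>a \<le> x; x \<le> y; y \<le> b; y - x < \<delta>; interval_family x y m u v\<rbrakk>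
      \<Longrightarrow> variation_sum g m u v < 1"
    using abs_cont_on_short_intervals[OF ac, of 1] by auto
  have bnd: "variation_sum g m u v \<le> real k"
    if "a \<le> x" "x \<le> b" "x \<le> a + real k * (\<delta>/2)" "interval_family a x m u v" for k x m u v
    using that
  proof (induction k arbitrary: x m u v)
    case 0
    then have "x = a" by simp
    then have "\<forall>i<m. u i = a \<and> v i = a" using 0 unfolding interval_family_def by force
    then show ?case by (simp add: variation_sum_def)
  next
    case (Suc k)
    \<comment> \<open>The piece cut off on the right has length at most \<open>\<delta>/2\<close>,
      because the bound for short intervals asks for length strictly below \<delta>; the maximum
      keeps y in \<open>{a..x}\<close>.\<close>
    define y where "y = max a (x - \<delta>/2)"
    have y: "a \<le> y" "y \<le> x" "x - y < \<delta>" "y \<le> b" "y \<le> a + real k * (\<delta>/2)"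
      using Suc.prems d(1) by (auto simp: y_def max_def field_simps)
    note sp = interval_family_split[OF Suc.prems(4) y(1,2)]
    have "variation_sum g m (\<lambda>i. min (u i) y) (\<lambda>i. min (v i) y) \<le> real k"
      using Suc.IH[OF y(1,4,5) sp(1)] .
    moreover have "variation_sum g m (\<lambda>i. max (u i) y) (\<lambda>i. max (v i) y) < 1"
      using d(2)[OF y(1,2) Suc.prems(2) y(3) sp(2)] .
    ultimately show ?case using sp(3)[of g] by simp
  qed
  obtain k :: nat where k: "b - a \<le> real k * (\<delta>/2)"
    using d(1) real_arch_simple[of "(b - a) / (\<delta>/2)"] by (auto simp: field_simps)
  show ?thesis
  proof (rule that)
    fix m u v assume f: "interval_family a b m u v"
    show "variation_sum g m u v \<le> real k"
    proof (cases "a \<le> b")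
      case True
      then show ?thesis using bnd[of b k m u v] k f by simp
    next
      case False
      then have "m = 0" using f unfolding interval_family_def by force
      then show ?thesis by (simp add: variation_sum_def)
    qed
  qed
qed

lemma variation_sum_le_total_variation:
  assumes ac: "abs_cont_on a b g" and "x \<le> b" and f: "interval_family a x m u v"
  shows "variation_sum g m u v \<le> total_variation g a x"
proof -
  obtain B where B: "\<And>m u v. interval_family a b m u v \<Longrightarrow> variation_sum g m u v \<le> B"
    using abs_cont_on_bounded_variation[OF ac] by metis
  have "bdd_above {variation_sum g m u v | m u v. interval_family a x m u v}"
    using B interval_family_mono[of a x _ _ _ a b] \<open>x \<le> b\<close> by (intro bdd_aboveI[of _ B]) auto
  then show ?thesis
    unfolding total_variation_def using f by (intro cSup_upper) auto
qed

lemma total_variation_least: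
  assumes "\<And>m u v. interval_family a x m u v \<Longrightarrow> variation_sum g m u v \<le> B"
  shows "total_variation g a x \<le> B"
  unfolding total_variation_def
proof (rule cSup_least)
  show "{variation_sum g m u v | m u v. interval_family a x m u v} \<noteq> {}"
    using interval_family_0[of a x] by blast
qed (use assms in blast)

text \<open>Any family in \<open>{a..x}\<close> can be prolonged by the interval from x to y. The
  bound shows that the variation, and the variation minus g, both increase with the upper limit: the
  Jordan decomposition used below.\<close>

lemma total_variation_increment:
  assumes ac: "abs_cont_on a b g" and xy: "a \<le> x" "x \<le> y" "y \<le> b"
  shows "\<bar>g y - g x\<bar> \<le> total_variation g a y - total_variation g a x"
proof -
  have "total_variation g a x \<le> total_variation g a y - \<bar>g y - g x\<bar>"
  proof (rule total_variation_least)
    fix m u v assume f: "interval_family a x m u v"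
    show "variation_sum g m u v \<le> total_variation g a y - \<bar>g y - g x\<bar>"
      using variation_sum_le_total_variation[OF ac xy(3) interval_family_append(1)[OF f xy(1,2)]]
        interval_family_append(2)[OF f xy(1,2), of g] by simp
  qed
  then show ?thesis by simp
qed

lemma total_variation_uniform:
  assumes ac: "abs_cont_on a b g" and "\<epsilon> > 0"
  obtains \<delta> where "\<delta> > 0" "\<And>x y. \<lbrakk>a \<le> x; x \<le> y; y \<le> b; y - x < \<delta>\<rbrakk>
     \<Longrightarrow> total_variation g a y - total_variation g a x \<le> \<epsilon>"
proof -
  obtain \<delta> where d: "\<delta> > 0"
    "\<And>x y m u v. \<lbrakk>a \<le> x; x \<le> y; y \<le> b; y - x < \<delta>; interval_family x y m u v\<rbrakk>
      \<Longrightarrow> variation_sum g m u v < \<epsilon>"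
    using abs_cont_on_short_intervals[OF assms] by metis
  show ?thesis
  proof (rule that[OF d(1)])
    fix x y assume xy: "a \<le> x" "x \<le> y" "y \<le> b" "y - x < \<delta>"
    have "total_variation g a y \<le> total_variation g a x + \<epsilon>"
    proof (rule total_variation_least)
      fix m u v assume f: "interval_family a y m u v"
      note sp = interval_family_split[OF f xy(1,2)]
      show "variation_sum g m u v \<le> total_variation g a x + \<epsilon>"
        using sp(3)[of g] variation_sum_le_total_variation[OF ac _ sp(1)] d(2)[OF xy sp(2)] xy
        by linarith
    qed
    then show "total_variation g a y - total_variation g a x \<le> \<epsilon>" by simp
  qed
qed

lemma continuous_on_total_variation:
  assumes ac: "abs_cont_on a b g"
  shows "continuous_on {a..b} (total_variation g a)"
  unfolding continuous_on_iff
proof (intro ballI allI impI)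
  fix x e :: real assume x: "x \<in> {a..b}" and "e > 0"
  obtain \<delta> where d: "\<delta> > 0" "\<And>x y. \<lbrakk>a \<le> x; x \<le> y; y \<le> b; y - x < \<delta>\<rbrakk>
     \<Longrightarrow> total_variation g a y - total_variation g a x \<le> e / 2"
    using total_variation_uniform[OF ac, of "e/2"] \<open>e > 0\<close> by auto
  show "\<exists>d>0. \<forall>x'\<in>{a..b}. dist x' x < d \<longrightarrow> dist (total_variation g a x') (total_variation g a x) < e"
  proof (intro exI[of _ \<delta>] conjI ballI impI)
    fix y assume y: "y \<in> {a..b}" "dist y x < \<delta>"
    have mono: "total_variation g a p \<le> total_variation g a q" if "a \<le> p" "p \<le> q" "q \<le> b" for p q
      using total_variation_increment[OF ac that] by simp
    show "dist (total_variation g a y) (total_variation g a x) < e"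
    proof (cases "x \<le> y")
      case True
      then show ?thesis using d(2)[of x y] mono[of x y] x y \<open>e > 0\<close> unfolding dist_real_def by force
    next
      case False
      then show ?thesis using d(2)[of y x] mono[of y x] x y \<open>e > 0\<close> unfolding dist_real_def by force
    qed
  qed (rule d(1))
qed

lemma abs_cont_on_imp_continuous_on:
  assumes ac: "abs_cont_on a b g"
  shows "continuous_on {a..b} g"
  unfolding continuous_on_iff
proof (intro ballI allI impI)
  fix x e :: real assume x: "x \<in> {a..b}" and "e > 0"
  have c: "continuous_on {a..b} (total_variation g a)"
    by (rule continuous_on_total_variation[OF ac])
  then obtain d where d: "d > 0" "\<And>y. y \<in> {a..b} \<Longrightarrow> dist y x < d \<Longrightarrow>
      dist (total_variation g a y) (total_variation g a x) < e"
    using x \<open>e > 0\<close> unfolding continuous_on_iff by blast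
  have "dist (g y) (g x) < e" if "y \<in> {a..b}" "dist y x < d" for y
  proof (cases "x \<le> y")
    case True
    then show ?thesis using d(2)[OF that] total_variation_increment[OF ac, of x y] x that
      unfolding dist_real_def by simp
  next
    case False
    then show ?thesis using d(2)[OF that] total_variation_increment[OF ac, of y x] x that
      unfolding dist_real_def by simp
  qed
  then show "\<exists>d>0. \<forall>x'\<in>{a..b}. dist x' x < d \<longrightarrow> dist (g x') (g x) < e"
    using d(1) by blast
qed

subsection \<open>Differentiability of monotone functions\<close>

text \<open>The hypothesis gives, at each point of E, arbitrarily short intervals with this point as
  an endpoint, hence a Vitali cover. The covering theorem speaks of balls, so a pair of endpoints is
  read as the ball around its midpoint.\<close>

lemma vitali_covering_intervals:
  fixes P :: "real \<Rightarrow> real \<Rightarrow> bool"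
  assumes "open U" "E \<subseteq> U" and fr: "\<And>x. x \<in> E \<Longrightarrow> \<exists>\<^sub>F y in at x. P (min x y) (max x y)"
  obtains C where "countable C"
    "\<And>c. c \<in> C \<Longrightarrow> fst c < snd c \<and> {fst c..snd c} \<subseteq> U \<and> P (fst c) (snd c)"
    "disjoint_family_on (\<lambda>c. {fst c..snd c}) C"
    "negligible (E - (\<Union>c\<in>C. {fst c..snd c}))"
proof -
  define K where "K = {c. fst c < snd c \<and> {fst c..snd c} \<subseteq> U \<and> P (fst c) (snd c)}"
  define mid rad where "mid c = (fst c + snd c) / 2" and "rad c = (snd c - fst c) / 2" for c :: "real \<times> real"
  have cb: "cball (mid c) (rad c) = {fst c..snd c}" for c
    unfolding cball_eq_atLeastAtMost mid_def rad_def by (simp add: field_simps)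
  have rpos: "0 < rad c" if "c \<in> K" for c
    using that by (simp add: K_def rad_def)
  have cov: "\<exists>c. c \<in> K \<and> x \<in> cball (mid c) (rad c) \<and> rad c < d" if "x \<in> E" "0 < d" for x d
  proof -
    obtain e where e: "e > 0" "ball x e \<subseteq> U"
      using assms(1,2) \<open>x \<in> E\<close> by (meson openE subsetD)
    have "\<exists>y. y \<noteq> x \<and> dist y x < min e d \<and> P (min x y) (max x y)"
    proof (rule ccontr)
      assume "\<not> ?thesis"
      then have "eventually (\<lambda>y. \<not> P (min x y) (max x y)) (at x)"
        unfolding eventually_at using e(1) \<open>0 < d\<close> by (intro exI[of _ "min e d"]) auto
      then show False using fr[OF \<open>x \<in> E\<close>] by (simp add: frequently_def)
    qed
    then obtain y where y: "y \<noteq> x" "dist y x < min e d" "P (min x y) (max x y)" by blast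
    have "{min x y..max x y} \<subseteq> ball x e"
      using y(2) by (auto simp: dist_real_def min_def max_def split: if_splits)
    then have "(min x y, max x y) \<in> K"
      using y e(2) by (auto simp: K_def min_def max_def)
    moreover have "x \<in> {min x y..max x y}" by auto
    moreover have "rad (min x y, max x y) < d"
      using y(2) \<open>0 < d\<close> by (auto simp: rad_def dist_real_def min_def max_def split: if_splits)
    ultimately show ?thesis unfolding cb by (intro exI[of _ "(min x y, max x y)"]) auto
  qed
  obtain C where C: "countable C" "C \<subseteq> K"
     "pairwise (\<lambda>i j. disjnt (cball (mid i) (rad i)) (cball (mid j) (rad j))) C"
     "negligible (E - (\<Union>i\<in>C. cball (mid i) (rad i)))"
    by (rule Vitali_covering_theorem_cballs[of K rad E mid, OF rpos cov]) (auto intro: that)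
  show ?thesis
  proof (rule that[OF C(1)])
    show "fst c < snd c \<and> {fst c..snd c} \<subseteq> U \<and> P (fst c) (snd c)" if "c \<in> C" for c
      using C(2) that by (auto simp: K_def)
    show "disjoint_family_on (\<lambda>c. {fst c..snd c}) C"
      using C(3) unfolding cb pairwise_def disjoint_family_on_def disjnt_def by blast
    show "negligible (E - (\<Union>c\<in>C. {fst c..snd c}))"
      using C(4) unfolding cb .
  qed
qed

lemma emeasure_UN_Icc_mono:
  fixes C :: "(real \<times> real) set"
  assumes "countable C" "disjoint_family_on (\<lambda>c. {fst c..snd c}) C" and [simp]: "sets M = sets borel" "sets N = sets borel"
    and le: "\<And>c. c \<in> C \<Longrightarrow> r * emeasure M {fst c..snd c} \<le> s * emeasure N {fst c..snd c}"
  shows "r * emeasure M (\<Union>c\<in>C. {fst c..snd c}) \<le> s * emeasure N (\<Union>c\<in>C. {fst c..snd c})"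
proof -
  have UN: "k * emeasure L (\<Union>c\<in>C. {fst c..snd c}) = (\<integral>\<^sup>+c. k * emeasure L {fst c..snd c} \<partial>count_space C)"
    if "sets L = sets borel" for k and L :: "real measure"
    using assms(1,2) that by (subst emeasure_UN_countable) (auto simp: nn_integral_cmult)
  show ?thesis
    unfolding UN[OF assms(3)] UN[OF assms(4)] by (rule nn_integral_mono) (use le in auto)
qed

context
  fixes F :: "real \<Rightarrow> real"
  assumes mono_F: "\<And>x y. x \<le> y \<Longrightarrow> F x \<le> F y" and cont_F: "continuous_on UNIV F"
begin

private lemma emeasure_Icc: "p \<le> q \<Longrightarrow> emeasure (interval_measure F) {p..q} = ennreal (F q - F p)"
  using emeasure_interval_measure_Icc[OF _ mono_F cont_F] by simp

text \<open>On a Vitali interval with difference quotient at least s, the Stieltjes measure of F is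
  at least s times the length; disjointness lets these inequalities be added.\<close>

private lemma cover_steep:
  assumes "open U" "E \<subseteq> U" "0 \<le> s"
    and fr: "\<And>x. x \<in> E \<Longrightarrow> \<exists>\<^sub>F y in at x. s * (max x y - min x y) \<le> F (max x y) - F (min x y)"
  obtains J where "J \<in> sets borel" "J \<subseteq> U" "negligible (E - J)"
    "ennreal s * emeasure lborel J \<le> emeasure (interval_measure F) J"
proof -
  obtain C where C: "countable C"
    "\<And>c. c \<in> C \<Longrightarrow> fst c < snd c \<and> {fst c..snd c} \<subseteq> U \<and> s * (snd c - fst c) \<le> F (snd c) - F (fst c)"
    "disjoint_family_on (\<lambda>c. {fst c..snd c}) C"
    "negligible (E - (\<Union>c\<in>C. {fst c..snd c}))"
    by (rule vitali_covering_intervals[OF assms(1,2), where P = "\<lambda>p q. s * (q - p) \<le> F q - F p", OF fr], assumption, rule that)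
  have "ennreal s * emeasure lborel (\<Union>c\<in>C. {fst c..snd c})
      \<le> 1 * emeasure (interval_measure F) (\<Union>c\<in>C. {fst c..snd c})"
  proof (rule emeasure_UN_Icc_mono[OF C(1,3)])
    fix c assume "c \<in> C"
    then have c: "fst c < snd c" "s * (snd c - fst c) \<le> F (snd c) - F (fst c)" using C(2) by auto
    show "ennreal s * emeasure lborel {fst c..snd c} \<le> 1 * emeasure (interval_measure F) {fst c..snd c}"
      using c \<open>0 \<le> s\<close> by (simp add: emeasure_Icc ennreal_mult'[symmetric] ennreal_leI)
  qed auto
  then show ?thesis
    using C by (intro that[of "\<Union>c\<in>C. {fst c..snd c}"]) (auto intro!: sets.countable_UN'')
qed

text \<open>I' consists of the interiors of the chosen intervals. It is open, so a second Vitali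
  cover can be formed inside it, and removing the countably many endpoints costs only a null
  set.\<close>

private lemma cover_flat:
  assumes "open U" "E \<subseteq> U" "0 \<le> r"
    and fr: "\<And>x. x \<in> E \<Longrightarrow> \<exists>\<^sub>F y in at x. F (max x y) - F (min x y) \<le> r * (max x y - min x y)"
  obtains I I' where "I \<in> sets borel" "I \<subseteq> U" "open I'" "I' \<subseteq> I" "negligible (E - I')"
    "emeasure (interval_measure F) I \<le> ennreal r * emeasure lborel I"
proof -
  obtain C where C: "countable C"
    "\<And>c. c \<in> C \<Longrightarrow> fst c < snd c \<and> {fst c..snd c} \<subseteq> U \<and> F (snd c) - F (fst c) \<le> r * (snd c - fst c)"
    "disjoint_family_on (\<lambda>c. {fst c..snd c}) C"
    "negligible (E - (\<Union>c\<in>C. {fst c..snd c}))"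
    by (rule vitali_covering_intervals[OF assms(1,2), where P = "\<lambda>p q. F q - F p \<le> r * (q - p)", OF fr], assumption, rule that)
  have "1 * emeasure (interval_measure F) (\<Union>c\<in>C. {fst c..snd c})
      \<le> ennreal r * emeasure lborel (\<Union>c\<in>C. {fst c..snd c})"
  proof (rule emeasure_UN_Icc_mono[OF C(1,3)])
    fix c assume "c \<in> C"
    then have c: "fst c < snd c" "F (snd c) - F (fst c) \<le> r * (snd c - fst c)" using C(2) by auto
    show "1 * emeasure (interval_measure F) {fst c..snd c} \<le> ennreal r * emeasure lborel {fst c..snd c}"
      using c \<open>0 \<le> r\<close> by (simp add: emeasure_Icc ennreal_mult'[symmetric] ennreal_leI)
  qed auto
  then have le: "emeasure (interval_measure F) (\<Union>c\<in>C. {fst c..snd c})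
     \<le> ennreal r * emeasure lborel (\<Union>c\<in>C. {fst c..snd c})" by simp
  have "negligible ((E - (\<Union>c\<in>C. {fst c..snd c})) \<union> (fst ` C \<union> snd ` C))"
    using C(1,4) countable_imp_null_set_lborel[of "fst ` C"] countable_imp_null_set_lborel[of "snd ` C"]
    by (intro negligible_Un) (auto simp: negligible_iff_null_sets intro: null_sets_completionI)
  moreover have "E - (\<Union>c\<in>C. {fst c<..<snd c}) \<subseteq> (E - (\<Union>c\<in>C. {fst c..snd c})) \<union> (fst ` C \<union> snd ` C)"
  proof
    fix x assume x: "x \<in> E - (\<Union>c\<in>C. {fst c<..<snd c})"
    show "x \<in> (E - (\<Union>c\<in>C. {fst c..snd c})) \<union> (fst ` C \<union> snd ` C)"
    proof (cases "x \<in> (\<Union>c\<in>C. {fst c..snd c})")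
      case True
      then obtain c where "c \<in> C" "fst c \<le> x" "x \<le> snd c" by auto
      moreover have "\<not> (fst c < x \<and> x < snd c)" using x \<open>c \<in> C\<close> by auto
      ultimately have "x = fst c \<or> x = snd c" by linarith
      then show ?thesis using \<open>c \<in> C\<close> by auto
    qed (use x in auto)
  qed
  ultimately have neg: "negligible (E - (\<Union>c\<in>C. {fst c<..<snd c}))"
    by (rule negligible_subset)
  show ?thesis
  proof (rule that[of "\<Union>c\<in>C. {fst c..snd c}" "\<Union>c\<in>C. {fst c<..<snd c}"])
    show "(\<Union>c\<in>C. {fst c..snd c}) \<in> sets borel" using C(1) by (intro sets.countable_UN'') auto
    show "(\<Union>c\<in>C. {fst c<..<snd c}) \<subseteq> (\<Union>c\<in>C. {fst c..snd c})" by fastforce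
  qed (use C le neg in auto)
qed

text \<open>Double covering: flat intervals inside an open U barely larger than E carry mass at most
  r times the measure of U; steep intervals inside the flat ones still cover almost all of E and
  carry mass at least s times its outer measure. For r < s this forces outer measure zero.\<close>

private lemma negligible_steep_and_flat:
  assumes E: "E \<subseteq> {-N<..<N}" and rs: "0 \<le> r" "r < s"
    and frs: "\<And>x. x \<in> E \<Longrightarrow> \<exists>\<^sub>F y in at x. s * (max x y - min x y) \<le> F (max x y) - F (min x y)"
    and frr: "\<And>x. x \<in> E \<Longrightarrow> \<exists>\<^sub>F y in at x. F (max x y) - F (min x y) \<le> r * (max x y - min x y)"
  shows "negligible E"
proof (rule ccontr)
  assume "\<not> negligible E"
  then obtain e where e: "e > 0" "\<And>T. E \<subseteq> T \<Longrightarrow> T \<in> lmeasurable \<Longrightarrow> e \<le> measure lebesgue T"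
    unfolding negligible_outer by (auto simp: not_less)
  \<comment> \<open>E is not known to be measurable, so its outer measure m is formed by hand; it is
    positive because E is not negligible.\<close>
  define A where "A = {measure lebesgue T | T. E \<subseteq> T \<and> T \<in> lmeasurable}"
  define m where "m = Inf A"
  have Ine: "{-N<..<N} \<in> lmeasurable" using lmeasurable_box[of "-N" N] by (simp add: box_real)
  have A: "A \<noteq> {}" "bdd_below A"
    using E Ine e unfolding A_def by (auto intro!: bdd_belowI[of _ e])
  have "e \<le> m" unfolding m_def using A e by (intro cInf_greatest) (auto simp: A_def)
  then have m: "m > 0" using e(1) by simp
  have mle: "m \<le> measure lebesgue T" if "E \<subseteq> T" "T \<in> lmeasurable" for T
    unfolding m_def by (rule cInf_lower) (use A that in \<open>auto simp: A_def\<close>)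
  \<comment> \<open>Makes \<open>r * (m + 2 * \<epsilon>) < s * m\<close>; the factor
    \<open>r + 1\<close> instead of r covers r = 0. One \<epsilon> is lost in choosing T and one in
    passing to the open set V.\<close>
  define \<epsilon> where "\<epsilon> = (s - r) * m / (4 * (r + 1))"
  have eps: "\<epsilon> > 0" "r * (m + 2 * \<epsilon>) < s * m"
  proof -
    show "\<epsilon> > 0" using rs m by (auto simp: \<epsilon>_def)
    have "r * (2 * \<epsilon>) = (r / (r + 1)) * ((s - r) * m) / 2" using rs by (simp add: \<epsilon>_def field_simps)
    also have "\<dots> \<le> 1 * ((s - r) * m) / 2"
      using rs m by (intro divide_right_mono mult_right_mono) auto
    also have "\<dots> < (s - r) * m" using rs m by simp
    finally show "r * (m + 2 * \<epsilon>) < s * m" by (simp add: algebra_simps)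
  qed
  have "\<exists>x\<in>A. x < m + \<epsilon>"
    using cInf_lessD[OF A(1), of "m + \<epsilon>"] eps(1) unfolding m_def by auto
  then obtain T where T: "E \<subseteq> T" "T \<in> lmeasurable" "measure lebesgue T < m + \<epsilon>"
    by (auto simp: A_def)
  have "T \<in> sets lebesgue" using T(2) by auto
  then obtain V where V: "open V" "T \<subseteq> V" "V - T \<in> lmeasurable" "emeasure lebesgue (V - T) < ennreal \<epsilon>"
    using sets_lebesgue_outer_open eps(1) by metis
  define U where "U = V \<inter> {-N<..<N}"
  have U: "open U" "E \<subseteq> U" using V T E unfolding U_def by auto
  have bU: "bounded U" by (rule bounded_subset[of "{-N..N}"]) (auto simp: U_def)
  have Um: "U \<in> lmeasurable" by (rule lmeasurable_open[OF bU U(1)])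
  have VT: "measure lebesgue (V - T) < \<epsilon>"
    using V(3,4) eps(1) by (simp add: emeasure_eq_measure2 ennreal_less_iff)
  have "measure lebesgue U \<le> measure lebesgue (T \<union> (V - T))"
  proof (rule measure_mono_fmeasurable)
    show "T \<union> (V - T) \<in> lmeasurable" using T(2) V(3) by (rule fmeasurable.Un)
  qed (use V(2) Um in \<open>auto simp: U_def\<close>)
  also have "\<dots> \<le> measure lebesgue T + measure lebesgue (V - T)"
    using T(2) V(3) by (intro measure_Un_le) auto
  finally have mU: "measure lebesgue U < m + 2 * \<epsilon>" using T(3) VT by simp
  obtain I I' where I: "I \<in> sets borel" "I \<subseteq> U" "open I'" "I' \<subseteq> I" "negligible (E - I')"
    "emeasure (interval_measure F) I \<le> ennreal r * emeasure lborel I"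
    by (rule cover_flat[OF U rs(1) frr]) (auto intro: that)
  obtain J where J: "J \<in> sets borel" "J \<subseteq> I'" "negligible (E \<inter> I' - J)"
    "ennreal s * emeasure lborel J \<le> emeasure (interval_measure F) J"
    by (rule cover_steep[OF I(3), of "E \<inter> I'" s]) (use frs rs in auto)
  have "bounded J" using J(2) I(2,4) bU by (meson bounded_subset)
  then have Jm: "J \<in> lmeasurable" using J(1) by (intro bounded_set_imp_lmeasurable) auto
  have null: "negligible ((E - I') \<union> (E \<inter> I' - J))" using I(5) J(3) by (rule negligible_Un)
  have "m \<le> measure lebesgue (J \<union> ((E - I') \<union> (E \<inter> I' - J)))"
    using Jm negligible_imp_measurable[OF null] by (intro mle) auto
  also have "\<dots> \<le> measure lebesgue J + measure lebesgue ((E - I') \<union> (E \<inter> I' - J))"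
    using Jm negligible_imp_measurable[OF null] by (intro measure_Un_le) auto
  finally have mJ: "m \<le> measure lebesgue J" using negligible_imp_measure0[OF null] by simp
  have eJ: "emeasure lborel J = ennreal (measure lebesgue J)"
    using Jm J(1) emeasure_eq_measure2[OF Jm] by simp
  have eU: "emeasure lborel U = ennreal (measure lebesgue U)"
    using Um U(1) emeasure_eq_measure2[OF Um] by simp
  have "ennreal s * emeasure lborel J \<le> emeasure (interval_measure F) I"
    using J I by (intro order_trans[OF J(4)] emeasure_mono) auto
  also have "\<dots> \<le> ennreal r * emeasure lborel U"
    using I U(1) by (intro order_trans[OF I(6)] mult_left_mono emeasure_mono) auto
  finally have "ennreal (s * measure lebesgue J) \<le> ennreal (r * measure lebesgue U)"
    using rs unfolding eJ eU by (simp add: ennreal_mult)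
  then have "s * measure lebesgue J \<le> r * measure lebesgue U"
    using rs by (subst (asm) ennreal_le_iff) auto
  moreover have "s * m \<le> s * measure lebesgue J" using mJ rs by (intro mult_left_mono) auto
  moreover have "r * measure lebesgue U \<le> r * (m + 2 * \<epsilon>)" using mU rs by (intro mult_left_mono) auto
  ultimately show False using eps(2) by linarith
qed

text \<open>A covering set on which the slope is at least \<open>M / e\<close> has measure at most
  e, because the whole window carries Stieltjes mass at most M.\<close>

private lemma negligible_infinitely_steep:
  assumes E: "E \<subseteq> {-N<..<N}"
    and fr: "\<And>x s. x \<in> E \<Longrightarrow> \<exists>\<^sub>F y in at x. s * (max x y - min x y) \<le> F (max x y) - F (min x y)"
  shows "negligible E"
  unfolding negligible_outer_le
proof (intro allI impI)
  fix e :: real assume "e > 0"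
  define M where "M = max 1 (F N - F (- N))"
  have M: "M > 0" "F N - F (-N) \<le> M" by (auto simp: M_def)
  obtain J where J: "J \<in> sets borel" "J \<subseteq> {-N<..<N}" "negligible (E - J)"
    "ennreal (M / e) * emeasure lborel J \<le> emeasure (interval_measure F) J"
    by (rule cover_steep[OF open_greaterThanLessThan E _ fr, of "M / e"], use M(1) \<open>e > 0\<close> in simp, assumption, rule that)
  have "bounded J" by (rule bounded_subset[of "{-N..N}"]) (use J(2) in auto)
  then have Jm: "J \<in> lmeasurable" using J(1) by (intro bounded_set_imp_lmeasurable) auto
  have eJ: "emeasure lborel J = ennreal (measure lebesgue J)"
    using Jm J(1) emeasure_eq_measure2[OF Jm] by simp
  have "measure lebesgue J \<le> e"
  proof (cases "- N \<le> N")
    case True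
    have "ennreal (M / e) * emeasure lborel J \<le> emeasure (interval_measure F) {-N..N}"
      using J(2) by (intro order_trans[OF J(4)] emeasure_mono) auto
    also have "\<dots> \<le> ennreal M" using True M by (simp add: emeasure_Icc ennreal_leI)
    finally have "ennreal ((M / e) * measure lebesgue J) \<le> ennreal M"
      using M(1) \<open>e > 0\<close> unfolding eJ by (subst ennreal_mult) auto
    then have "(M / e) * measure lebesgue J \<le> M"
      using M(1) by (subst (asm) ennreal_le_iff) auto
    then show ?thesis using M(1) \<open>e > 0\<close> by (simp add: field_simps)
  next
    case False
    then have "J = {}" using J(2) by auto
    then show ?thesis using \<open>e > 0\<close> by simp
  qed
  moreover have "measure lebesgue (J \<union> (E - J)) \<le> measure lebesgue J + measure lebesgue (E - J)"
    using Jm negligible_imp_measurable[OF J(3)] by (intro measure_Un_le) auto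
  ultimately have "measure lebesgue (J \<union> (E - J)) \<le> e"
    using negligible_imp_measure0[OF J(3)] by simp
  then show "\<exists>T. E \<subseteq> T \<and> T \<in> lmeasurable \<and> measure lebesgue T \<le> e"
    using fmeasurable.Un[OF Jm negligible_imp_measurable[OF J(3)]]
    by (intro exI[of _ "J \<union> (E - J)"]) (auto simp del: Un_Diff_cancel)
qed

private lemma frequently_steep:
  assumes "\<exists>\<^sub>F y in at x. s < (F y - F x) / (y - x)"
  shows "\<exists>\<^sub>F y in at x. s * (max x y - min x y) \<le> F (max x y) - F (min x y)"
proof (rule frequently_rev_mp[OF assms], unfold eventually_at, intro exI[of _ 1] conjI ballI impI)
  fix y assume y: "y \<noteq> x \<and> dist y x < 1" and s: "s < (F y - F x) / (y - x)"
  show "s * (max x y - min x y) \<le> F (max x y) - F (min x y)"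
  proof (cases "x < y")
    case True
    then show ?thesis using s by (simp add: max_def min_def field_simps)
  next
    case False
    then have "y < x" using y by auto
    then show ?thesis using s by (simp add: max_def min_def field_simps)
  qed
qed simp

private lemma frequently_flat:
  assumes "\<exists>\<^sub>F y in at x. (F y - F x) / (y - x) < r"
  shows "\<exists>\<^sub>F y in at x. F (max x y) - F (min x y) \<le> r * (max x y - min x y)"
proof (rule frequently_rev_mp[OF assms], unfold eventually_at, intro exI[of _ 1] conjI ballI impI)
  fix y assume y: "y \<noteq> x \<and> dist y x < 1" and s: "(F y - F x) / (y - x) < r"
  show "F (max x y) - F (min x y) \<le> r * (max x y - min x y)"
  proof (cases "x < y")
    case True
    then show ?thesis using s by (simp add: max_def min_def field_simps)
  next
    case False
    then have "y < x" using y by auto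
    then show ?thesis using s by (simp add: max_def min_def field_simps)
  qed
qed simp

text \<open>\<open>Inf A\<close> is the upper limit of the difference quotients. If they fell below
  \<open>L - e\<close> arbitrarily near x, two rationals between \<open>L - e\<close> and L would
  separate frequent small values from frequent large ones, which \<open>eq\<close> forbids.\<close>

private lemma differentiableI_quotients:
  assumes fin: "\<not> (\<exists>\<^sub>F y in at x. s0 < (F y - F x) / (y - x))"
    and eq: "\<And>r s :: real. r \<in> \<rat> \<Longrightarrow> s \<in> \<rat> \<Longrightarrow> 0 \<le> r \<Longrightarrow> r < s \<Longrightarrow> \<exists>\<^sub>F y in at x. (F y - F x) / (y - x) < r
       \<Longrightarrow> \<exists>\<^sub>F y in at x. s < (F y - F x) / (y - x) \<Longrightarrow> False"
  shows "F differentiable (at x)"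
proof -
  define Q where "Q y = (F y - F x) / (y - x)" for y
  have Q0: "0 \<le> Q y" for y
    unfolding Q_def using mono_F[of x y] mono_F[of y x]
    by (cases "x \<le> y") (auto intro: divide_nonneg_nonneg divide_nonpos_nonpos)
  define A where "A = {s. eventually (\<lambda>y. Q y \<le> s) (at x)}"
  have "s0 \<in> A" using fin by (auto simp: A_def Q_def frequently_def not_less)
  have A0: "0 \<le> s" if "s \<in> A" for s
  proof -
    have "eventually (\<lambda>y. Q y \<le> s) (at x)" using that by (simp add: A_def)
    then obtain y where "Q y \<le> s" using eventually_happens[of _ "at x"] by auto
    then show ?thesis using Q0[of y] by simp
  qed
  define L where "L = Inf A"
  have bdd: "bdd_below A" using A0 by (auto intro: bdd_belowI[of _ 0])
  have "(Q \<longlongrightarrow> L) (at x)"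
    unfolding tendsto_iff
  proof (intro allI impI)
    fix e :: real assume "e > 0"
    have "\<exists>s\<in>A. s < L + e"
      using cInf_lessD[of A "L + e"] \<open>s0 \<in> A\<close> \<open>e > 0\<close> unfolding L_def by auto
    then obtain s where "s \<in> A" "s < L + e" by blast
    then have up: "eventually (\<lambda>y. Q y < L + e) (at x)"
      unfolding A_def by (auto elim: eventually_mono)
    have lo: "eventually (\<lambda>y. L - e < Q y) (at x)"
    proof (rule ccontr)
      assume "\<not> ?thesis"
      then have f1: "\<exists>\<^sub>F y in at x. Q y \<le> L - e" by (simp add: frequently_def not_le)
      obtain y where "Q y \<le> L - e" using frequently_ex[OF f1] by blast
      then have "0 \<le> L - e" using Q0[of y] by simp
      obtain r where r: "r \<in> \<rat>" "L - e < r" "r < L" using Rats_dense_in_real[of "L - e" L] \<open>e > 0\<close> by auto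
      obtain s where s: "s \<in> \<rat>" "r < s" "s < L" using Rats_dense_in_real[of r L] r by auto
      have "s \<notin> A" using s(3) bdd cInf_lower[of s A] unfolding L_def by auto
      then have "\<exists>\<^sub>F y in at x. s < Q y" by (simp add: A_def frequently_def not_less)
      moreover have "\<exists>\<^sub>F y in at x. Q y < r"
        using f1 by (rule frequently_elim1) (use r in auto)
      ultimately show False using eq[OF r(1) s(1) _ s(2)] r \<open>0 \<le> L - e\<close> by (simp add: Q_def)
    qed
    show "eventually (\<lambda>y. dist (Q y) L < e) (at x)"
      using up lo by eventually_elim (auto simp: dist_real_def)
  qed
  then have "(F has_field_derivative L) (at x)"
    unfolding has_field_derivative_iff Q_def .
  then show ?thesis using real_differentiable_def by blast
qed

text \<open>Lebesgue's theorem. At a bad point either the quotients exceed every bound or two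
  rationals separate their lower and upper limits. The rational pairs and the windows
  \<open>{-N<..<N}\<close> are countable in number, and the windows keep all masses finite.\<close>

theorem mono_continuous_differentiable_ae: "negligible {x. \<not> F differentiable (at x)}"
proof -
  define E where "E r s N = {x \<in> {-real N<..<real N}. (\<exists>\<^sub>F y in at x. (F y - F x) / (y - x) < r)
     \<and> (\<exists>\<^sub>F y in at x. s < (F y - F x) / (y - x))}" for r s :: real and N :: nat
  define H where "H N = {x \<in> {-real N<..<real N}. \<forall>s. \<exists>\<^sub>F y in at x. s < (F y - F x) / (y - x)}" for N :: nat
  have nE: "negligible (E r s N)" if "0 \<le> r" "r < s" for r s N
    by (rule negligible_steep_and_flat[of _ "real N" r s])
      (use that frequently_steep frequently_flat in \<open>auto simp: E_def\<close>)
  have nH: "negligible (H N)" for N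
    by (rule negligible_infinitely_steep[of _ "real N"]) (use frequently_steep in \<open>auto simp: H_def\<close>)
  define I where "I = {(r, s, N) | r s N. r \<in> \<rat> \<and> s \<in> \<rat> \<and> (0::real) \<le> r \<and> r < s \<and> N \<in> (UNIV :: nat set)}"
  have cI: "countable I"
    by (rule countable_subset[of _ "\<rat> \<times> \<rat> \<times> UNIV"]) (auto simp: I_def countable_rat)
  have "negligible (\<Union> ((\<lambda>(r, s, N). E r s N) ` I))"
    using cI nE by (intro negligible_countable_Union) (auto simp: I_def)
  moreover have "negligible (\<Union> (range H))"
    using nH by (intro negligible_countable_Union) auto
  ultimately have "negligible (\<Union> ((\<lambda>(r, s, N). E r s N) ` I) \<union> \<Union> (range H))"
    by (rule negligible_Un)
  moreover have "{x. \<not> F differentiable (at x)} \<subseteq> \<Union> ((\<lambda>(r, s, N). E r s N) ` I) \<union> \<Union> (range H)"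
  proof (rule subsetI, rule ccontr)
    fix x assume x: "x \<in> {x. \<not> F differentiable (at x)}"
      and nx: "x \<notin> \<Union> ((\<lambda>(r, s, N). E r s N) ` I) \<union> \<Union> (range H)"
    obtain N :: nat where "\<bar>x\<bar> < real N" using reals_Archimedean2 by blast
    then have xN: "x \<in> {-real N<..<real N}" by auto
    then obtain s0 where s0: "\<not> (\<exists>\<^sub>F y in at x. s0 < (F y - F x) / (y - x))"
      using nx unfolding H_def by blast
    have "F differentiable (at x)"
    proof (rule differentiableI_quotients[OF s0])
      fix r s :: real
      assume *: "r \<in> \<rat>" "s \<in> \<rat>" "0 \<le> r" "r < s" "\<exists>\<^sub>F y in at x. (F y - F x) / (y - x) < r"
        "\<exists>\<^sub>F y in at x. s < (F y - F x) / (y - x)"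
      then have "(r, s, N) \<in> I" by (simp add: I_def)
      moreover have "x \<in> E r s N" using * xN by (simp add: E_def)
      ultimately show False using nx by blast
    qed
    then show False using x by simp
  qed
  ultimately show ?thesis by (rule negligible_subset)
qed

end

subsection \<open>Absolutely continuous functions\<close>

text \<open>g is the difference of two increasing functions given by its variation. Clamping the
  argument by \<open>cl\<close> extends both to monotone continuous functions on the whole line,
  where Lebesgue's theorem is stated.\<close>

lemma abs_cont_on_differentiable_ae:
  assumes ac: "abs_cont_on a b g" and "a \<le> b"
  shows "negligible {x \<in> {a<..<b}. \<not> g differentiable (at x)}"
proof -
  define cl where "cl x = max a (min b x)" for x
  define F where "F x = total_variation g a (cl x)" for x
  define G where "G x = total_variation g a (cl x) - g (cl x)" for x
  have cl: "a \<le> cl x" "cl x \<le> b" for x using \<open>a \<le> b\<close> by (auto simp: cl_def)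
  have clm: "cl x \<le> cl y" if "x \<le> y" for x y using that by (auto simp: cl_def)
  have cc: "continuous_on UNIV cl" unfolding cl_def by (intro continuous_intros)
  have "cl ` UNIV \<subseteq> {a..b}" using cl by auto
  then have cF: "continuous_on UNIV F" and cg: "continuous_on UNIV (\<lambda>x. g (cl x))"
    unfolding F_def using cc
    by (auto intro!: continuous_on_compose2[OF continuous_on_total_variation[OF ac]]
        continuous_on_compose2[OF abs_cont_on_imp_continuous_on[OF ac]])
  have cG: "continuous_on UNIV G" using cF cg unfolding F_def G_def by (rule continuous_on_diff)
  have inc: "\<bar>g (cl y) - g (cl x)\<bar> \<le> F y - F x" if "x \<le> y" for x y
    unfolding F_def using total_variation_increment[OF ac cl(1) clm[OF that] cl(2)] .
  have mF: "F x \<le> F y" if "x \<le> y" for x y using inc[OF that] by simp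
  have mG: "G x \<le> G y" if "x \<le> y" for x y using inc[OF that] by (simp add: G_def F_def)
  have "negligible ({x. \<not> F differentiable (at x)} \<union> {x. \<not> G differentiable (at x)})"
    using mono_continuous_differentiable_ae[OF mF cF] mono_continuous_differentiable_ae[OF mG cG]
    by (rule negligible_Un)
  moreover have "{x \<in> {a<..<b}. \<not> g differentiable (at x)}
     \<subseteq> {x. \<not> F differentiable (at x)} \<union> {x. \<not> G differentiable (at x)}"
  proof (rule ccontr)
    assume "\<not> ?thesis"
    then obtain x where x: "x \<in> {a<..<b}" "\<not> g differentiable (at x)"
      "F differentiable (at x)" "G differentiable (at x)" by auto
    have "(\<lambda>x. F x - G x) differentiable (at x)" using x(3,4) by (rule differentiable_diff)
    then have "g differentiable (at x)"
    proof (rule differentiable_transform_within[where d = "min (x - a) (b - x)"])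
      fix y assume "dist y x < min (x - a) (b - x)"
      then have "cl y = y" by (auto simp: cl_def dist_real_def)
      then show "F y - G y = g y" by (simp add: F_def G_def)
    qed (use x(1) in auto)
    then show False using x(2) by simp
  qed
  ultimately show ?thesis by (rule negligible_subset)
qed

lemma disjoint_open_intervals:
  fixes a b c d :: real
  assumes "{a<..<b} \<inter> {c<..<d} = {}" "a < b" "c < d"
  shows "b \<le> c \<or> d \<le> a"
proof (rule ccontr)
  assume "\<not> ?thesis"
  then have "max a c < min b d" using assms(2,3) by auto
  then obtain z where "max a c < z" "z < min b d" using dense by blast
  then show False using assms(1) by auto
qed

text \<open>A gauge argument: the tags in the exceptional set carry intervals of small total length.\<close>

lemma fundamental_theorem_abs_cont:
  assumes ac: "abs_cont_on a b g" and "a \<le> b" and N: "negligible N"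
    and der: "\<And>x. x \<in> {a..b} - N \<Longrightarrow> (g has_real_derivative h x) (at x within {a..b})"
    and hN: "\<And>x. x \<in> N \<Longrightarrow> h x = 0"
  shows "(h has_integral (g b - g a)) {a..b}"
  unfolding has_integral_real
proof (intro allI impI)
  fix e :: real assume "e > 0"
  define e' where "e' = e / (2 * (b - a + 1))"
  have e': "e' > 0" "e' * (b - a) < e / 2"
    using \<open>e > 0\<close> \<open>a \<le> b\<close> by (auto simp: e'_def field_simps)
  obtain \<delta> where dl: "\<delta> > 0" "\<And>m u v. interval_family a b m u v \<Longrightarrow> (\<Sum>i<m. v i - u i) < \<delta>
      \<Longrightarrow> variation_sum g m u v < e / 2"
    using ac[unfolded abs_cont_on_iff_variation_sum, rule_format, of "e/2"] \<open>e > 0\<close> by auto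
  have "N \<in> sets lebesgue" using N by (simp add: negligible_imp_sets)
  then obtain U where U: "open U" "N \<subseteq> U" "U - N \<in> lmeasurable" "emeasure lebesgue (U - N) < ennreal \<delta>"
    using sets_lebesgue_outer_open dl(1) by metis
  have Um: "U \<in> lmeasurable"
    using fmeasurable.Un[OF U(3) negligible_imp_measurable[OF N]] U(2) by (simp add: Un_absorb2)
  have "measure lebesgue U \<le> measure lebesgue (U - N) + measure lebesgue N"
    using measure_Un_le[of "U - N" lebesgue N] U(2,3) N by (simp add: Un_absorb2 fmeasurableD negligible_imp_sets)
  also have "measure lebesgue (U - N) < \<delta>"
    using U(3,4) dl(1) by (simp add: emeasure_eq_measure2 ennreal_less_iff)
  finally have mU: "measure lebesgue U < \<delta>" using negligible_imp_measure0[OF N] by simp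
  have "\<forall>x. \<exists>d>0. x \<in> {a..b} - N \<longrightarrow>
         (\<forall>y\<in>{a..b}. \<bar>y - x\<bar> < d \<longrightarrow> \<bar>g y - g x - (y - x) * h x\<bar> \<le> e' * \<bar>y - x\<bar>)"
  proof
    fix x
    show "\<exists>d>0. x \<in> {a..b} - N \<longrightarrow>
         (\<forall>y\<in>{a..b}. \<bar>y - x\<bar> < d \<longrightarrow> \<bar>g y - g x - (y - x) * h x\<bar> \<le> e' * \<bar>y - x\<bar>)"
    proof (cases "x \<in> {a..b} - N")
      case True
      then show ?thesis
        using der[OF True] e'(1)
        unfolding has_field_derivative_def has_derivative_within_alt by (auto simp: mult.commute)
    qed (auto intro: exI[of _ "1::real"])
  qed
  then obtain d where d: "\<And>x. d x > 0"
    "\<And>x y. x \<in> {a..b} - N \<Longrightarrow> y \<in> {a..b} \<Longrightarrow> \<bar>y - x\<bar> < d x \<Longrightarrow>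
        \<bar>g y - g x - (y - x) * h x\<bar> \<le> e' * \<bar>y - x\<bar>"
    by metis
  define \<gamma> where "\<gamma> x = (if x \<in> N then U else ball x (d x))" for x
  have g: "gauge \<gamma>" using U(1,2) d(1) by (auto simp: gauge_def \<gamma>_def)
  show "\<exists>\<gamma>. gauge \<gamma> \<and> (\<forall>\<D>. \<D> tagged_division_of {a..b} \<and> \<gamma> fine \<D> \<longrightarrow>
        norm ((\<Sum>(x, k)\<in>\<D>. measure lborel k *\<^sub>R h x) - (g b - g a)) < e)"
  proof (intro exI[of _ \<gamma>] conjI allI impI g)
    fix p assume "p tagged_division_of {a..b} \<and> \<gamma> fine p"
    then have p: "p tagged_division_of {a..b}" and fine: "\<gamma> fine p" by auto
    have fp: "finite p" by (rule tagged_division_of_finite[OF p])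
    have ivl: "fst c \<in> snd c \<and> snd c = {Inf (snd c)..Sup (snd c)} \<and> Inf (snd c) \<le> Sup (snd c)
       \<and> a \<le> Inf (snd c) \<and> Sup (snd c) \<le> b \<and> measure lborel (snd c) = Sup (snd c) - Inf (snd c)" if "c \<in> p" for c
    proof -
      obtain x K where c: "c = (x, K)" by (cases c)
      then have cp: "(x, K) \<in> p" using that by simp
      have xK: "x \<in> K" "K \<subseteq> {a..b}" using tagged_division_ofD(2,3)[OF p cp] by auto
      obtain u v where K: "K = {u..v}" using tagged_division_ofD(4)[OF p cp] by auto
      then have "u \<le> v" using xK(1) by auto
      then show ?thesis using xK K c by auto
    qed
    define D where "D c = measure lborel (snd c) * h (fst c) - (g (Sup (snd c)) - g (Inf (snd c)))" for c
    have sum: "(\<Sum>(x, k)\<in>p. measure lborel k *\<^sub>R h x) - (g b - g a) = (\<Sum>c\<in>p. D c)"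
      using additive_tagged_division_1[OF \<open>a \<le> b\<close> p, of g]
      by (simp add: D_def sum_subtractf case_prod_beta)
    \<comment> \<open>Degenerate intervals contribute nothing and are left out, since the order of
      two intervals is read off from their nonempty disjoint interiors.\<close>
    define q where "q = {c\<in>p. fst c \<in> N \<and> Inf (snd c) < Sup (snd c)}"
    have "\<bar>D c\<bar> \<le> e' * measure lborel (snd c)" if c: "c \<in> p - q" for c
    proof (cases "fst c \<in> N")
      case True
      then have "Inf (snd c) = Sup (snd c)" using c ivl[of c] by (auto simp: q_def)
      then show ?thesis using True hN ivl[of c] c by (simp add: D_def)
    next
      case False
      define u v x where "u = Inf (snd c)" and "v = Sup (snd c)" and "x = fst c"
      have uv: "a \<le> u" "u \<le> x" "x \<le> v" "v \<le> b" "measure lborel (snd c) = v - u" "snd c = {u..v}"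
        using ivl[of c] c unfolding u_def v_def x_def by auto
      have "snd c \<subseteq> ball x (d x)"
        using fine c False unfolding fine_def \<gamma>_def x_def by (cases c) force
      moreover have "u \<in> snd c" "v \<in> snd c" using uv by auto
      ultimately have "u \<in> ball x (d x)" "v \<in> ball x (d x)" by auto
      then have "\<bar>g u - g x - (u - x) * h x\<bar> \<le> e' * \<bar>u - x\<bar>" "\<bar>g v - g x - (v - x) * h x\<bar> \<le> e' * \<bar>v - x\<bar>"
        using d(2)[of x u] d(2)[of x v] uv False by (auto simp: x_def dist_real_def)
      moreover have "D c = (g u - g x - (u - x) * h x) - (g v - g x - (v - x) * h x)"
        unfolding D_def uv(5) by (simp add: u_def v_def x_def algebra_simps)
      ultimately have "\<bar>D c\<bar> \<le> e' * \<bar>u - x\<bar> + e' * \<bar>v - x\<bar>" by linarith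
      also have "\<dots> = e' * measure lborel (snd c)" using uv by (simp add: algebra_simps)
      finally show ?thesis .
    qed
    then have "(\<Sum>c\<in>p - q. \<bar>D c\<bar>) \<le> (\<Sum>c\<in>p - q. e' * measure lborel (snd c))"
      by (rule sum_mono)
    also have "\<dots> \<le> (\<Sum>c\<in>p. e' * measure lborel (snd c))"
      using fp e'(1) by (intro sum_mono2) auto
    also have "\<dots> = e' * (b - a)"
      using additive_content_tagged_division[where d = p and a = a and b = b] p \<open>a \<le> b\<close>
      by (simp add: sum_distrib_left[symmetric] case_prod_beta)
    finally have 1: "(\<Sum>c\<in>p - q. \<bar>D c\<bar>) < e / 2" using e'(2) by simp
    have fq: "finite q" using fp by (auto simp: q_def)
    have no: "Sup (snd c) \<le> Inf (snd c') \<or> Sup (snd c') \<le> Inf (snd c)" if "c \<in> q" "c' \<in> q" "c \<noteq> c'" for c c'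
    proof -
      have "interior (snd c) \<inter> interior (snd c') = {}"
        using tagged_division_ofD(5)[OF p, of "fst c" "snd c" "fst c'" "snd c'"] that by (auto simp: q_def)
      moreover have "interior (snd c) = {Inf (snd c)<..<Sup (snd c)}" "interior (snd c') = {Inf (snd c')<..<Sup (snd c')}"
        using ivl[of c] ivl[of c'] that by (metis (no_types, lifting) interior_atLeastAtMost_real mem_Collect_eq q_def)+
      ultimately show ?thesis using that by (intro disjoint_open_intervals) (auto simp: q_def)
    qed
    obtain m u v where f: "interval_family a b m u v"
      "variation_sum g m u v = (\<Sum>c\<in>q. \<bar>g (Sup (snd c)) - g (Inf (snd c))\<bar>)"
      "(\<Sum>i<m. v i - u i) = (\<Sum>c\<in>q. Sup (snd c) - Inf (snd c))"
      by (rule interval_family_of_finite_set[where P = q and a = a and b = b and g = g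
          and U = "\<lambda>c. Inf (snd c)" and V = "\<lambda>c. Sup (snd c)", OF fq _ no]) (use ivl in \<open>auto simp: q_def\<close>)
    have "(\<Sum>c\<in>q. Sup (snd c) - Inf (snd c)) = (\<Sum>c\<in>q. measure lebesgue {Inf (snd c)<..<Sup (snd c)})"
      by (intro sum.cong) (auto simp: q_def)
    also have "\<dots> = measure lebesgue (\<Union>c\<in>q. {Inf (snd c)<..<Sup (snd c)})"
    proof (rule measure_finite_Union[symmetric])
      show "disjoint_family_on (\<lambda>c. {Inf (snd c)<..<Sup (snd c)}) q"
        unfolding disjoint_family_on_def using no by fastforce
    qed (use fq in \<open>auto simp: q_def\<close>)
    also have "\<dots> \<le> measure lebesgue U"
    proof (rule measure_mono_fmeasurable[OF _ _ Um])
      show "(\<Union>c\<in>q. {Inf (snd c)<..<Sup (snd c)}) \<subseteq> U"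
      proof (rule UN_least)
        fix c assume c: "c \<in> q"
        have "{Inf (snd c)<..<Sup (snd c)} \<subseteq> snd c" using ivl[of c] c
          by (metis (no_types, lifting) greaterThanLessThan_subseteq_atLeastAtMost_iff mem_Collect_eq order_refl q_def)
        also have "\<dots> \<subseteq> U" using fine c unfolding fine_def \<gamma>_def q_def by (cases c) force
        finally show "{Inf (snd c)<..<Sup (snd c)} \<subseteq> U" .
      qed
    qed (use fq in auto)
    finally have "(\<Sum>i<m. v i - u i) < \<delta>" using mU f(3) by simp
    then have "(\<Sum>c\<in>q. \<bar>g (Sup (snd c)) - g (Inf (snd c))\<bar>) < e / 2"
      using dl(2)[OF f(1)] f(2) by simp
    moreover have "(\<Sum>c\<in>q. \<bar>D c\<bar>) = (\<Sum>c\<in>q. \<bar>g (Sup (snd c)) - g (Inf (snd c))\<bar>)"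
      by (intro sum.cong) (auto simp: D_def q_def hN)
    ultimately have 2: "(\<Sum>c\<in>q. \<bar>D c\<bar>) < e / 2" by simp
    have "(\<Sum>c\<in>p. \<bar>D c\<bar>) = (\<Sum>c\<in>p - q. \<bar>D c\<bar>) + (\<Sum>c\<in>q. \<bar>D c\<bar>)"
      using fp by (subst sum.subset_diff[of q p]) (auto simp: q_def)
    then have "\<bar>\<Sum>c\<in>p. D c\<bar> < e" using sum_abs[of D p] 1 2 by linarith
    then show "norm ((\<Sum>(x, k)\<in>p. measure lborel k *\<^sub>R h x) - (g b - g a)) < e"
      unfolding sum by simp
  qed
qed

lemma abs_cont_on_subinterval: "abs_cont_on a b g \<Longrightarrow> a \<le> c \<Longrightarrow> d \<le> b \<Longrightarrow> abs_cont_on c d g"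
  unfolding abs_cont_on_iff_variation_sum using interval_family_mono by meson

text \<open>The gauge argument yields only a Henstock-Kurzweil integral. The integrals of h over the
  members of a division are increments of g, so bounded variation of g makes h absolutely
  integrable.\<close>

theorem abs_cont_on_integral_representation:
  assumes ac: "abs_cont_on a b g" and "a \<le> b"
  obtains h where "h absolutely_integrable_on {a..b}"
    "\<And>x y. a \<le> x \<Longrightarrow> x \<le> y \<Longrightarrow> y \<le> b \<Longrightarrow> (h has_integral (g y - g x)) {x..y}"
    "negligible {x \<in> {a<..<b}. \<not> (g has_real_derivative h x) (at x)}"
proof -
  define N where "N = {x \<in> {a<..<b}. \<not> g differentiable (at x)} \<union> {a, b}"
  have N: "negligible N"
    unfolding N_def using abs_cont_on_differentiable_ae[OF assms] by (intro negligible_Un) auto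
  define h where "h x = (if x \<in> N then 0 else deriv g x)" for x
  have der: "(g has_real_derivative h x) (at x)" if "x \<in> {a..b} - N" for x
    using that by (auto simp: N_def h_def field_differentiable_derivI real_differentiable_def
        field_differentiable_def)
  have int: "(h has_integral (g y - g x)) {x..y}" if "a \<le> x" "x \<le> y" "y \<le> b" for x y
  proof (rule fundamental_theorem_abs_cont[OF abs_cont_on_subinterval[OF ac] _ N])
    show "(g has_real_derivative h z) (at z within {x..y})" if "z \<in> {x..y} - N" for z
      using der[of z] that \<open>a \<le> x\<close> \<open>y \<le> b\<close> by (auto intro: has_field_derivative_at_within)
  qed (use that in \<open>auto simp: h_def\<close>)
  obtain B where B: "\<And>m u v. interval_family a b m u v \<Longrightarrow> variation_sum g m u v \<le> B"
    using abs_cont_on_bounded_variation[OF ac] by metis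
  have "h absolutely_integrable_on cbox a b"
  proof (rule bounded_variation_absolutely_integrable_interval[where B = B])
    show "h integrable_on cbox a b" using int[of a b] \<open>a \<le> b\<close> by auto
    fix d assume d: "d division_of cbox a b"
    have ivl: "K = {Inf K..Sup K} \<and> Inf K \<le> Sup K \<and> a \<le> Inf K \<and> Sup K \<le> b" if "K \<in> d" for K
    proof -
      obtain u v where K: "K = {u..v}" using division_ofD(4)[OF d \<open>K \<in> d\<close>] by auto
      moreover have "u \<le> v" using division_ofD(3)[OF d that] K by auto
      ultimately show ?thesis using division_ofD(2)[OF d that] by auto
    qed
    define q where "q = {K\<in>d. Inf K < Sup K}"
    have fd: "finite d" using d by auto
    have no: "Sup K \<le> Inf K' \<or> Sup K' \<le> Inf K" if "K \<in> q" "K' \<in> q" "K \<noteq> K'" for K K'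
    proof -
      have "interior K \<inter> interior K' = {}"
        using division_ofD(5)[OF d, of K K'] that by (auto simp: q_def)
      moreover have "interior K = {Inf K<..<Sup K}" "interior K' = {Inf K'<..<Sup K'}"
        using ivl[of K] ivl[of K'] that by (metis (no_types, lifting) interior_atLeastAtMost_real mem_Collect_eq q_def)+
      ultimately show ?thesis using that by (intro disjoint_open_intervals) (auto simp: q_def)
    qed
    obtain m u v where f: "interval_family a b m u v"
      "variation_sum g m u v = (\<Sum>K\<in>q. \<bar>g (Sup K) - g (Inf K)\<bar>)"
      by (rule interval_family_of_finite_set[where P = q and a = a and b = b and g = g and U = Inf and V = Sup, OF _ _ no]) (use ivl fd in \<open>auto simp: q_def\<close>)
    have "(\<Sum>K\<in>d. norm (integral K h)) = (\<Sum>K\<in>d. \<bar>g (Sup K) - g (Inf K)\<bar>)"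
    proof (rule sum.cong)
      fix K assume "K \<in> d"
      then have "(h has_integral (g (Sup K) - g (Inf K))) K" using int[of "Inf K" "Sup K"] ivl[of K] by simp
      then show "norm (integral K h) = \<bar>g (Sup K) - g (Inf K)\<bar>" by (simp add: integral_unique)
    qed simp
    also have "\<dots> = (\<Sum>K\<in>q. \<bar>g (Sup K) - g (Inf K)\<bar>)"
      using ivl fd by (intro sum.mono_neutral_right) (force simp: q_def)+
    also have "\<dots> \<le> B" using B[OF f(1)] f(2) by simp
    finally show "(\<Sum>K\<in>d. norm (integral K h)) \<le> B" .
  qed
  moreover have "{x \<in> {a<..<b}. \<not> (g has_real_derivative h x) (at x)} \<subseteq> N"
  proof (intro subsetI, rule ccontr)
    fix x assume "x \<in> {x \<in> {a<..<b}. \<not> (g has_real_derivative h x) (at x)}" "x \<notin> N"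
    then show False using der[of x] by auto
  qed
  then have "negligible {x \<in> {a<..<b}. \<not> (g has_real_derivative h x) (at x)}"
    by (rule negligible_subset[OF N])
  ultimately show ?thesis using int by (intro that[of h]) auto
qed

text \<open>A single epsilon-delta argument behind the closure properties that follow: sums,
  products, reciprocals and Lipschitz functions have increments dominated in this way on a compact
  interval.\<close>

lemma abs_cont_on_dominated:
  assumes f: "abs_cont_on a b f" and g: "abs_cont_on a b g"
    and le: "\<And>x y. x \<in> {a..b} \<Longrightarrow> y \<in> {a..b} \<Longrightarrow> \<bar>F y - F x\<bar> \<le> C * (\<bar>f y - f x\<bar> + \<bar>g y - g x\<bar>)"
  shows "abs_cont_on a b F"
  unfolding abs_cont_on_iff_variation_sum
proof (intro allI impI)
  fix e :: real assume "e > 0"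
  define e' where "e' = e / (2 * (\<bar>C\<bar> + 1))"
  have e': "e' > 0" using \<open>e > 0\<close> by (auto simp: e'_def)
  obtain d1 where d1: "d1 > 0" "\<And>m u v. interval_family a b m u v \<Longrightarrow> (\<Sum>i<m. v i - u i) < d1
      \<Longrightarrow> variation_sum f m u v < e'"
    using f[unfolded abs_cont_on_iff_variation_sum, rule_format, OF e'] by auto
  obtain d2 where d2: "d2 > 0" "\<And>m u v. interval_family a b m u v \<Longrightarrow> (\<Sum>i<m. v i - u i) < d2
      \<Longrightarrow> variation_sum g m u v < e'"
    using g[unfolded abs_cont_on_iff_variation_sum, rule_format, OF e'] by auto
  show "\<exists>\<delta>>0. \<forall>m u v. interval_family a b m u v \<and> (\<Sum>i<m. v i - u i) < \<delta> \<longrightarrow> variation_sum F m u v < e"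
  proof (intro exI[of _ "min d1 d2"] conjI allI impI)
    fix m u v assume *: "interval_family a b m u v \<and> (\<Sum>i<m. v i - u i) < min d1 d2"
    have "variation_sum F m u v \<le> (\<Sum>i<m. (\<bar>C\<bar> + 1) * (\<bar>f (v i) - f (u i)\<bar> + \<bar>g (v i) - g (u i)\<bar>))"
      unfolding variation_sum_def
    proof (rule sum_mono)
      fix i assume "i \<in> {..<m}"
      then have "u i \<in> {a..b}" "v i \<in> {a..b}" using * unfolding interval_family_def by force+
      then have "\<bar>F (v i) - F (u i)\<bar> \<le> C * (\<bar>f (v i) - f (u i)\<bar> + \<bar>g (v i) - g (u i)\<bar>)" by (rule le)
      also have "\<dots> \<le> (\<bar>C\<bar> + 1) * (\<bar>f (v i) - f (u i)\<bar> + \<bar>g (v i) - g (u i)\<bar>)"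
        by (intro mult_right_mono) auto
      finally show "\<bar>F (v i) - F (u i)\<bar> \<le> (\<bar>C\<bar> + 1) * (\<bar>f (v i) - f (u i)\<bar> + \<bar>g (v i) - g (u i)\<bar>)" .
    qed
    also have "\<dots> = (\<bar>C\<bar> + 1) * (variation_sum f m u v + variation_sum g m u v)"
      unfolding variation_sum_def sum.distrib[symmetric] by (simp only: sum_distrib_left)
    also have "\<dots> < (\<bar>C\<bar> + 1) * (e' + e')"
      using d1(2) d2(2) * by (intro mult_strict_left_mono add_strict_mono) auto
    also have "\<dots> = e"
    proof -
      have "K * (e / (2 * K) + e / (2 * K)) = e" if "K > 0" for K :: real
        using that by (simp add: field_simps)
      from this[of "\<bar>C\<bar> + 1"] show ?thesis unfolding e'_def by simp
    qed
    finally show "variation_sum F m u v < e" .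
  qed (use d1(1) d2(1) in auto)
qed

lemma abs_cont_on_id: "abs_cont_on a b (\<lambda>x. x)"
  unfolding abs_cont_on_iff_variation_sum
proof (intro allI impI)
  fix e :: real assume "e > 0"
  show "\<exists>\<delta>>0. \<forall>m u v. interval_family a b m u v \<and> (\<Sum>i<m. v i - u i) < \<delta> \<longrightarrow> variation_sum (\<lambda>x. x) m u v < e"
  proof (intro exI[of _ e] conjI allI impI)
    fix m u v assume *: "interval_family a b m u v \<and> (\<Sum>i<m. v i - u i) < e"
    then have "variation_sum (\<lambda>x. x) m u v = (\<Sum>i<m. v i - u i)"
      unfolding variation_sum_def interval_family_def by (intro sum.cong) auto
    then show "variation_sum (\<lambda>x. x) m u v < e" using * by simp
  qed (rule \<open>e > 0\<close>)
qed

lemma abs_cont_on_lipschitz: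
  assumes "\<And>x y. x \<in> {a..b} \<Longrightarrow> y \<in> {a..b} \<Longrightarrow> \<bar>F y - F x\<bar> \<le> C * \<bar>y - x\<bar>"
  shows "abs_cont_on a b F"
  by (rule abs_cont_on_dominated[OF abs_cont_on_id abs_cont_on_id, where C = "C / 2"])
    (use assms in auto)

lemma abs_cont_on_const: "abs_cont_on a b (\<lambda>x. c)"
  by (rule abs_cont_on_lipschitz[where C = 0]) auto

lemma abs_cont_on_add:
  "abs_cont_on a b f \<Longrightarrow> abs_cont_on a b g \<Longrightarrow> abs_cont_on a b (\<lambda>x. f x + g x)"
  by (rule abs_cont_on_dominated[where C = 1 and f = f and g = g]) auto

lemma abs_cont_on_bounded:
  assumes "abs_cont_on a b f"
  obtains B where "B > 0" "\<And>x. x \<in> {a..b} \<Longrightarrow> \<bar>f x\<bar> \<le> B"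
proof -
  have "bounded (f ` {a..b})"
    by (rule compact_imp_bounded[OF compact_continuous_image[OF abs_cont_on_imp_continuous_on[OF assms]]]) auto
  then show ?thesis unfolding bounded_pos using that by auto
qed

lemma abs_cont_on_mult:
  assumes f: "abs_cont_on a b f" and g: "abs_cont_on a b g"
  shows "abs_cont_on a b (\<lambda>x. f x * g x)"
proof -
  obtain A B where A: "A > 0" "\<And>x. x \<in> {a..b} \<Longrightarrow> \<bar>f x\<bar> \<le> A" and B: "B > 0" "\<And>x. x \<in> {a..b} \<Longrightarrow> \<bar>g x\<bar> \<le> B"
    using abs_cont_on_bounded[OF f] abs_cont_on_bounded[OF g] by metis
  show ?thesis
  proof (rule abs_cont_on_dominated[OF f g, where C = "A + B"])
    fix x y assume xy: "x \<in> {a..b}" "y \<in> {a..b}"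
    have "f y * g y - f x * g x = (f y - f x) * g y + f x * (g y - g x)" by (simp add: algebra_simps)
    also have "\<bar>\<dots>\<bar> \<le> \<bar>f y - f x\<bar> * \<bar>g y\<bar> + \<bar>f x\<bar> * \<bar>g y - g x\<bar>"
      by (metis abs_mult abs_triangle_ineq)
    also have "\<dots> \<le> \<bar>f y - f x\<bar> * B + A * \<bar>g y - g x\<bar>"
      using A B xy by (intro add_mono mult_left_mono mult_right_mono) auto
    also have "\<dots> \<le> (A + B) * (\<bar>f y - f x\<bar> + \<bar>g y - g x\<bar>)"
      using A(1) B(1) by (simp add: algebra_simps)
    finally show "\<bar>f y * g y - f x * g x\<bar> \<le> (A + B) * (\<bar>f y - f x\<bar> + \<bar>g y - g x\<bar>)" .
  qed
qed

lemma abs_cont_on_inverse: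
  assumes f: "abs_cont_on a b f" and nz: "\<And>x. x \<in> {a..b} \<Longrightarrow> f x \<noteq> 0"
  shows "abs_cont_on a b (\<lambda>x. inverse (f x))"
proof -
  have "continuous_on {a..b} (\<lambda>x. inverse (f x))"
    using abs_cont_on_imp_continuous_on[OF f] nz by (intro continuous_intros) auto
  then have "bounded ((\<lambda>x. inverse (f x)) ` {a..b})"
    by (intro compact_imp_bounded compact_continuous_image) auto
  then obtain B where B: "B > 0" "\<And>x. x \<in> {a..b} \<Longrightarrow> \<bar>inverse (f x)\<bar> \<le> B"
    unfolding bounded_pos by auto
  show ?thesis
  proof (rule abs_cont_on_dominated[OF f f, where C = "B * B"])
    fix x y assume xy: "x \<in> {a..b}" "y \<in> {a..b}"
    have "inverse (f y) - inverse (f x) = - ((f y - f x) * (inverse (f y) * inverse (f x)))"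
      using nz xy by (simp add: field_simps)
    then have "\<bar>inverse (f y) - inverse (f x)\<bar> = \<bar>f y - f x\<bar> * (\<bar>inverse (f y)\<bar> * \<bar>inverse (f x)\<bar>)"
      by (simp only: abs_minus_cancel abs_mult)
    also have "\<dots> \<le> \<bar>f y - f x\<bar> * (B * B)"
      using B xy by (intro mult_left_mono mult_mono) auto
    also have "\<dots> \<le> B * B * (\<bar>f y - f x\<bar> + \<bar>f y - f x\<bar>)"
      using B(1) by (simp add: mult.commute distrib_left)
    finally show "\<bar>inverse (f y) - inverse (f x)\<bar> \<le> B * B * (\<bar>f y - f x\<bar> + \<bar>f y - f x\<bar>)" .
  qed
qed

lemma abs_cont_on_C1:
  assumes der: "\<And>x. x \<in> {a..b} \<Longrightarrow> (f has_real_derivative f' x) (at x within {a..b})"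
    and cont: "continuous_on {a..b} f'"
  shows "abs_cont_on a b f"
proof -
  have "bounded (f' ` {a..b})" using cont by (intro compact_imp_bounded compact_continuous_image) auto
  then obtain B where B: "B > 0" "\<And>x. x \<in> {a..b} \<Longrightarrow> \<bar>f' x\<bar> \<le> B" unfolding bounded_pos by auto
  show ?thesis
  proof (rule abs_cont_on_lipschitz[where C = B])
    fix x y assume xy: "x \<in> {a..b}" "y \<in> {a..b}"
    have "norm (f y - f x) \<le> B * norm (y - x)"
      by (rule field_differentiable_bound[OF _ der]) (use B xy in auto)
    then show "\<bar>f y - f x\<bar> \<le> B * \<bar>y - x\<bar>" by simp
  qed
qed

lemma abs_cont_on_cong:
  assumes "\<And>x. x \<in> {a..b} \<Longrightarrow> f x = g x" "abs_cont_on a b f"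
  shows "abs_cont_on a b g"
  by (rule abs_cont_on_dominated[OF assms(2) assms(2), where C = 1]) (use assms(1) in auto)

section \<open>The half-open interval and a Borel derivative on it\<close>

lemma mem_ivl: "t \<in> ivl T x0 \<longleftrightarrow> T \<le> t \<and> ereal t < x0"
  by (simp add: ivl_def)

lemma ivl_subset: "x \<in> ivl T x0 \<Longrightarrow> y \<in> ivl T x0 \<Longrightarrow> {x..y} \<subseteq> ivl T x0"
  by (auto simp: mem_ivl) (meson ereal_less_eq(3) le_less_trans)

lemma ivl_down: "y \<in> ivl T x0 \<Longrightarrow> T \<le> x \<Longrightarrow> x \<le> y \<Longrightarrow> x \<in> ivl T x0"
  by (auto simp: mem_ivl) (meson ereal_less_eq(3) le_less_trans)

lemma ivl_greater: "x \<in> ivl T x0 \<Longrightarrow> \<exists>y\<in>ivl T x0. x < y"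
  using ereal_dense2[of "ereal x" x0] by (auto simp: mem_ivl intro: less_imp_le)

lemma ivl_borel [measurable]: "ivl T x0 \<in> sets borel"
  unfolding ivl_def by measurable

lemma borel_measurable_ennreal_indicator_ivl:
  assumes "continuous_on (ivl T x0) g"
  shows "(\<lambda>t. ennreal (g t) * indicator (ivl T x0) t) \<in> borel_measurable borel"
proof -
  have "(\<lambda>t. indicator (ivl T x0) t *\<^sub>R g t) \<in> borel_measurable borel"
    by (rule borel_measurable_continuous_on_indicator[OF ivl_borel assms])
  then have "(\<lambda>t. ennreal (indicator (ivl T x0) t *\<^sub>R g t)) \<in> borel_measurable borel" by measurable
  also have "(\<lambda>t. ennreal (indicator (ivl T x0) t *\<^sub>R g t)) = (\<lambda>t. ennreal (g t) * indicator (ivl T x0) t)"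
    by (auto simp: indicator_def)
  finally show ?thesis .
qed

text \<open>Even T, with its one-sided neighbourhoods, is a limit point. Hence derivatives within
  the interval are unique, and the choice in \<open>deriv_within\<close> is determined wherever a
  derivative exists.\<close>

lemma ivl_islimpt: assumes "x \<in> ivl T x0" shows "x islimpt ivl T x0"
proof (rule connected_imp_perfect[OF _ assms])
  show "connected (ivl T x0)"
    unfolding is_interval_connected_1[symmetric] is_interval_1 using ivl_subset by fastforce
  show "ivl T x0 \<noteq> {y}" for y
    using ivl_greater[of y T x0] by auto
qed

lemma derivative_unique_ivl:
  assumes "x \<in> ivl T x0" "(g has_real_derivative A) (at x within ivl T x0)"
    "(g has_real_derivative B) (at x within ivl T x0)"
  shows "A = B"
  using assms(2,3) ivl_islimpt[OF assms(1)] unfolding has_field_derivative_iff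
  by (intro tendsto_unique[of "at x within ivl T x0"]) (auto simp: trivial_limit_within)

lemma at_within_Icc_ivl:
  assumes "x \<in> ivl T x0" "y \<in> ivl T x0" "x < y"
  shows "at x within {T..y} = at x within ivl T x0"
proof (rule at_within_nhd[of x "{..<y}"])
  show "{T..y} \<inter> {..<y} - {x} = ivl T x0 \<inter> {..<y} - {x}"
    using ivl_down[OF assms(2)] by (auto simp: mem_ivl)
qed (use assms in auto)

definition locally_abs_cont_on :: "real set \<Rightarrow> (real \<Rightarrow> real) \<Rightarrow> bool" where
  "locally_abs_cont_on S g \<longleftrightarrow> (\<forall>a b. a \<le> b \<and> {a..b} \<subseteq> S \<longrightarrow> abs_cont_on a b g)"

lemma locally_abs_cont_on_continuous:
  assumes ac: "locally_abs_cont_on (ivl T x0) g"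
  shows "continuous_on (ivl T x0) g"
  unfolding continuous_on_eq_continuous_within
proof
  fix x assume x: "x \<in> ivl T x0"
  obtain y where y: "y \<in> ivl T x0" "x < y" using ivl_greater[OF x] by blast
  have T: "T \<in> ivl T x0" using ivl_down[OF x, of T] x by (auto simp: mem_ivl)
  have "abs_cont_on T y g"
    using ac ivl_subset[OF T y(1)] y unfolding locally_abs_cont_on_def by (auto simp: mem_ivl)
  then have "continuous_on {T..y} g" by (rule abs_cont_on_imp_continuous_on)
  then have "continuous (at x within {T..y}) g"
    using x y by (auto simp: mem_ivl continuous_on_eq_continuous_within)
  then show "continuous (at x within ivl T x0) g" using at_within_Icc_ivl[OF x y] by simp
qed

lemma nn_integral_abs_eq_integral:
  assumes k: "k absolutely_integrable_on {a..b}"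
  shows "(\<integral>\<^sup>+t. ennreal \<bar>k t\<bar> * indicator {a..b} t \<partial>lborel) = ennreal (integral {a..b} (\<lambda>x. \<bar>k x\<bar>))"
proof -
  have ka: "(\<lambda>x. \<bar>k x\<bar>) absolutely_integrable_on {a..b}"
    using absolutely_integrable_norm[OF k] by (simp add: o_def)
  have "(\<integral>\<^sup>+t. ennreal \<bar>k t\<bar> * indicator {a..b} t \<partial>lborel)
      = (\<integral>\<^sup>+t. ennreal (indicator {a..b} t *\<^sub>R \<bar>k t\<bar>) \<partial>lborel)"
    by (intro nn_integral_cong) (auto simp: indicator_def)
  also have "\<dots> = (\<integral>\<^sup>+t. ennreal (indicator {a..b} t *\<^sub>R \<bar>k t\<bar>) \<partial>lebesgue)"
    by (simp add: nn_integral_completion)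
  also have "\<dots> = ennreal (LINT t|lebesgue. indicator {a..b} t *\<^sub>R \<bar>k t\<bar>)"
    using ka unfolding set_integrable_def by (intro nn_integral_eq_integral) auto
  also have "(LINT t|lebesgue. indicator {a..b} t *\<^sub>R \<bar>k t\<bar>) = integral {a..b} (\<lambda>x. \<bar>k x\<bar>)"
    using set_lebesgue_integral_eq_integral(2)[OF ka] by (simp add: set_lebesgue_integral_def)
  finally show ?thesis .
qed

lemma nn_integral_abs_cont_bound:
  assumes k: "k absolutely_integrable_on {a..b}"
    and int: "(k has_integral I) {a..b}"
    and hk: "AE x in lborel. x \<in> {a..b} \<longrightarrow> h x = k x"
  shows "ennreal \<bar>I\<bar> \<le> (\<integral>\<^sup>+t. ennreal \<bar>h t\<bar> * indicator {a..b} t \<partial>lborel)"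
    and "(\<integral>\<^sup>+t. ennreal \<bar>h t\<bar> * indicator {a..b} t \<partial>lborel) < \<infinity>"
proof -
  have ka: "(\<lambda>x. \<bar>k x\<bar>) absolutely_integrable_on {a..b}"
    using absolutely_integrable_norm[OF k] by (simp add: o_def)
  have "(\<integral>\<^sup>+t. ennreal \<bar>h t\<bar> * indicator {a..b} t \<partial>lborel) = (\<integral>\<^sup>+t. ennreal \<bar>k t\<bar> * indicator {a..b} t \<partial>lborel)"
    using hk by (intro nn_integral_cong_AE) (auto simp: indicator_def)
  then have eq: "(\<integral>\<^sup>+t. ennreal \<bar>h t\<bar> * indicator {a..b} t \<partial>lborel) = ennreal (integral {a..b} (\<lambda>x. \<bar>k x\<bar>))"
    unfolding nn_integral_abs_eq_integral[OF k] .
  have "\<bar>integral {a..b} k\<bar> \<le> integral {a..b} (\<lambda>x. \<bar>k x\<bar>)"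
    using integral_norm_bound_integral[of k "{a..b}" "\<lambda>x. \<bar>k x\<bar>"] set_lebesgue_integral_eq_integral(1)[OF ka] int
    by auto
  then show "ennreal \<bar>I\<bar> \<le> (\<integral>\<^sup>+t. ennreal \<bar>h t\<bar> * indicator {a..b} t \<partial>lborel)"
    unfolding eq using int by (auto simp: integral_unique intro: ennreal_leI)
  show "(\<integral>\<^sup>+t. ennreal \<bar>h t\<bar> * indicator {a..b} t \<partial>lborel) < \<infinity>" unfolding eq by simp
qed

lemma AE_lborel_of_negligible: "negligible {x. \<not> P x} \<Longrightarrow> AE x in lborel. P (x :: real)"
  using AE_not_in[of "{x. \<not> P x}" lebesgue] unfolding negligible_iff_null_sets AE_completion_iff by simp

text \<open>h is the limit of the difference quotients, with step \<open>1 / (m + 1)\<close>, of g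
  extended by 0. It is Borel on the whole line, does not depend on a subinterval, and equals the
  derivative wherever that exists in the interior; so the representations on compact subintervals
  fit together.\<close>

theorem locally_abs_cont_on_derivative:
  assumes ac: "locally_abs_cont_on (ivl T x0) g"
  obtains h where "h \<in> borel_measurable borel"
    "AE x in lborel. x \<in> ivl T x0 \<longrightarrow> (g has_real_derivative h x) (at x)"
    "\<And>x y. x \<in> ivl T x0 \<Longrightarrow> y \<in> ivl T x0 \<Longrightarrow> x \<le> y \<Longrightarrow>
      ennreal \<bar>g y - g x\<bar> \<le> (\<integral>\<^sup>+t. ennreal \<bar>h t\<bar> * indicator {x..y} t \<partial>lborel)"
    "\<And>x y. x \<in> ivl T x0 \<Longrightarrow> y \<in> ivl T x0 \<Longrightarrow> x \<le> y \<Longrightarrow>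
      (\<integral>\<^sup>+t. ennreal \<bar>h t\<bar> * indicator {x..y} t \<partial>lborel) < \<infinity>"
proof -
  let ?S = "ivl T x0"
  define G where "G x = indicator ?S x *\<^sub>R g x" for x
  define h where "h x = lim (\<lambda>m. (G (x + inverse (real (Suc m))) - G x) / inverse (real (Suc m)))" for x
  have [measurable]: "G \<in> borel_measurable borel"
    unfolding G_def by (rule borel_measurable_continuous_on_indicator[OF ivl_borel locally_abs_cont_on_continuous[OF ac]])
  have hm: "h \<in> borel_measurable borel" unfolding h_def by measurable
  have hD: "h x = D" if D: "(g has_real_derivative D) (at x)" and x: "x \<in> {a<..<b}" "{a..b} \<subseteq> ?S" for x D a b
  proof -
    have "(G has_real_derivative D) (at x)"
    proof (rule has_field_derivative_transform_within[OF D])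
      show "g y = G y" if "dist y x < min (x - a) (b - x)" for y
      proof -
        have "y \<in> {a..b}" using that by (auto simp: dist_real_def)
        then have "y \<in> ?S" using x(2) by blast
        then show ?thesis by (simp add: G_def)
      qed
    qed (use x in auto)
    then have "((\<lambda>e. (G (x + e) - G x) / e) \<longlongrightarrow> D) (at 0)"
      by (simp add: DERIV_def)
    moreover have "filterlim (\<lambda>m. inverse (real (Suc m))) (at 0) sequentially"
      unfolding filterlim_at using LIMSEQ_inverse_real_of_nat by auto
    ultimately have "(\<lambda>m. (G (x + inverse (real (Suc m))) - G x) / inverse (real (Suc m))) \<longlonglongrightarrow> D"
      by (rule filterlim_compose)
    then show ?thesis unfolding h_def by (rule limI)
  qed
  have loc: "negligible {x \<in> {a<..<b}. \<not> (g has_real_derivative h x) (at x)} \<and>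
      ennreal \<bar>g b - g a\<bar> \<le> (\<integral>\<^sup>+t. ennreal \<bar>h t\<bar> * indicator {a..b} t \<partial>lborel) \<and>
      (\<integral>\<^sup>+t. ennreal \<bar>h t\<bar> * indicator {a..b} t \<partial>lborel) < \<infinity>"
    if ab: "a \<le> b" "{a..b} \<subseteq> ?S" for a b
  proof -
    have "abs_cont_on a b g" using ac ab unfolding locally_abs_cont_on_def by blast
    then obtain k where k: "k absolutely_integrable_on {a..b}"
      "\<And>x y. a \<le> x \<Longrightarrow> x \<le> y \<Longrightarrow> y \<le> b \<Longrightarrow> (k has_integral (g y - g x)) {x..y}"
      "negligible {x \<in> {a<..<b}. \<not> (g has_real_derivative k x) (at x)}"
      by (rule abs_cont_on_integral_representation[OF _ ab(1)]) (rule that)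
    have hk: "h x = k x" if "x \<in> {a<..<b}" "(g has_real_derivative k x) (at x)" for x
      using hD[OF that(2,1) ab(2)] .
    have 1: "negligible {x \<in> {a<..<b}. \<not> (g has_real_derivative h x) (at x)}"
      by (rule negligible_subset[OF k(3)]) (auto simp: hk)
    have "negligible {x. \<not> (x \<in> {a..b} \<longrightarrow> h x = k x)}"
    proof (rule negligible_subset)
      show "negligible ({x \<in> {a<..<b}. \<not> (g has_real_derivative k x) (at x)} \<union> {a, b})"
        using k(3) by (intro negligible_Un) auto
      show "{x. \<not> (x \<in> {a..b} \<longrightarrow> h x = k x)} \<subseteq> {x \<in> {a<..<b}. \<not> (g has_real_derivative k x) (at x)} \<union> {a, b}"
        using hk by (auto simp: le_less)
    qed
    then have "AE x in lborel. x \<in> {a..b} \<longrightarrow> h x = k x" by (rule AE_lborel_of_negligible)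
    then show ?thesis
      using 1 nn_integral_abs_cont_bound[OF k(1) k(2)[OF order_refl ab(1) order_refl]] by blast
  qed
  define bad where "bad = (\<lambda>(a, b). {x \<in> {a<..<b}. \<not> (g has_real_derivative h x) (at x)})"
  \<comment> \<open>Countably many exceptional sets suffice: T is the only point of the interval
    that lies in the interior of none of these.\<close>
  define I where "I = {(a, b). a \<in> \<rat> \<and> b \<in> \<rat> \<and> a \<le> b \<and> {a..b} \<subseteq> ?S}"
  have "countable I"
    by (rule countable_subset[of _ "\<rat> \<times> \<rat>"]) (auto simp: I_def countable_rat)
  then have "negligible (\<Union> (bad ` I) \<union> {T})"
    using loc by (intro negligible_Un negligible_countable_Union) (auto simp: I_def bad_def)
  moreover have "{x. \<not> (x \<in> ?S \<longrightarrow> (g has_real_derivative h x) (at x))} \<subseteq> \<Union> (bad ` I) \<union> {T}"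
  proof
    fix x assume x: "x \<in> {x. \<not> (x \<in> ?S \<longrightarrow> (g has_real_derivative h x) (at x))}"
    show "x \<in> \<Union> (bad ` I) \<union> {T}"
    proof (cases "x = T")
      case False
      then have "T < x" "x \<in> ?S" using x by (auto simp: mem_ivl)
      obtain y where y: "y \<in> ?S" "x < y" using ivl_greater[OF \<open>x \<in> ?S\<close>] by blast
      obtain a where a: "a \<in> \<rat>" "T < a" "a < x" using Rats_dense_in_real[OF \<open>T < x\<close>] by blast
      obtain b where b: "b \<in> \<rat>" "x < b" "b < y" using Rats_dense_in_real[OF y(2)] by blast
      have "{a..b} \<subseteq> ?S" using ivl_down[OF y(1)] a b by auto
      then have "(a, b) \<in> I" using a b by (simp add: I_def)
      moreover have "x \<in> bad (a, b)" using x a b by (simp add: bad_def)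
      ultimately show ?thesis by blast
    qed auto
  qed
  ultimately have "AE x in lborel. x \<in> ?S \<longrightarrow> (g has_real_derivative h x) (at x)"
    by (intro AE_lborel_of_negligible) (rule negligible_subset)
  then show ?thesis
    using hm loc ivl_subset by (intro that[of h]) blast+
qed

subsection \<open>Wronskians\<close>

text \<open>By the Leibniz formula a determinant is a polynomial in its entries. Q stands for
  continuity, differentiability at a point or local absolute continuity.\<close>

lemma det_mat_closed:
  fixes e :: "nat \<Rightarrow> nat \<Rightarrow> 'a \<Rightarrow> real"
  assumes const: "\<And>c. Q (\<lambda>x. c)"
    and add: "\<And>f g. Q f \<Longrightarrow> Q g \<Longrightarrow> Q (\<lambda>x. f x + g x)"
    and mult: "\<And>f g. Q f \<Longrightarrow> Q g \<Longrightarrow> Q (\<lambda>x. f x * g x)"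
    and e: "\<And>i j. i < n \<Longrightarrow> j < n \<Longrightarrow> Q (e i j)"
  shows "Q (\<lambda>x. det (mat n n (\<lambda>(i, j). e i j x)))"
proof -
  have sum: "Q (\<lambda>x. \<Sum>a\<in>A. f a x)" if "finite A" "\<And>a. a \<in> A \<Longrightarrow> Q (f a)" for A :: "(nat \<Rightarrow> nat) set" and f
    using that by (induction A) (auto intro: const add)
  have prod: "Q (\<lambda>x. \<Prod>a\<in>A. f a x)" if "finite A" "\<And>a. a \<in> A \<Longrightarrow> Q (f a)" for A :: "nat set" and f
    using that by (induction A) (auto intro: const mult)
  have pl: "p i < n" if "p permutes {0..<n}" "i < n" for p i
    using permutes_in_image[OF that(1), of i] that(2) by simp
  have eq: "(\<lambda>x. det (mat n n (\<lambda>(i, j). e i j x)))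
     = (\<lambda>x. \<Sum>p\<in>{p. p permutes {0..<n}}. signof p * (\<Prod>i = 0..<n. e i (p i) x))"
    unfolding det_def by (auto intro!: sum.cong prod.cong ext simp: pl)
  show ?thesis
    unfolding eq by (intro sum mult const prod finite_permutations) (auto intro!: e simp: pl)
qed

text \<open>The coefficient of the \<open>j\<close>-th derivative of \<open>u\<close> in the expansion of \<open>W(\<phi>\<^sub>1, \<dots>, \<phi>\<^sub>k, u)\<close>
  along its last column.\<close>

definition wcoeff :: "real set \<Rightarrow> (nat \<Rightarrow> real \<Rightarrow> real) \<Rightarrow> nat \<Rightarrow> nat \<Rightarrow> real \<Rightarrow> real" where
  "wcoeff S \<phi> k j x = (-1) ^ (j + k) *
     det (mat k k (\<lambda>(i, l). hder S (if i < j then i else Suc i) (\<phi> (Suc l)) x))"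

lemma wronskian_snoc:
  "wronskian S (map \<phi> [1..<Suc k] @ [u]) x = (\<Sum>j\<le>k. wcoeff S \<phi> k j x * hder S j u x)"
proof -
  let ?us = "map \<phi> [1..<Suc k] @ [u]"
  let ?A = "mat (Suc k) (Suc k) (\<lambda>(i, j). hder S i (?us ! j) x)"
  have nth: "?us ! l = \<phi> (Suc l)" if "l < k" for l
    using that by (simp add: nth_append del: upt_Suc)
  have nthk: "?us ! k = u" by (simp add: nth_append del: upt_Suc)
  have "wronskian S ?us x = det ?A" by (simp add: wronskian_def del: upt_Suc)
  also have "\<dots> = (\<Sum>i<Suc k. ?A $$ (i, k) * cofactor ?A i k)"
    by (rule laplace_expansion_column) auto
  also have "\<dots> = (\<Sum>j\<le>k. wcoeff S \<phi> k j x * hder S j u x)"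
    unfolding lessThan_Suc_atMost
  proof (rule sum.cong)
    fix j assume j: "j \<in> {..k}"
    have "mat_delete ?A j k = mat k k (\<lambda>(i, l). hder S (if i < j then i else Suc i) (\<phi> (Suc l)) x)"
      using j by (intro eq_matI) (auto simp: mat_delete_def nth simp del: upt_Suc One_nat_def)
    moreover have "?A $$ (j, k) = hder S j u x" using j by (simp add: nthk del: upt_Suc One_nat_def)
    ultimately show "?A $$ (j, k) * cofactor ?A j k = wcoeff S \<phi> k j x * hder S j u x"
      by (simp add: cofactor_def wcoeff_def)
  qed simp
  finally show ?thesis .
qed

lemma Wf_eq_det: "Wf S \<phi> k x = det (mat k k (\<lambda>(i, l). hder S i (\<phi> (Suc l)) x))"
proof (cases k)
  case 0
  have "det (mat 0 0 (\<lambda>(i, l). hder S i (\<phi> (Suc l)) x)) = 1" by (rule det_dim_zero) auto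
  then show ?thesis using 0 by (simp add: Wf_def wronskian_def)
next
  case (Suc m)
  have "mat k k (\<lambda>(i, j). hder S i (map \<phi> [1..<Suc k] ! j) x) = mat k k (\<lambda>(i, l). hder S i (\<phi> (Suc l)) x)"
    by (intro eq_matI) (auto simp del: upt_Suc)
  then show ?thesis using Suc by (auto simp: Wf_def wronskian_def simp del: upt_Suc)
qed

lemma wcoeff_top: "wcoeff S \<phi> k k x = Wf S \<phi> k x"
proof -
  have "mat k k (\<lambda>(i, l). hder S (if i < k then i else Suc i) (\<phi> (Suc l)) x)
     = mat k k (\<lambda>(i, l). hder S i (\<phi> (Suc l)) x)"
    by (intro eq_matI) auto
  then show ?thesis by (simp add: wcoeff_def Wf_eq_det flip: mult_2)
qed

lemma Wf_Suc: "Wf S \<phi> (Suc k) x = (\<Sum>j\<le>k. wcoeff S \<phi> k j x * hder S j (\<phi> (Suc k)) x)"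
  using wronskian_snoc[of S \<phi> k "\<phi> (Suc k)" x] by (simp add: Wf_def)

text \<open>The sum is the Wronskian of a list in which \<open>\<phi> i\<close> occurs
  twice.\<close>

lemma wcoeff_annihilates:
  assumes "1 \<le> i" "i \<le> k"
  shows "(\<Sum>j\<le>k. wcoeff S \<phi> k j x * hder S j (\<phi> i) x) = 0"
proof -
  let ?us = "map \<phi> [1..<Suc k] @ [\<phi> i]"
  let ?A = "mat (Suc k) (Suc k) (\<lambda>(i, j). hder S i (?us ! j) x)"
  have "?us ! (i - 1) = \<phi> i" "?us ! k = \<phi> i"
    using assms by (auto simp: nth_append simp del: upt_Suc)
  then have "col ?A (i - 1) = col ?A k"
    using assms by (intro eq_vecI) auto
  then have "det ?A = 0"
    using assms by (intro det_identical_columns[of ?A "Suc k" "i - 1" k]) auto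
  then show ?thesis unfolding wronskian_snoc[symmetric] by (simp add: wronskian_def del: upt_Suc)
qed

text \<open>A linear functional of the jet of order below k is determined by its values on
  \<open>\<phi> 1\<close>, ..., \<open>\<phi> k\<close>. Identities between differential operators
  are derived below from this uniqueness instead of by computing with determinants.\<close>

lemma jets_independent:
  assumes W: "Wf S \<phi> k x \<noteq> 0"
    and z: "\<And>i. 1 \<le> i \<Longrightarrow> i \<le> k \<Longrightarrow> (\<Sum>j<k. d j * hder S j (\<phi> i) x) = 0" and "j < k"
  shows "d j = 0"
proof -
  let ?A = "mat k k (\<lambda>(i, l). hder S i (\<phi> (Suc l)) x)"
  let ?B = "transpose_mat ?A"
  have B: "?B \<in> carrier_mat k k" by simp
  have "det ?B \<noteq> 0" using W det_transpose[of ?A k] by (simp add: Wf_eq_det)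
  moreover have "?B *\<^sub>v vec k d = 0\<^sub>v k"
  proof (rule eq_vecI)
    fix i assume i: "i < dim_vec (0\<^sub>v k)"
    then show "(?B *\<^sub>v vec k d) $ i = 0\<^sub>v k $ i"
      using z[of "Suc i"] by (simp add: scalar_prod_def atLeast0LessThan mult.commute)
  qed simp
  ultimately have "vec k d = 0\<^sub>v k"
    using det_0_iff_vec_prod_zero_field[OF B] by (metis vec_carrier)
  then show ?thesis using \<open>j < k\<close> by (metis index_vec index_zero_vec(1))
qed

lemma wronskian_zero_combination:
  assumes W: "Wf S \<phi> k x = 0"
  obtains c where "\<exists>i\<in>{1..k}. c i \<noteq> 0"
    "\<And>j. j < k \<Longrightarrow> (\<Sum>i=1..k. c i * hder S j (\<phi> i) x) = 0"
proof -
  let ?A = "mat k k (\<lambda>(i, l). hder S i (\<phi> (Suc l)) x)"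
  have A: "?A \<in> carrier_mat k k" by simp
  have "det ?A = 0" using W by (simp add: Wf_eq_det)
  then obtain v where v: "v \<in> carrier_vec k" "v \<noteq> 0\<^sub>v k" "?A *\<^sub>v v = 0\<^sub>v k"
    using det_0_iff_vec_prod_zero_field[OF A] by blast
  have sh: "(\<Sum>i=1..k. g i) = (\<Sum>l<k. g (Suc l))" for g :: "nat \<Rightarrow> real"
    by (simp add: sum.atLeast1_atMost_eq)
  show ?thesis
  proof (rule that[of "\<lambda>i. v $ (i - 1)"])
    obtain l where "l < k" "v $ l \<noteq> 0"
      using v(1,2) by (metis carrier_vecD eq_vecI index_zero_vec(1,2))
    then show "\<exists>i\<in>{1..k}. v $ (i - 1) \<noteq> 0" by (intro bexI[of _ "Suc l"]) auto
    fix j assume "j < k"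
    then have "(?A *\<^sub>v v) $ j = 0" using v(3) by simp
    then show "(\<Sum>i=1..k. v $ (i - 1) * hder S j (\<phi> i) x) = 0"
      using \<open>j < k\<close> v(1) unfolding sh by (simp add: scalar_prod_def atLeast0LessThan mult.commute)
  qed
qed

text \<open>The coefficients form a column of the inverse of the Wronskian matrix.\<close>

lemma combination_with_prescribed_jet:
  assumes W: "Wf S \<phi> k x \<noteq> 0" and "m < k"
  obtains c where "\<And>j. j < k \<Longrightarrow> (\<Sum>i=1..k. c i * hder S j (\<phi> i) x) = (if j = m then 1 else 0)"
proof -
  let ?A = "mat k k (\<lambda>(i, l). hder S i (\<phi> (Suc l)) x)"
  have A: "?A \<in> carrier_mat k k" by simp
  have "det ?A \<noteq> 0" using W by (simp add: Wf_eq_det)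
  from det_non_zero_imp_unit[OF A this, unfolded Units_def, of "()"]
  obtain B where B: "B \<in> carrier_mat k k" and AB: "?A * B = 1\<^sub>m k"
    unfolding ring_mat_def by auto
  have sh: "(\<Sum>i=1..k. g i) = (\<Sum>l<k. g (Suc l))" for g :: "nat \<Rightarrow> real"
    by (simp add: sum.atLeast1_atMost_eq)
  show ?thesis
  proof (rule that[of "\<lambda>i. B $$ (i - 1, m)"])
    fix j assume j: "j < k"
    have "(?A * B) $$ (j, m) = (if j = m then 1 else 0)" using AB j \<open>m < k\<close> by simp
    then show "(\<Sum>i=1..k. B $$ (i - 1, m) * hder S j (\<phi> i) x) = (if j = m then 1 else 0)"
      using j \<open>m < k\<close> B unfolding sh
      by (simp add: scalar_prod_def atLeast0LessThan mult.commute)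
  qed
qed

section \<open>Iterated derivatives within the interval\<close>

lemma deriv_within_works:
  "g differentiable (at x within S) \<Longrightarrow> (g has_real_derivative deriv_within S g x) (at x within S)"
  unfolding deriv_within_def real_differentiable_def by (rule someI_ex)

lemma deriv_within_ivl:
  "x \<in> ivl T x0 \<Longrightarrow> (g has_real_derivative D) (at x within ivl T x0) \<Longrightarrow> deriv_within (ivl T x0) g x = D"
  using deriv_within_works[of g x "ivl T x0"] derivative_unique_ivl real_differentiable_def by blast

lemma has_real_derivative_cong_on:
  assumes "(g has_real_derivative D) (at x within S)" "x \<in> S" "\<And>y. y \<in> S \<Longrightarrow> g y = h y"
  shows "(h has_real_derivative D) (at x within S)"
  by (rule has_field_derivative_transform_within[where d = 1, OF assms(1) _ assms(2)]) (simp_all add: assms(3))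

lemma hder_derivative:
  "AC_on S m u \<Longrightarrow> j < m \<Longrightarrow> x \<in> S \<Longrightarrow>
    (hder S j u has_real_derivative hder S (Suc j) u x) (at x within S)"
  unfolding AC_on_def by (auto intro: deriv_within_works)

text \<open>Only the top derivative is absolutely continuous by definition; each lower one has a
  continuous derivative and so is locally Lipschitz, whence the downward induction.\<close>

lemma hder_locally_abs_cont:
  assumes AC: "AC_on (ivl T x0) m u" and "j \<le> m"
  shows "locally_abs_cont_on (ivl T x0) (hder (ivl T x0) j u)"
proof -
  have top: "locally_abs_cont_on (ivl T x0) (hder (ivl T x0) m u)"
    using AC unfolding AC_on_def locally_abs_cont_on_def by blast
  have down: "locally_abs_cont_on (ivl T x0) (hder (ivl T x0) j u)"
    if "Suc j \<le> m" "locally_abs_cont_on (ivl T x0) (hder (ivl T x0) (Suc j) u)" for j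
    unfolding locally_abs_cont_on_def
  proof (intro allI impI, elim conjE)
    fix a b assume ab: "a \<le> b" "{a..b} \<subseteq> ivl T x0"
    show "abs_cont_on a b (hder (ivl T x0) j u)"
    proof (rule abs_cont_on_C1)
      show "(hder (ivl T x0) j u has_real_derivative hder (ivl T x0) (Suc j) u x) (at x within {a..b})"
        if "x \<in> {a..b}" for x
      proof -
        have "x \<in> ivl T x0" using that ab(2) by blast
        from hder_derivative[OF AC _ this, of j] show ?thesis
          using \<open>Suc j \<le> m\<close> DERIV_subset[OF _ ab(2)] by simp
      qed
      show "continuous_on {a..b} (hder (ivl T x0) (Suc j) u)"
        using locally_abs_cont_on_continuous[OF that(2)] ab(2) continuous_on_subset by blast
    qed
  qed
  show ?thesis using \<open>j \<le> m\<close>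
  proof (induction j rule: inc_induct)
    case (step k)
    then show ?case using down[of k] by auto
  qed (rule top)
qed

lemma AC_on_lincomb:
  assumes u: "AC_on (ivl T x0) m u" and v: "AC_on (ivl T x0) m v"
  shows "AC_on (ivl T x0) m (\<lambda>x. u x + c * v x)"
    and "j \<le> m \<Longrightarrow> x \<in> ivl T x0 \<Longrightarrow>
      hder (ivl T x0) j (\<lambda>x. u x + c * v x) x = hder (ivl T x0) j u x + c * hder (ivl T x0) j v x"
proof -
  let ?S = "ivl T x0" and ?w = "\<lambda>x. u x + c * v x"
  have *: "j \<le> m \<longrightarrow> (\<forall>x\<in>?S. hder ?S j ?w x = hder ?S j u x + c * hder ?S j v x)" for j
  proof (induction j)
    case (Suc j)
    show ?case
    proof (intro impI ballI)
      fix x assume j: "Suc j \<le> m" and x: "x \<in> ?S"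
      have "((\<lambda>x. hder ?S j u x + c * hder ?S j v x) has_real_derivative
         hder ?S (Suc j) u x + c * hder ?S (Suc j) v x) (at x within ?S)"
        using hder_derivative[OF u _ x, of j] hder_derivative[OF v _ x, of j] j
        by (intro DERIV_add DERIV_cmult) auto
      then have "(hder ?S j ?w has_real_derivative
         hder ?S (Suc j) u x + c * hder ?S (Suc j) v x) (at x within ?S)"
        by (rule has_real_derivative_cong_on) (use Suc.IH j x in auto)
      then show "hder ?S (Suc j) ?w x = hder ?S (Suc j) u x + c * hder ?S (Suc j) v x"
        using deriv_within_ivl[OF x] by simp
    qed
  qed simp
  show "j \<le> m \<Longrightarrow> x \<in> ?S \<Longrightarrow> hder ?S j ?w x = hder ?S j u x + c * hder ?S j v x" for j x
    using * by blast
  show "AC_on ?S m ?w"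
    unfolding AC_on_def
  proof (intro conjI allI impI ballI)
    fix j x assume j: "j < m" and x: "x \<in> ?S"
    have "((\<lambda>x. hder ?S j u x + c * hder ?S j v x) has_real_derivative
       hder ?S (Suc j) u x + c * hder ?S (Suc j) v x) (at x within ?S)"
      using hder_derivative[OF u j x] hder_derivative[OF v j x]
      by (intro DERIV_add DERIV_cmult) auto
    then have "(hder ?S j ?w has_real_derivative
       hder ?S (Suc j) u x + c * hder ?S (Suc j) v x) (at x within ?S)"
      by (rule has_real_derivative_cong_on) (use * j x in auto)
    then show "hder ?S j ?w differentiable (at x within ?S)"
      using real_differentiable_def by blast
  next
    fix a b assume ab: "a \<le> b \<and> {a..b} \<subseteq> ?S"
    have "abs_cont_on a b (\<lambda>x. hder ?S m u x + c * hder ?S m v x)"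
      using u v ab unfolding AC_on_def by (intro abs_cont_on_add abs_cont_on_mult abs_cont_on_const) auto
    then show "abs_cont_on a b (hder ?S m ?w)"
      by (rule abs_cont_on_cong[rotated]) (use * ab in auto)
  qed
qed

lemma AC_on_zero: "AC_on (ivl T x0) m (\<lambda>x. 0)" "x \<in> ivl T x0 \<Longrightarrow> hder (ivl T x0) j (\<lambda>x. 0) x = 0"
proof -
  let ?S = "ivl T x0"
  have *: "\<forall>x\<in>?S. hder ?S j (\<lambda>x. 0) x = 0" for j
  proof (induction j)
    case (Suc j)
    have "(hder ?S j (\<lambda>x. 0) has_real_derivative 0) (at x within ?S)" if "x \<in> ?S" for x
      by (rule has_real_derivative_cong_on[where g = "\<lambda>x. 0"]) (use Suc.IH that in auto)
    then show ?case using deriv_within_ivl by auto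
  qed simp
  show "x \<in> ?S \<Longrightarrow> hder ?S j (\<lambda>x. 0) x = 0" for x j using * by blast
  have "(hder ?S j (\<lambda>x. 0) has_real_derivative 0) (at x within ?S)" if "x \<in> ?S" for x j
    by (rule has_real_derivative_cong_on[where g = "\<lambda>x. 0"]) (use * that in auto)
  moreover have "abs_cont_on a b (hder ?S m (\<lambda>x. 0))" if "{a..b} \<subseteq> ?S" for a b
    by (rule abs_cont_on_cong[OF _ abs_cont_on_const[of a b 0]]) (use * that in auto)
  ultimately show "AC_on ?S m (\<lambda>x. 0)"
    unfolding AC_on_def real_differentiable_def by blast
qed

lemma AC_on_sum:
  assumes "finite A" "\<And>i. i \<in> A \<Longrightarrow> AC_on (ivl T x0) m (\<psi> i)"
  shows "AC_on (ivl T x0) m (\<lambda>x. \<Sum>i\<in>A. c i * \<psi> i x) \<and>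
    (\<forall>j\<le>m. \<forall>x\<in>ivl T x0. hder (ivl T x0) j (\<lambda>x. \<Sum>i\<in>A. c i * \<psi> i x) x
        = (\<Sum>i\<in>A. c i * hder (ivl T x0) j (\<psi> i) x))"
  using assms
proof (induction A)
  case empty
  then show ?case using AC_on_zero by auto
next
  case (insert a A)
  let ?u = "\<lambda>x. \<Sum>i\<in>A. c i * \<psi> i x"
  have "AC_on (ivl T x0) m ?u" "AC_on (ivl T x0) m (\<psi> a)" using insert by auto
  note l = AC_on_lincomb[OF this, where c = "c a"]
  have eq: "(\<lambda>x. \<Sum>i\<in>insert a A. c i * \<psi> i x) = (\<lambda>x. ?u x + c a * \<psi> a x)"
    using insert by (auto simp: add.commute)
  show ?case unfolding eq using l insert by (auto simp: add.commute)
qed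

lemma locally_abs_cont_on_const: "locally_abs_cont_on S (\<lambda>x. c)"
  and locally_abs_cont_on_add: "locally_abs_cont_on S f \<Longrightarrow> locally_abs_cont_on S g \<Longrightarrow>
    locally_abs_cont_on S (\<lambda>x. f x + g x)"
  and locally_abs_cont_on_mult: "locally_abs_cont_on S f \<Longrightarrow> locally_abs_cont_on S g \<Longrightarrow>
    locally_abs_cont_on S (\<lambda>x. f x * g x)"
  unfolding locally_abs_cont_on_def
  by (auto intro: abs_cont_on_const abs_cont_on_add abs_cont_on_mult)

lemma locally_abs_cont_on_sum:
  "finite A \<Longrightarrow> (\<And>i. i \<in> A \<Longrightarrow> locally_abs_cont_on S (f i)) \<Longrightarrow> locally_abs_cont_on S (\<lambda>x. \<Sum>i\<in>A. f i x)"
  by (induction A rule: finite_induct) (auto intro: locally_abs_cont_on_const locally_abs_cont_on_add)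

lemma locally_abs_cont_on_inverse:
  "locally_abs_cont_on S f \<Longrightarrow> (\<And>x. x \<in> S \<Longrightarrow> f x \<noteq> 0) \<Longrightarrow> locally_abs_cont_on S (\<lambda>x. inverse (f x))"
  unfolding locally_abs_cont_on_def by (auto intro!: abs_cont_on_inverse)

lemma wcoeff_closed:
  assumes const: "\<And>c. Q (\<lambda>x. c)"
    and add: "\<And>f g. Q f \<Longrightarrow> Q g \<Longrightarrow> Q (\<lambda>x. f x + g x)"
    and mult: "\<And>f g. Q f \<Longrightarrow> Q g \<Longrightarrow> Q (\<lambda>x. f x * g x)"
    and e: "\<And>i l. i \<le> k \<Longrightarrow> 1 \<le> l \<Longrightarrow> l \<le> k \<Longrightarrow> Q (hder S i (\<phi> l))"
  shows "Q (wcoeff S \<phi> k j)"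
proof -
  have "Q (\<lambda>x. det (mat k k (\<lambda>(i, l). (\<lambda>i l. hder S (if i < j then i else Suc i) (\<phi> (Suc l))) i l x)))"
    by (rule det_mat_closed[OF const add mult]) (use e in auto)
  then have "Q (\<lambda>x. (-1) ^ (j + k) * det (mat k k (\<lambda>(i, l). hder S (if i < j then i else Suc i) (\<phi> (Suc l)) x)))"
    by (intro mult const)
  then show ?thesis unfolding wcoeff_def .
qed

lemma Wf_closed:
  assumes const: "\<And>c. Q (\<lambda>x. c)"
    and add: "\<And>f g. Q f \<Longrightarrow> Q g \<Longrightarrow> Q (\<lambda>x. f x + g x)"
    and mult: "\<And>f g. Q f \<Longrightarrow> Q g \<Longrightarrow> Q (\<lambda>x. f x * g x)"
    and e: "\<And>i l. i < k \<Longrightarrow> 1 \<le> l \<Longrightarrow> l \<le> k \<Longrightarrow> Q (hder S i (\<phi> l))"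
  shows "Q (Wf S \<phi> k)"
proof -
  have "Q (\<lambda>x. det (mat k k (\<lambda>(i, l). (\<lambda>i l. hder S i (\<phi> (Suc l))) i l x)))"
    by (rule det_mat_closed[OF const add mult]) (use e in auto)
  then show ?thesis unfolding Wf_eq_det .
qed

text \<open>No growth relation is assumed: reversing a Chebyshev scale inverts the order of growth
  but keeps these axioms, so every result of this locale is available for both chains of
  operators.\<close>

locale wronskian_system =
  fixes T :: real and x0 :: ereal and n :: nat and \<phi> :: "nat \<Rightarrow> real \<Rightarrow> real"
  assumes T_less: "ereal T < x0" and n2: "n \<ge> 2"
    and AC: "\<And>i. 1 \<le> i \<Longrightarrow> i \<le> n \<Longrightarrow> AC_on (ivl T x0) (n - 1) (\<phi> i)"
    and W_nonzero: "\<And>i x. 1 \<le> i \<Longrightarrow> i \<le> n \<Longrightarrow> x \<in> ivl T x0 \<Longrightarrow> Wf (ivl T x0) \<phi> i x \<noteq> 0"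
begin

abbreviation S :: "real set" where "S \<equiv> ivl T x0"
abbreviation W :: "nat \<Rightarrow> real \<Rightarrow> real" where "W \<equiv> Wf S \<phi>"
abbreviation M :: "nat \<Rightarrow> (real \<Rightarrow> real) \<Rightarrow> real \<Rightarrow> real" where "M \<equiv> wop S (qw S \<phi> n)"

text \<open>\<open>M k u\<close> without its sign, normalised so that
  \<open>N k (\<phi> (Suc k)) = 1\<close>. The expanded numerator exhibits it as a linear functional
  of the jet of u.\<close>

definition N :: "nat \<Rightarrow> (real \<Rightarrow> real) \<Rightarrow> real \<Rightarrow> real" where
  "N k u x = (\<Sum>j\<le>k. wcoeff S \<phi> k j x * hder S j u x) / W (Suc k) x"

lemma T_in: "T \<in> S" using T_less by (simp add: mem_ivl)

lemma W_0: "W 0 x = 1" by (simp add: Wf_def wronskian_def)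

lemma W_nz: "k \<le> n \<Longrightarrow> x \<in> S \<Longrightarrow> W k x \<noteq> 0"
  using W_nonzero[of k x] W_0 by (cases "k = 0") auto

lemma N_basis:
  assumes "1 \<le> i" "i \<le> Suc k" "Suc k \<le> n" "x \<in> S"
  shows "N k (\<phi> i) x = (if i = Suc k then 1 else 0)"
proof (cases "i = Suc k")
  case True
  then show ?thesis unfolding N_def True Wf_Suc[symmetric] using W_nz[OF assms(3,4)] by simp
next
  case False
  then show ?thesis unfolding N_def using wcoeff_annihilates[of i k S \<phi> x] assms by simp
qed

text \<open>The formula of Polya and Frobenius for the derivative of a quotient of Wronskians. Both sides
  are functionals of the jet of \<open>u\<close> at \<open>x\<close> with the same leading coefficient which annihilate
  \<open>\<phi>\<^sub>1, \<dots>, \<phi>\<^sub>k\<^sub>+\<^sub>1\<close>, and the jets of these functions are linearly independent.\<close>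

lemma N_derivative:
  assumes k: "Suc k \<le> n" and x: "x \<in> S"
    and d\<phi>: "\<And>i j. 1 \<le> i \<Longrightarrow> i \<le> Suc k \<Longrightarrow> j \<le> k \<Longrightarrow> hder S j (\<phi> i) differentiable (at x within S)"
    and du: "\<And>j. j \<le> k \<Longrightarrow> hder S j u differentiable (at x within S)"
  shows "(N k u has_real_derivative
     W k x * (\<Sum>j\<le>Suc k. wcoeff S \<phi> (Suc k) j x * hder S j u x) / (W (Suc k) x)\<^sup>2) (at x within S)"
proof -
  define w where "w = W (Suc k) x"
  have w: "w \<noteq> 0" unfolding w_def using W_nz[OF k x] .
  have "wcoeff S \<phi> k j differentiable (at x within S)" if "j \<le> k" for j
    by (rule wcoeff_closed[where Q = "\<lambda>f. f differentiable (at x within S)"]) (use d\<phi> in auto)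
  then have "\<forall>j\<le>k. \<exists>D. (wcoeff S \<phi> k j has_real_derivative D) (at x within S)"
    unfolding real_differentiable_def by blast
  then obtain c' where c': "\<And>j. j \<le> k \<Longrightarrow> (wcoeff S \<phi> k j has_real_derivative c' j) (at x within S)"
    by metis
  have "W (Suc k) differentiable (at x within S)"
    by (rule Wf_closed[where Q = "\<lambda>f. f differentiable (at x within S)"]) (use d\<phi> in auto)
  then obtain w' where w': "(W (Suc k) has_real_derivative w') (at x within S)"
    unfolding real_differentiable_def by blast
  define c where "c j = wcoeff S \<phi> k j x" for j
  \<comment> \<open>Coefficients after the product rule: \<open>D j\<close> collects the derivative
    of the j-th coefficient of \<open>N k\<close> and, from differentiating u, the coefficient of
    index \<open>j - 1\<close>. Setting \<open>d (Suc k) = 0\<close> lets both sums run to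
    \<open>Suc k\<close>.\<close>
  define d where "d j = (if j \<le> k then (c' j * w - c j * w') / (w * w) else 0)" for j
  define D where "D j = d j + (if j = 0 then 0 else c (j - 1) / w)" for j
  have der: "(N k u has_real_derivative (\<Sum>j\<le>Suc k. D j * hder S j u x)) (at x within S)"
    if du: "\<And>j. j \<le> k \<Longrightarrow> hder S j u differentiable (at x within S)" for u
  proof -
    have "(hder S j u has_real_derivative hder S (Suc j) u x) (at x within S)" if "j \<le> k" for j
      using deriv_within_works[OF du[OF that]] by simp
    then have "((\<lambda>x. (wcoeff S \<phi> k j x / W (Suc k) x) * hder S j u x) has_real_derivative
       (d j * hder S j u x + c j / w * hder S (Suc j) u x)) (at x within S)" if "j \<le> k" for j
      using DERIV_mult[OF DERIV_divide[OF c'[OF that] w'], of "hder S j u" "hder S (Suc j) u x"] w that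
      by (simp add: d_def c_def w_def algebra_simps)
    then have "((\<lambda>x. \<Sum>j\<le>k. (wcoeff S \<phi> k j x / W (Suc k) x) * hder S j u x) has_real_derivative
       (\<Sum>j\<le>k. d j * hder S j u x + c j / w * hder S (Suc j) u x)) (at x within S)"
      by (intro DERIV_sum) auto
    also have "(\<lambda>x. \<Sum>j\<le>k. (wcoeff S \<phi> k j x / W (Suc k) x) * hder S j u x) = N k u"
      by (simp add: N_def sum_divide_distrib fun_eq_iff)
    also have "(\<Sum>j\<le>k. d j * hder S j u x + c j / w * hder S (Suc j) u x) = (\<Sum>j\<le>Suc k. D j * hder S j u x)"
    proof -
      have "(\<Sum>j\<le>Suc k. D j * hder S j u x) = (\<Sum>j\<le>Suc k. d j * hder S j u x)
         + (\<Sum>j\<le>Suc k. (if j = 0 then 0 else c (j - 1) / w) * hder S j u x)"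
        by (simp add: D_def distrib_right sum.distrib del: sum.atMost_Suc)
      also have "(\<Sum>j\<le>Suc k. d j * hder S j u x) = (\<Sum>j\<le>k. d j * hder S j u x)"
        by (simp add: d_def)
      also have "(\<Sum>j\<le>Suc k. (if j = 0 then 0 else c (j - 1) / w) * hder S j u x)
          = (\<Sum>j\<le>k. c j / w * hder S (Suc j) u x)"
        by (subst sum.atMost_Suc_shift) simp
      finally show ?thesis by (simp add: sum.distrib)
    qed
    finally show ?thesis .
  qed
  define e where "e j = W k x * wcoeff S \<phi> (Suc k) j x / w\<^sup>2" for j
  have top: "D (Suc k) = e (Suc k)"
    using w by (simp add: D_def d_def c_def e_def wcoeff_top w_def power2_eq_square)
  have zero: "(\<Sum>j\<le>Suc k. (D j - e j) * hder S j (\<phi> i) x) = 0" if i: "1 \<le> i" "i \<le> Suc k" for i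
  proof -
    have "(N k (\<phi> i) has_real_derivative 0) (at x within S)"
      by (rule has_real_derivative_cong_on[OF DERIV_const[where k = "if i = Suc k then 1 else 0"] x])
        (use N_basis[OF i k] in auto)
    then have "(\<Sum>j\<le>Suc k. D j * hder S j (\<phi> i) x) = 0"
      using derivative_unique_ivl[OF x] der[of "\<phi> i"] d\<phi> i by blast
    moreover have "(\<Sum>j\<le>Suc k. e j * hder S j (\<phi> i) x)
       = W k x / w\<^sup>2 * (\<Sum>j\<le>Suc k. wcoeff S \<phi> (Suc k) j x * hder S j (\<phi> i) x)"
      unfolding sum_distrib_left by (rule sum.cong) (auto simp: e_def)
    ultimately show ?thesis
      using wcoeff_annihilates[OF i, of S \<phi> x] by (simp add: left_diff_distrib sum_subtractf del: sum.atMost_Suc)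
  qed
  have "D j - e j = 0" if "j < Suc k" for j
  proof (rule jets_independent[OF W_nz[OF k x] _ that])
    fix i assume "1 \<le> i" "i \<le> Suc k"
    from zero[OF this] show "(\<Sum>j<Suc k. (D j - e j) * hder S j (\<phi> i) x) = 0"
      using top by (simp add: lessThan_Suc_atMost)
  qed
  then have "D j = e j" if "j \<le> Suc k" for j using that top by (cases "j = Suc k") auto
  then have "(\<Sum>j\<le>Suc k. D j * hder S j u x) = (\<Sum>j\<le>Suc k. e j * hder S j u x)" by simp
  also have "\<dots> = W k x * (\<Sum>j\<le>Suc k. wcoeff S \<phi> (Suc k) j x * hder S j u x) / w\<^sup>2"
    unfolding sum_distrib_left sum_divide_distrib by (rule sum.cong) (auto simp: e_def)
  finally show ?thesis using der[OF du] unfolding w_def by simp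
qed

end

section \<open>The chain \<open>M k\<close> and its signs\<close>

context wronskian_system begin

lemma W_continuous: "k \<le> n \<Longrightarrow> continuous_on S (W k)"
  by (rule Wf_closed[where Q = "continuous_on S", OF continuous_on_const continuous_on_add continuous_on_mult])
    (auto intro!: locally_abs_cont_on_continuous hder_locally_abs_cont[OF AC])

definition sg :: "nat \<Rightarrow> real" where "sg k = sgn (W k T)"

lemma sg_abs: "k \<le> n \<Longrightarrow> \<bar>sg k\<bar> = 1"
  unfolding sg_def using W_nz[OF _ T_in] by (auto simp: sgn_if)

lemma sgn_W: assumes k: "k \<le> n" and x: "x \<in> S" shows "sgn (W k x) = sg k"
proof (rule ccontr)
  assume ne: "sgn (W k x) \<noteq> sg k"
  have Tx: "T \<le> x" using x by (simp add: mem_ivl)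
  have c: "continuous_on {T..x} (W k)"
    using W_continuous[OF k] ivl_subset[OF T_in x] by (rule continuous_on_subset)
  have "\<exists>z. T \<le> z \<and> z \<le> x \<and> W k z = 0"
  proof (cases "W k T \<le> 0")
    case True
    then have "W k T \<le> 0 \<and> 0 \<le> W k x"
      using ne W_nz[OF k x] W_nz[OF k T_in] by (auto simp: sg_def sgn_if split: if_splits)
    then show ?thesis using IVT'[of "W k" T 0 x] Tx c by blast
  next
    case False
    then have "0 \<le> W k T \<and> W k x \<le> 0"
      using ne W_nz[OF k x] W_nz[OF k T_in] by (auto simp: sg_def sgn_if split: if_splits)
    then show ?thesis using IVT2'[of "W k" x 0 T] Tx c by blast
  qed
  then obtain z where z: "T \<le> z" "z \<le> x" "W k z = 0" by blast
  then have "z \<in> S" using ivl_subset[OF T_in x] by auto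
  then show False using W_nz[OF k] z(3) by blast
qed

lemma abs_W: "k \<le> n \<Longrightarrow> x \<in> S \<Longrightarrow> \<bar>W k x\<bar> = sg k * W k x"
  using sgn_W[of k x] by (metis abs_sgn mult.commute)

text \<open>The accumulated sign between \<open>M k\<close> and \<open>N k\<close>: the weight of
  index \<open>Suc k\<close> divides by the absolute values of \<open>W k\<close> and
  \<open>W (Suc (Suc k))\<close>, and each leaves one sign behind.\<close>

fun \<sigma> :: "nat \<Rightarrow> real" where
  "\<sigma> 0 = sg 1"
| "\<sigma> (Suc k) = \<sigma> k * sg k * sg (Suc (Suc k))"

lemma \<sigma>_abs: "k < n \<Longrightarrow> \<bar>\<sigma> k\<bar> = 1"
proof (induction k)
  case (Suc k)
  then show ?case using sg_abs[of k] sg_abs[of "Suc (Suc k)"] by (simp add: abs_mult)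
qed (use sg_abs n2 in auto)

lemma \<sigma>_nz: "k < n \<Longrightarrow> \<sigma> k \<noteq> 0"
  using \<sigma>_abs[of k] by auto

lemma W_1: "W (Suc 0) x = \<phi> (Suc 0) x"
  using Wf_Suc[of S \<phi> 0 x] by (simp add: wcoeff_top W_0)

lemma \<phi>1_nz: "x \<in> S \<Longrightarrow> \<phi> 1 x \<noteq> 0"
  using W_nz[of 1 x] n2 W_1[of x] by simp

lemma qw_pos: "k \<le> n \<Longrightarrow> x \<in> S \<Longrightarrow> qw S \<phi> n k x > 0"
  using \<phi>1_nz[of x] W_nz[of k x] W_nz[of "k - 1" x] W_nz[of "k + 1" x] W_nz[of n x] W_nz[of "n - 1" x]
  by (auto simp: qw_def)

lemma qw_continuous: "k \<le> n \<Longrightarrow> continuous_on S (qw S \<phi> n k)"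
proof -
  assume k: "k \<le> n"
  have p1: "continuous_on S (\<phi> 1)"
    using W_continuous[of "Suc 0"] n2 W_1 by (simp add: fun_eq_iff cong: continuous_on_cong)
  consider "k = 0" | "0 < k" "k < n" | "k = n" "0 < k" using k n2 by linarith
  then show ?thesis
  proof cases
    case 1
    then have "qw S \<phi> n k = (\<lambda>x. 1 / \<bar>\<phi> 1 x\<bar>)" by (simp add: qw_def fun_eq_iff)
    then show ?thesis using p1 \<phi>1_nz by (auto intro!: continuous_intros)
  next
    case 2
    then have "qw S \<phi> n k = (\<lambda>x. (W k x)\<^sup>2 / \<bar>W (k - 1) x * W (k + 1) x\<bar>)"
      by (simp add: qw_def fun_eq_iff)
    then show ?thesis using 2 W_continuous W_nz by (auto intro!: continuous_intros)
  next
    case 3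
    then have "qw S \<phi> n k = (\<lambda>x. \<bar>W n x / W (n - 1) x\<bar>)" by (simp add: qw_def fun_eq_iff)
    then show ?thesis using 3 W_continuous W_nz by (auto intro!: continuous_intros)
  qed
qed

lemma differentiable_\<phi>:
  "1 \<le> i \<Longrightarrow> i \<le> n \<Longrightarrow> j < n - 1 \<Longrightarrow> x \<in> S \<Longrightarrow> hder S j (\<phi> i) differentiable (at x within S)"
  using AC[of i] unfolding AC_on_def by blast

text \<open>In the induction step the square of \<open>W (Suc k)\<close> cancels between the weight
  and \<open>N_derivative\<close>. What remains are quotients of Wronskians by their absolute
  values, which are constant because a nonvanishing continuous Wronskian keeps its sign.\<close>

lemma M_eq: "k < n \<Longrightarrow> AC_on S (n - 1) u \<Longrightarrow> x \<in> S \<Longrightarrow> M k u x = \<sigma> k * N k u x"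
proof (induction k arbitrary: x)
  case 0
  have "N 0 u x = u x / \<phi> 1 x" by (simp add: N_def wcoeff_top W_0 W_1)
  moreover have "u x / \<bar>\<phi> 1 x\<bar> = sg 1 * (u x / \<phi> 1 x)"
  proof -
    have "\<bar>\<phi> 1 x\<bar> = sg 1 * \<phi> 1 x" using abs_W[of 1 x] 0 n2 W_1[of x] by simp
    moreover have "sg 1 = 1 \<or> sg 1 = -1" using sg_abs[of 1] n2 by (auto simp: abs_if split: if_splits)
    ultimately show ?thesis by auto
  qed
  ultimately show ?case by (simp add: qw_def)
next
  case (Suc k)
  define num where "num = (\<Sum>j\<le>Suc k. wcoeff S \<phi> (Suc k) j x * hder S j u x)"
  have nd: "(N k u has_real_derivative W k x * num / (W (Suc k) x)\<^sup>2) (at x within S)"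
    unfolding num_def
  proof (rule N_derivative)
    show "hder S j u differentiable (at x within S)" if "j \<le> k" for j
      using Suc.prems that unfolding AC_on_def by auto
  qed (use Suc.prems differentiable_\<phi> in auto)
  have "((\<lambda>x. \<sigma> k * N k u x) has_real_derivative \<sigma> k * (W k x * num / (W (Suc k) x)\<^sup>2)) (at x within S)"
    using nd by (rule DERIV_cmult)
  then have "(M k u has_real_derivative \<sigma> k * (W k x * num / (W (Suc k) x)\<^sup>2)) (at x within S)"
    by (rule has_real_derivative_cong_on) (use Suc in auto)
  then have "M (Suc k) u x = qw S \<phi> n (Suc k) x * (\<sigma> k * (W k x * num / (W (Suc k) x)\<^sup>2))"
    using deriv_within_ivl[OF Suc.prems(3)] by simp
  also have "\<dots> = \<sigma> k * (W k x / \<bar>W k x\<bar>) * (num / \<bar>W (Suc (Suc k)) x\<bar>)"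
    using Suc.prems W_nz[of "Suc k" x] by (simp add: qw_def abs_mult)
  also have "W k x / \<bar>W k x\<bar> = sg k"
    using sgn_W[of k x] Suc.prems by (simp add: real_sgn_eq)
  also have "num / \<bar>W (Suc (Suc k)) x\<bar> = sg (Suc (Suc k)) * (num / W (Suc (Suc k)) x)"
  proof -
    have "\<bar>W (Suc (Suc k)) x\<bar> = sg (Suc (Suc k)) * W (Suc (Suc k)) x"
      using abs_W[of "Suc (Suc k)" x] Suc.prems by simp
    moreover have "sg (Suc (Suc k)) = 1 \<or> sg (Suc (Suc k)) = -1"
      using sg_abs[of "Suc (Suc k)"] Suc.prems by (auto simp: abs_if split: if_splits)
    ultimately show ?thesis by auto
  qed
  finally show ?case by (simp add: N_def num_def)
qed

lemma M_derivative:
  assumes "Suc k < n" "AC_on S (n - 1) u" "x \<in> S"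
  shows "(M k u has_real_derivative M (Suc k) u x / qw S \<phi> n (Suc k) x) (at x within S)"
proof -
  have "(N k u has_real_derivative W k x * (\<Sum>j\<le>Suc k. wcoeff S \<phi> (Suc k) j x * hder S j u x)
       / (W (Suc k) x)\<^sup>2) (at x within S)"
  proof (rule N_derivative)
    show "hder S j u differentiable (at x within S)" if "j \<le> k" for j
      using assms that unfolding AC_on_def by auto
  qed (use assms differentiable_\<phi> in auto)
  from has_real_derivative_cong_on[OF DERIV_cmult[OF this, of "\<sigma> k"] assms(3), of "M k u"]
  obtain D where D: "(M k u has_real_derivative D) (at x within S)"
    using M_eq[OF _ assms(2)] assms(1) by auto
  then show ?thesis
    using deriv_within_ivl[OF assms(3) D] qw_pos[of "Suc k" x] assms by simp
qed

lemma M_basis_zero: "1 \<le> i \<Longrightarrow> i \<le> k \<Longrightarrow> k < n \<Longrightarrow> x \<in> S \<Longrightarrow> M k (\<phi> i) x = 0"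
  using M_eq[OF _ AC] N_basis by simp

lemma M_basis_one: "k < n \<Longrightarrow> x \<in> S \<Longrightarrow> M k (\<phi> (Suc k)) x = \<sigma> k"
  using M_eq[OF _ AC] N_basis by simp

lemma AC_on_combination:
  assumes "finite A" "A \<subseteq> {1..n}" and f: "AC_on S (n - 1) f"
  shows "AC_on S (n - 1) (\<lambda>x. f x - (\<Sum>i\<in>A. a i * \<phi> i x))"
    and "k < n \<Longrightarrow> x \<in> S \<Longrightarrow> M k (\<lambda>x. f x - (\<Sum>i\<in>A. a i * \<phi> i x)) x = M k f x - (\<Sum>i\<in>A. a i * M k (\<phi> i) x)"
proof -
  let ?g = "\<lambda>x. \<Sum>i\<in>A. a i * \<phi> i x"
  have ACA: "AC_on S (n - 1) (\<phi> i)" if "i \<in> A" for i using AC[of i] that assms(2) by auto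
  note s = AC_on_sum[where A = A and \<psi> = \<phi> and c = a, OF assms(1) ACA]
  then have g: "AC_on S (n - 1) ?g" by blast
  have eq: "(\<lambda>x. f x - ?g x) = (\<lambda>x. f x + (-1) * ?g x)" by simp
  show 1: "AC_on S (n - 1) (\<lambda>x. f x - ?g x)"
    unfolding eq by (rule AC_on_lincomb(1)[OF f g])
  assume k: "k < n" and x: "x \<in> S"
  have h: "hder S j (\<lambda>x. f x - ?g x) x = hder S j f x - (\<Sum>i\<in>A. a i * hder S j (\<phi> i) x)" if "j \<le> k" for j
    unfolding eq using AC_on_lincomb(2)[OF f g _ x, of j "-1"] s that k x by auto
  have "N k (\<lambda>x. f x - ?g x) x = N k f x - (\<Sum>i\<in>A. a i * N k (\<phi> i) x)"
  proof -
    have "(\<Sum>j\<le>k. wcoeff S \<phi> k j x * hder S j (\<lambda>x. f x - ?g x) x)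
      = (\<Sum>j\<le>k. wcoeff S \<phi> k j x * hder S j f x) - (\<Sum>j\<le>k. \<Sum>i\<in>A. a i * (wcoeff S \<phi> k j x * hder S j (\<phi> i) x))"
      by (simp add: h sum_subtractf right_diff_distrib sum_distrib_left mult.left_commute)
    also have "(\<Sum>j\<le>k. \<Sum>i\<in>A. a i * (wcoeff S \<phi> k j x * hder S j (\<phi> i) x))
       = (\<Sum>i\<in>A. a i * (\<Sum>j\<le>k. wcoeff S \<phi> k j x * hder S j (\<phi> i) x))"
      by (subst sum.swap) (simp add: sum_distrib_left)
    finally show ?thesis unfolding N_def by (simp add: diff_divide_distrib sum_divide_distrib[where A = A])
  qed
  then show "M k (\<lambda>x. f x - ?g x) x = M k f x - (\<Sum>i\<in>A. a i * M k (\<phi> i) x)"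
    using M_eq[OF k 1 x] M_eq[OF k f x] M_eq[OF k ACA x]
    by (simp add: right_diff_distrib sum_distrib_left mult.left_commute)
qed

lemma M_sum:
  assumes "A \<subseteq> {1..n}" "k < n" "x \<in> S"
  shows "AC_on S (n - 1) (\<lambda>x. \<Sum>i\<in>A. a i * \<phi> i x)"
    and "M k (\<lambda>x. \<Sum>i\<in>A. a i * \<phi> i x) x = (\<Sum>i\<in>A. a i * M k (\<phi> i) x)"
proof -
  have fin: "finite A" using assms(1) finite_subset by blast
  have z: "AC_on S (n - 1) (\<lambda>x. 0)" by (rule AC_on_zero)
  have M0: "M k (\<lambda>x. 0) x = 0"
    using M_eq[OF assms(2) z assms(3)] AC_on_zero(2)[OF assms(3)] by (simp add: N_def)
  have eq: "(\<lambda>x. \<Sum>i\<in>A. a i * \<phi> i x) = (\<lambda>x. 0 - (\<Sum>i\<in>A. (- a i) * \<phi> i x))"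
    by (simp add: sum_negf)
  show "AC_on S (n - 1) (\<lambda>x. \<Sum>i\<in>A. a i * \<phi> i x)"
    unfolding eq by (rule AC_on_combination(1)[OF fin assms(1) z])
  show "M k (\<lambda>x. \<Sum>i\<in>A. a i * \<phi> i x) x = (\<Sum>i\<in>A. a i * M k (\<phi> i) x)"
    unfolding eq using AC_on_combination(2)[OF fin assms(1) z assms(2,3), of "\<lambda>i. - a i"] M0
    by (simp add: sum_negf)
qed

text \<open>The right-hand side is free of x: the chain of every combination ends in a constant. The
  eventual signs, the count of sign changes and the kernel identity all start from this
  constant.\<close>

lemma M_last_sum:
  assumes A: "A \<subseteq> {1..n}" and x: "x \<in> S"
  shows "M (n - 1) (\<lambda>x. \<Sum>i\<in>A. a i * \<phi> i x) x = (\<Sum>i\<in>A. a i * (if i = n then \<sigma> (n - 1) else 0))"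
proof -
  have "M (n - 1) (\<lambda>x. \<Sum>i\<in>A. a i * \<phi> i x) x = (\<Sum>i\<in>A. a i * M (n - 1) (\<phi> i) x)"
    using M_sum(2)[OF A _ x] n2 by simp
  also have "\<dots> = (\<Sum>i\<in>A. a i * (if i = n then \<sigma> (n - 1) else 0))"
  proof (rule sum.cong)
    fix i assume "i \<in> A"
    then have i: "1 \<le> i" "i \<le> n" using A by auto
    show "a i * M (n - 1) (\<phi> i) x = a i * (if i = n then \<sigma> (n - 1) else 0)"
      using M_basis_zero[OF i(1), of "n - 1" x] M_basis_one[of "n - 1" x] i n2 x by auto
  qed simp
  finally show ?thesis .
qed

lemma hder_sum:
  assumes "A \<subseteq> {1..n}" "j < n" "x \<in> S"
  shows "hder S j (\<lambda>x. \<Sum>i\<in>A. a i * \<phi> i x) x = (\<Sum>i\<in>A. a i * hder S j (\<phi> i) x)"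
proof -
  have "finite A" "\<And>i. i \<in> A \<Longrightarrow> AC_on S (n - 1) (\<phi> i)"
    using assms(1) finite_subset AC by auto
  from AC_on_sum[OF this, where c = a] show ?thesis using assms by auto
qed

lemma M_zero_of_jet:
  assumes "k < n" "AC_on S (n - 1) u" "x \<in> S" "\<And>j. j \<le> k \<Longrightarrow> hder S j u x = 0"
  shows "M k u x = 0"
  using M_eq[OF assms(1-3)] assms(4) by (simp add: N_def)

text \<open>This jet picks out the top coefficient \<open>W (n - 1)\<close> of the numerator of
  \<open>N (n - 1)\<close>.\<close>

lemma M_last_of_jet:
  assumes "AC_on S (n - 1) u" "x \<in> S" "\<And>j. j < n - 1 \<Longrightarrow> hder S j u x = 0" "hder S (n - 1) u x = 1"
  shows "\<bar>M (n - 1) u x\<bar> = 1 / qw S \<phi> n n x"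
proof -
  have n: "Suc (n - 1) = n" using n2 by simp
  have "(\<Sum>j\<le>n-1. wcoeff S \<phi> (n - 1) j x * hder S j u x) = (\<Sum>j\<in>{n-1}. wcoeff S \<phi> (n - 1) j x * hder S j u x)"
    using assms(3) by (intro sum.mono_neutral_right) auto
  then have "N (n - 1) u x = W (n - 1) x / W n x" using assms(4) by (simp add: N_def n wcoeff_top del: One_nat_def)
  then show ?thesis
    using M_eq[OF _ assms(1,2), of "n - 1"] n2 \<sigma>_abs[of "n - 1"] by (simp add: abs_mult qw_def)
qed

lemma Lop_eq: "Lop S \<phi> n u x = (\<Sum>j\<le>n. wcoeff S \<phi> n j x * hder S j u x) / W n x"
  by (simp add: Lop_def wronskian_snoc del: upt_Suc One_nat_def)

lemma M_last_locally_abs_cont: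
  assumes f: "AC_on S (n - 1) f"
  shows "locally_abs_cont_on S (M (n - 1) f)"
proof -
  have n: "Suc (n - 1) = n" using n2 by simp
  have c: "locally_abs_cont_on S (wcoeff S \<phi> (n - 1) j)" for j
    by (rule wcoeff_closed[where Q = "locally_abs_cont_on S"])
      (auto intro: locally_abs_cont_on_const locally_abs_cont_on_add locally_abs_cont_on_mult
          hder_locally_abs_cont[OF AC])
  have w: "locally_abs_cont_on S (W n)"
    by (rule Wf_closed[where Q = "locally_abs_cont_on S"])
      (auto intro: locally_abs_cont_on_const locally_abs_cont_on_add locally_abs_cont_on_mult
          hder_locally_abs_cont[OF AC])
  have "locally_abs_cont_on S (\<lambda>x. \<sigma> (n - 1) * ((\<Sum>j\<le>n-1. wcoeff S \<phi> (n - 1) j x * hder S j f x) * inverse (W n x)))"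
    using c w W_nz hder_locally_abs_cont[OF f]
    by (intro locally_abs_cont_on_mult locally_abs_cont_on_const locally_abs_cont_on_sum locally_abs_cont_on_inverse) auto
  then show ?thesis
    unfolding locally_abs_cont_on_def
  proof (intro allI impI)
    fix a b assume *: "\<forall>a b. a \<le> b \<and> {a..b} \<subseteq> S \<longrightarrow> abs_cont_on a b
       (\<lambda>x. \<sigma> (n - 1) * ((\<Sum>j\<le>n-1. wcoeff S \<phi> (n - 1) j x * hder S j f x) * inverse (W n x)))"
      and ab: "a \<le> b \<and> {a..b} \<subseteq> S"
    show "abs_cont_on a b (M (n - 1) f)"
    proof (rule abs_cont_on_cong[OF _ *[rule_format, OF ab]])
      fix x assume "x \<in> {a..b}"
      then have "x \<in> S" using ab by auto
      then show "\<sigma> (n - 1) * ((\<Sum>j\<le>n-1. wcoeff S \<phi> (n - 1) j x * hder S j f x) * inverse (W n x)) = M (n - 1) f x"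
        using M_eq[OF _ f, of "n - 1" x] n2 by (simp add: N_def n divide_inverse del: One_nat_def)
    qed
  qed
qed

text \<open>At \<open>k = n - 1\<close> the formula for the derivative of \<open>N\<close> needs the
  derivatives of order \<open>n - 1\<close> of f and of all \<open>\<phi> i\<close> to be
  differentiable, which holds off a null set; there its sum over jets is \<open>W n\<close> times
  \<open>Lop\<close>.\<close>

lemma M_last_derivative_ae:
  assumes f: "AC_on S (n - 1) f"
  shows "AE x in lborel. x \<in> S \<longrightarrow> (\<exists>D. (M (n - 1) f has_real_derivative D) (at x within S) \<and>
      \<bar>D\<bar> = \<bar>Lop S \<phi> n f x\<bar> / qw S \<phi> n n x)"
proof -
  have n: "Suc (n - 1) = n" using n2 by simp
  have diff: "AE x in lborel. x \<in> S \<longrightarrow> hder S j u differentiable (at x within S)"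
    if u: "AC_on S (n - 1) u" and j: "j \<le> n - 1" for u j
  proof (rule locally_abs_cont_on_derivative[OF hder_locally_abs_cont[OF u j]])
    fix h assume "AE x in lborel. x \<in> S \<longrightarrow> (hder S j u has_real_derivative h x) (at x)"
    then show ?thesis
      by eventually_elim (auto simp: real_differentiable_def intro: has_field_derivative_at_within)
  qed
  have "AE x in lborel. \<forall>i\<in>{1..n}. \<forall>j\<in>{..n-1}. x \<in> S \<longrightarrow> hder S j (\<phi> i) differentiable (at x within S)"
    by (intro AE_finite_allI diff AC) auto
  moreover have "AE x in lborel. \<forall>j\<in>{..n-1}. x \<in> S \<longrightarrow> hder S j f differentiable (at x within S)"
    by (intro AE_finite_allI diff f) auto
  ultimately show ?thesis
  proof eventually_elim
    case (elim x)
    show ?case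
    proof
      assume x: "x \<in> S"
      have "(N (n - 1) f has_real_derivative W (n - 1) x * (\<Sum>j\<le>Suc (n - 1). wcoeff S \<phi> (Suc (n - 1)) j x * hder S j f x)
         / (W (Suc (n - 1)) x)\<^sup>2) (at x within S)"
        by (rule N_derivative) (use elim x n2 in auto)
      then have "(N (n - 1) f has_real_derivative W (n - 1) x * (Lop S \<phi> n f x * W n x) / (W n x)\<^sup>2) (at x within S)"
        using W_nz[OF order_refl x] unfolding n Lop_eq by simp
      from has_real_derivative_cong_on[OF DERIV_cmult[OF this, of "\<sigma> (n - 1)"] x, of "M (n - 1) f"]
      have d: "(M (n - 1) f has_real_derivative \<sigma> (n - 1) * (W (n - 1) x * (Lop S \<phi> n f x * W n x) / (W n x)\<^sup>2)) (at x within S)"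
        using M_eq[OF _ f] n2 by auto
      moreover have "\<bar>\<sigma> (n - 1) * (W (n - 1) x * (Lop S \<phi> n f x * W n x) / (W n x)\<^sup>2)\<bar> = \<bar>Lop S \<phi> n f x\<bar> / qw S \<phi> n n x"
        using \<sigma>_abs[of "n - 1"] n2 W_nz[OF order_refl x]
        by (simp add: abs_mult qw_def power2_eq_square abs_divide)
      ultimately show "\<exists>D. (M (n - 1) f has_real_derivative D) (at x within S) \<and>
        \<bar>D\<bar> = \<bar>Lop S \<phi> n f x\<bar> / qw S \<phi> n n x" by blast
    qed
  qed
qed

end

subsection \<open>Behaviour of the scale at the end point\<close>

lemma eventually_at_end:
  assumes "ereal T < x0"
  shows "eventually P (at_end x0) \<longleftrightarrow> (\<exists>b\<in>ivl T x0. \<forall>x\<in>ivl T x0. b < x \<longrightarrow> P x)"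
proof (cases x0)
  case (real r)
  then have Tr: "T < r" using assms by simp
  have "eventually P (at_end x0) \<longleftrightarrow> (\<exists>b<r. \<forall>y>b. y < r \<longrightarrow> P y)"
    using real by (simp add: at_end_def eventually_at_left[OF Tr])
  also have "\<dots> \<longleftrightarrow> (\<exists>b\<in>ivl T x0. \<forall>x\<in>ivl T x0. b < x \<longrightarrow> P x)"
  proof
    assume "\<exists>b<r. \<forall>y>b. y < r \<longrightarrow> P y"
    then obtain b where "b < r" "\<forall>y>b. y < r \<longrightarrow> P y" by blast
    then show "\<exists>b\<in>ivl T x0. \<forall>x\<in>ivl T x0. b < x \<longrightarrow> P x"
      using Tr real by (intro bexI[of _ "max b T"]) (auto simp: mem_ivl)
  next
    assume "\<exists>b\<in>ivl T x0. \<forall>x\<in>ivl T x0. b < x \<longrightarrow> P x"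
    then obtain b where b: "b \<in> ivl T x0" "\<forall>x\<in>ivl T x0. b < x \<longrightarrow> P x" by blast
    then show "\<exists>b<r. \<forall>y>b. y < r \<longrightarrow> P y"
      using real by (intro exI[of _ b]) (auto simp: mem_ivl)
  qed
  finally show ?thesis .
next
  case PInf
  have "eventually P (at_end x0) \<longleftrightarrow> (\<exists>b. \<forall>y>b. P y)"
    using PInf by (simp add: at_end_def eventually_at_top_dense)
  also have "\<dots> \<longleftrightarrow> (\<exists>b\<in>ivl T x0. \<forall>x\<in>ivl T x0. b < x \<longrightarrow> P x)"
  proof
    assume "\<exists>b. \<forall>y>b. P y"
    then obtain b where "\<forall>y>b. P y" by blast
    then show "\<exists>b\<in>ivl T x0. \<forall>x\<in>ivl T x0. b < x \<longrightarrow> P x"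
      using PInf by (intro bexI[of _ "max b T"]) (auto simp: mem_ivl max_def)
  next
    assume "\<exists>b\<in>ivl T x0. \<forall>x\<in>ivl T x0. b < x \<longrightarrow> P x"
    then obtain b where b: "b \<in> ivl T x0" "\<forall>x\<in>ivl T x0. b < x \<longrightarrow> P x" by blast
    then show "\<exists>b. \<forall>y>b. P y" using PInf by (intro exI[of _ b]) (auto simp: mem_ivl)
  qed
  finally show ?thesis .
next
  case MInf
  then show ?thesis using assms by simp
qed

lemma at_end_neq_bot: "ereal T < x0 \<Longrightarrow> at_end x0 \<noteq> bot"
  using eventually_at_end[of T x0 "\<lambda>x. False"] ivl_greater[of _ T x0]
  by (auto simp: trivial_limit_def)

lemma mean_value_ivl:
  assumes "x \<in> ivl T x0" "y \<in> ivl T x0" "x < y"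
    and der: "\<And>z. z \<in> ivl T x0 \<Longrightarrow> (v has_real_derivative d z) (at z within ivl T x0)"
  obtains z where "x < z" "z < y" "z \<in> ivl T x0" "v y - v x = (y - x) * d z"
proof -
  have sub: "{x..y} \<subseteq> ivl T x0" by (rule ivl_subset[OF assms(1,2)])
  have "\<exists>z\<in>{x<..<y}. v y - v x = (\<lambda>h. d z * h) (y - x)"
  proof (rule mvt_simple[OF assms(3)])
    fix z assume "x \<le> z" "z \<le> y"
    then have "z \<in> ivl T x0" using sub by auto
    then show "(v has_derivative (\<lambda>h. d z * h)) (at z within {x..y})"
      using DERIV_subset[OF der sub] by (simp add: has_field_derivative_def)
  qed
  then obtain z where z: "z \<in> {x<..<y}" "v y - v x = d z * (y - x)" by auto
  moreover have "z \<in> ivl T x0" using z(1) sub by auto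
  ultimately show ?thesis using that by (auto simp: mult.commute)
qed

section \<open>Eventual signs and quotients of derivatives\<close>

context wronskian_system begin

abbreviation F :: "real filter" where "F \<equiv> at_end x0"

lemmas eventually_F = eventually_at_end[OF T_less]
lemmas F_nontrivial = at_end_neq_bot[OF T_less]

lemma eventually_S: "eventually (\<lambda>x. x \<in> S) F" using T_in eventually_F by blast

lemma eventually_greater: "b \<in> S \<Longrightarrow> eventually (\<lambda>x. x \<in> S \<and> b < x) F"
  unfolding eventually_F by blast

lemma eventually_upto:
  assumes "eventually P F" obtains b where "b \<in> S" "\<And>x. x \<in> S \<Longrightarrow> b < x \<Longrightarrow> P x"
  using assms unfolding eventually_F by blast

text \<open>Excludes oscillation: applied to \<open>\<beta> - c * \<alpha>\<close> with \<alpha> of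
  fixed sign, it says that \<open>\<beta> / \<alpha>\<close> is eventually above c, below c or equal
  to c.\<close>

definition eventual_sign :: "(real \<Rightarrow> real) \<Rightarrow> bool" where
  "eventual_sign g \<longleftrightarrow> eventually (\<lambda>x. 0 < g x) F \<or> eventually (\<lambda>x. g x < 0) F \<or> eventually (\<lambda>x. g x = 0) F"

lemma eventual_sign_minus: "eventual_sign (\<lambda>x. - g x) \<longleftrightarrow> eventual_sign g"
  unfolding eventual_sign_def by auto

lemma eventual_sign_const: "eventual_sign (\<lambda>x. c)"
  unfolding eventual_sign_def by (cases c "0::real" rule: linorder_cases) auto

lemma eventual_sign_eventually_cong:
  assumes g: "eventual_sign g" and eq: "eventually (\<lambda>x. g x = h x) F" shows "eventual_sign h"
proof -
  have tr: "eventually (\<lambda>x. P (h x)) F" if "eventually (\<lambda>x. P (g x)) F" for P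
    using that eq by eventually_elim simp
  show ?thesis
    using g tr[of "\<lambda>y. 0 < y"] tr[of "\<lambda>y. y < 0"] tr[of "\<lambda>y. y = 0"]
    unfolding eventual_sign_def by blast
qed

lemma eventual_sign_cong:
  assumes "eventual_sign g" "\<And>x. x \<in> S \<Longrightarrow> g x = h x" shows "eventual_sign h"
proof (rule eventual_sign_eventually_cong[OF assms(1)])
  show "eventually (\<lambda>x. g x = h x) F" using eventually_S by eventually_elim (rule assms(2))
qed

text \<open>Near the end point v is strictly monotone or constant. A strictly increasing v either
  reaches 0 and is positive afterwards or stays negative.\<close>

lemma eventual_sign_integrate:
  assumes der: "\<And>x. x \<in> S \<Longrightarrow> (v has_real_derivative w x / q x) (at x within S)"
    and q: "\<And>x. x \<in> S \<Longrightarrow> 0 < q x" and w: "eventual_sign w"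
  shows "eventual_sign v"
proof -
  have pos: "eventual_sign v"
    if der: "\<And>x. x \<in> S \<Longrightarrow> (v has_real_derivative w x / q x) (at x within S)"
      and w: "eventually (\<lambda>x. 0 < w x) F" for v w
  proof -
    obtain b where b: "b \<in> S" "\<And>x. x \<in> S \<Longrightarrow> b < x \<Longrightarrow> 0 < w x" using eventually_upto[OF w] by metis
    have mono: "v x < v y" if xy: "x \<in> S" "y \<in> S" "b < x" "x < y" for x y
    proof -
      obtain z where z: "x < z" "z < y" "z \<in> S" "v y - v x = (y - x) * (w z / q z)"
        by (rule mean_value_ivl[OF xy(1,2,4) der])
      then have "0 < (y - x) * (w z / q z)" using b(2)[of z] q[of z] xy by simp
      then show ?thesis using z(4) by simp
    qed
    show ?thesis
    proof (cases "\<exists>c\<in>S. b < c \<and> 0 \<le> v c")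
      case True
      then obtain c where c: "c \<in> S" "b < c" "0 \<le> v c" by blast
      have "eventually (\<lambda>x. 0 < v x) F"
        using eventually_greater[OF c(1)] by eventually_elim (use mono[of c] c in force)
      then show ?thesis by (simp add: eventual_sign_def)
    next
      case False
      have "eventually (\<lambda>x. v x < 0) F"
        using eventually_greater[OF b(1)] by eventually_elim (use False in force)
      then show ?thesis by (simp add: eventual_sign_def)
    qed
  qed
  consider "eventually (\<lambda>x. 0 < w x) F" | "eventually (\<lambda>x. w x < 0) F" | "eventually (\<lambda>x. w x = 0) F"
    using w unfolding eventual_sign_def by blast
  then show ?thesis
  proof cases
    case 1
    then show ?thesis using pos[OF der] by blast
  next
    case 2
    have "eventual_sign (\<lambda>x. - v x)"
    proof (rule pos)
      show "((\<lambda>x. - v x) has_real_derivative - w x / q x) (at x within S)" if "x \<in> S" for x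
        using DERIV_minus[OF der[OF that]] by simp
      show "eventually (\<lambda>x. 0 < - w x) F" using 2 by simp
    qed
    then show ?thesis by (simp add: eventual_sign_minus)
  next
    case 3
    obtain b where b: "b \<in> S" "\<And>x. x \<in> S \<Longrightarrow> b < x \<Longrightarrow> w x = 0" using eventually_upto[OF 3] by metis
    obtain c where c: "c \<in> S" "b < c" using ivl_greater[OF b(1)] by blast
    have eq: "v x = v c" if x: "x \<in> S" "c < x" for x
    proof -
      obtain z where z: "c < z" "z < x" "z \<in> S" "v x - v c = (x - c) * (w z / q z)"
        by (rule mean_value_ivl[OF c(1) x der])
      then show ?thesis using b(2)[of z] c(2) by simp
    qed
    show ?thesis
    proof (rule eventual_sign_eventually_cong[OF eventual_sign_const[of "v c"]])
      show "eventually (\<lambda>x. v c = v x) F"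
        using eventually_greater[OF c(1)] by eventually_elim (use eq in metis)
    qed
  qed
qed

lemma eventual_sign_M:
  assumes u: "AC_on S (n - 1) u" and const: "\<And>x. x \<in> S \<Longrightarrow> M (n - 1) u x = C" and "k < n"
  shows "eventual_sign (M k u)"
proof -
  have "k \<le> n - 1" using \<open>k < n\<close> by simp
  then show ?thesis
  proof (induction k rule: inc_induct)
    case base
    show ?case by (rule eventual_sign_cong[OF eventual_sign_const[of C]]) (use const in auto)
  next
    case (step k)
    show ?case
      by (rule eventual_sign_integrate[OF M_derivative[OF _ u] qw_pos step.IH]) (use step in auto)
  qed
qed

lemma eventual_sign_M_sum:
  assumes "A \<subseteq> {1..n}" "k < n"
  shows "eventual_sign (M k (\<lambda>x. \<Sum>i\<in>A. a i * \<phi> i x))"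
  by (rule eventual_sign_M[OF M_sum(1)[OF assms T_in] M_last_sum[OF assms(1)] assms(2)])

lemma eventually_zero_M_Suc:
  assumes "Suc k < n" and u: "AC_on S (n - 1) u" and z: "eventually (\<lambda>x. M k u x = 0) F"
  shows "eventually (\<lambda>x. M (Suc k) u x = 0) F"
proof -
  obtain b where b: "b \<in> S" "\<And>x. x \<in> S \<Longrightarrow> b < x \<Longrightarrow> M k u x = 0" using eventually_upto[OF z] by metis
  show ?thesis using eventually_greater[OF b(1)]
  proof eventually_elim
    case (elim x)
    then have x: "x \<in> S" "b < x" by auto
    have "((\<lambda>x. 0) has_real_derivative M (Suc k) u x / qw S \<phi> n (Suc k) x) (at x within S)"
    proof (rule has_field_derivative_transform_within[OF M_derivative[OF assms(1) u x(1)]])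
      show "M k u y = 0" if "y \<in> S" "dist y x < x - b" for y
        using b(2)[OF that(1)] that(2) by (auto simp: dist_real_def)
    qed (use x in auto)
    then have "M (Suc k) u x / qw S \<phi> n (Suc k) x = 0"
      using derivative_unique_ivl[OF x(1)] DERIV_const by blast
    then show ?case using qw_pos[of "Suc k" x] assms(1) x by simp
  qed
qed

lemma eventually_zero_M:
  assumes u: "AC_on S (n - 1) u" and z: "eventually (\<lambda>x. M k u x = 0) F" and "k \<le> l" "l < n"
  shows "eventually (\<lambda>x. M l u x = 0) F"
  using assms(3,4) by (induction rule: dec_induct) (use z eventually_zero_M_Suc[OF _ u] in auto)

text \<open>If \<open>M k (\<phi> j)\<close> vanished near the end point, so would
  \<open>M (j - 1) (\<phi> j)\<close>, which is the nonzero constant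
  \<open>\<sigma> (j - 1)\<close>.\<close>

lemma eventually_nonzero_M_basis:
  assumes "k < j" "j \<le> n"
  shows "eventually (\<lambda>x. 0 < M k (\<phi> j) x) F \<or> eventually (\<lambda>x. M k (\<phi> j) x < 0) F"
proof -
  have eq: "\<phi> j = (\<lambda>x. \<Sum>i\<in>{j}. 1 * \<phi> i x)" by simp
  have "eventual_sign (M k (\<phi> j))"
    by (subst eq, rule eventual_sign_M_sum) (use assms in auto)
  moreover have "\<not> eventually (\<lambda>x. M k (\<phi> j) x = 0) F"
  proof
    assume "eventually (\<lambda>x. M k (\<phi> j) x = 0) F"
    then have "eventually (\<lambda>x. M (j - 1) (\<phi> j) x = 0) F"
      using eventually_zero_M[OF AC, of j k "j - 1"] assms by auto
    with eventually_S have "eventually (\<lambda>x. False) F"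
    proof eventually_elim
      case (elim x)
      obtain j' where "j = Suc j'" using assms(1) by (cases j) auto
      then show ?case using elim M_basis_one[of j' x] \<sigma>_nz[of j'] assms by simp
    qed
    then show False using F_nontrivial by (simp add: trivial_limit_def)
  qed
  ultimately show ?thesis unfolding eventual_sign_def by blast
qed

lemma eventually_nonzero_M_basis':
  "k < j \<Longrightarrow> j \<le> n \<Longrightarrow> eventually (\<lambda>x. M k (\<phi> j) x \<noteq> 0) F"
  using eventually_nonzero_M_basis[of k j] by (auto elim: eventually_mono)

lemma nonpos_of_increasing_to_zero:
  assumes der: "\<And>x. x \<in> S \<Longrightarrow> (v has_real_derivative d x) (at x within S)"
    and lim: "(v \<longlongrightarrow> 0) F" and b: "b \<in> S" and x: "x \<in> S" "b < x"
    and d: "\<And>x. x \<in> S \<Longrightarrow> b < x \<Longrightarrow> 0 \<le> d x"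
  shows "v x \<le> 0" and "(\<And>x. x \<in> S \<Longrightarrow> b < x \<Longrightarrow> 0 < d x) \<Longrightarrow> v x < 0"
proof -
  have mono: "v x \<le> v y" if xy: "x \<in> S" "y \<in> S" "b < x" "x < y" for x y
  proof -
    obtain z where z: "x < z" "z < y" "z \<in> S" "v y - v x = (y - x) * d z"
      by (rule mean_value_ivl[OF xy(1,2,4) der])
    then have "0 \<le> (y - x) * d z" using d[of z] xy by simp
    then show ?thesis using z(4) by simp
  qed
  have le: "v x \<le> 0" if "x \<in> S" "b < x" for x
  proof (rule tendsto_lowerbound[OF lim _ F_nontrivial])
    show "eventually (\<lambda>y. v x \<le> v y) F"
      using eventually_greater[OF that(1)] by eventually_elim (use mono that in blast)
  qed
  show "v x \<le> 0" by (rule le[OF x])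
  assume d': "\<And>x. x \<in> S \<Longrightarrow> b < x \<Longrightarrow> 0 < d x"
  obtain y where y: "y \<in> S" "x < y" using ivl_greater[OF x(1)] by blast
  obtain z where z: "x < z" "z < y" "z \<in> S" "v y - v x = (y - x) * d z"
    by (rule mean_value_ivl[OF x(1) y der])
  then have "0 < (y - x) * d z" using d'[of z] y x by simp
  then show "v x < 0" using z(4) le[of y] y x by simp
qed

text \<open>If \<open>\<beta>/\<alpha>\<close> were bounded away from zero near the end point, integrating would give the same for
  \<open>b/a\<close>.\<close>

lemma ratio_contradiction:
  assumes q: "\<And>x. x \<in> S \<Longrightarrow> 0 < q x"
    and da: "\<And>x. x \<in> S \<Longrightarrow> (a has_real_derivative \<alpha> x / q x) (at x within S)"
    and db: "\<And>x. x \<in> S \<Longrightarrow> (b has_real_derivative \<beta> x / q x) (at x within S)"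
    and lim: "(a \<longlongrightarrow> 0) F" "(b \<longlongrightarrow> 0) F" "((\<lambda>x. b x / a x) \<longlongrightarrow> 0) F"
    and c: "0 < c" and pos: "eventually (\<lambda>x. 0 < \<alpha> x) F" and ge: "eventually (\<lambda>x. c * \<alpha> x \<le> \<beta> x) F"
  shows False
proof -
  have "eventually (\<lambda>x. b x / a x < c) F" using order_tendstoD(2)[OF lim(3) c] .
  with pos ge have "eventually (\<lambda>x. 0 < \<alpha> x \<and> c * \<alpha> x \<le> \<beta> x \<and> b x / a x < c) F"
    by eventually_elim auto
  from eventually_upto[OF this] obtain t where t: "t \<in> S"
    "\<And>x. x \<in> S \<Longrightarrow> t < x \<Longrightarrow> 0 < \<alpha> x \<and> c * \<alpha> x \<le> \<beta> x \<and> b x / a x < c"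
    by metis
  obtain x where x: "x \<in> S" "t < x" using ivl_greater[OF t(1)] by blast
  have a: "a x < 0"
    by (rule nonpos_of_increasing_to_zero(2)[OF da lim(1) t(1) x]) (use t(2) q in \<open>auto intro: less_imp_le\<close>)
  have "b x - c * a x \<le> 0"
  proof (rule nonpos_of_increasing_to_zero(1)[where d = "\<lambda>x. \<beta> x / q x - c * (\<alpha> x / q x)", OF _ _ t(1) x])
    show "((\<lambda>x. b x - c * a x) \<longlongrightarrow> 0) F" using tendsto_diff[OF lim(2) tendsto_mult_left[OF lim(1), of c]] by simp
    show "0 \<le> \<beta> x / q x - c * (\<alpha> x / q x)" if "x \<in> S" "t < x" for x
    proof -
      have "\<beta> x / q x - c * (\<alpha> x / q x) = (\<beta> x - c * \<alpha> x) / q x" by (simp add: diff_divide_distrib)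
      then show ?thesis using t(2)[OF that] q[OF that(1)] by simp
    qed
  qed (intro DERIV_diff DERIV_cmult da db)
  then have "c \<le> b x / a x" using a by (simp add: field_simps)
  then show False using t(2)[OF x] by simp
qed

text \<open>The converse of L'Hopital's rule. Were \<open>\<beta> / \<alpha>\<close> not eventually
  below a given c > 0, \<open>sign\<close> would keep it at least c near the end point, contrary to
  \<open>ratio_contradiction\<close>; the lower bound follows by changing the sign of b.\<close>

lemma ratio_step:
  assumes q: "\<And>x. x \<in> S \<Longrightarrow> 0 < q x"
    and da: "\<And>x. x \<in> S \<Longrightarrow> (a has_real_derivative \<alpha> x / q x) (at x within S)"
    and db: "\<And>x. x \<in> S \<Longrightarrow> (b has_real_derivative \<beta> x / q x) (at x within S)"
    and lim: "(a \<longlongrightarrow> 0) F" "(b \<longlongrightarrow> 0) F" "((\<lambda>x. b x / a x) \<longlongrightarrow> 0) F"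
    and \<alpha>: "eventually (\<lambda>x. 0 < \<alpha> x) F \<or> eventually (\<lambda>x. \<alpha> x < 0) F"
    and sign: "\<And>c. eventual_sign (\<lambda>x. \<beta> x - c * \<alpha> x)"
  shows "((\<lambda>x. \<beta> x / \<alpha> x) \<longlongrightarrow> 0) F"
proof -
  have main: "((\<lambda>x. \<beta> x / \<alpha> x) \<longlongrightarrow> 0) F"
    if da: "\<And>x. x \<in> S \<Longrightarrow> (a has_real_derivative \<alpha> x / q x) (at x within S)"
    and db: "\<And>x. x \<in> S \<Longrightarrow> (b has_real_derivative \<beta> x / q x) (at x within S)"
    and lim: "(a \<longlongrightarrow> 0) F" "(b \<longlongrightarrow> 0) F" "((\<lambda>x. b x / a x) \<longlongrightarrow> 0) F"
    and \<alpha>: "eventually (\<lambda>x. 0 < \<alpha> x) F"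
    and sign: "\<And>c. eventual_sign (\<lambda>x. \<beta> x - c * \<alpha> x)" for a b \<alpha> \<beta>
  proof -
    have up: "eventually (\<lambda>x. \<beta> x < c * \<alpha> x) F" if "c > 0" for c
    proof (rule ccontr)
      assume n: "\<not> ?thesis"
      have "eventually (\<lambda>x. 0 < \<beta> x - c * \<alpha> x) F \<or> eventually (\<lambda>x. \<beta> x - c * \<alpha> x = 0) F"
        using sign[of c] n unfolding eventual_sign_def by auto
      then have ge: "eventually (\<lambda>x. c * \<alpha> x \<le> \<beta> x) F" by (auto elim: eventually_mono)
      show False by (rule ratio_contradiction[OF q da db lim \<open>c > 0\<close> \<alpha> ge])
    qed
    have lo: "eventually (\<lambda>x. - \<beta> x < c * \<alpha> x) F" if "c > 0" for c
    proof (rule ccontr)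
      assume n: "\<not> ?thesis"
      have "eventually (\<lambda>x. \<beta> x - (- c) * \<alpha> x < 0) F \<or> eventually (\<lambda>x. \<beta> x - (- c) * \<alpha> x = 0) F"
      proof -
        have "\<not> eventually (\<lambda>x. 0 < \<beta> x - (- c) * \<alpha> x) F"
        proof
          assume "eventually (\<lambda>x. 0 < \<beta> x - (- c) * \<alpha> x) F"
          then have "eventually (\<lambda>x. - \<beta> x < c * \<alpha> x) F" by eventually_elim simp
          then show False using n by simp
        qed
        then show ?thesis using sign[of "- c"] unfolding eventual_sign_def by blast
      qed
      then have ge: "eventually (\<lambda>x. c * \<alpha> x \<le> - \<beta> x) F" by (auto elim!: eventually_mono)
      have "((\<lambda>x. - b x / a x) \<longlongrightarrow> 0) F" using tendsto_minus[OF lim(3)] by simp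
      moreover have "((\<lambda>x. - b x) \<longlongrightarrow> 0) F" using tendsto_minus[OF lim(2)] by simp
      moreover have "((\<lambda>x. - b x) has_real_derivative - \<beta> x / q x) (at x within S)" if "x \<in> S" for x
        using DERIV_minus[OF db[OF that]] by simp
      ultimately show False
        using ratio_contradiction[of q a \<alpha> "\<lambda>x. - b x" "\<lambda>x. - \<beta> x", OF q da _ lim(1) _ _ \<open>c > 0\<close> \<alpha> ge] by simp
    qed
    show ?thesis
      unfolding tendsto_iff
    proof (intro allI impI)
      fix e :: real assume "e > 0"
      show "eventually (\<lambda>x. dist (\<beta> x / \<alpha> x) 0 < e) F"
        using up[OF \<open>e > 0\<close>] lo[OF \<open>e > 0\<close>] \<alpha>
        by eventually_elim (auto simp: abs_if field_simps)
    qed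
  qed
  show ?thesis using \<alpha>
  proof
    assume "eventually (\<lambda>x. 0 < \<alpha> x) F"
    then show ?thesis using main[OF da db lim _ sign] by blast
  next
    assume neg: "eventually (\<lambda>x. \<alpha> x < 0) F"
    have "((\<lambda>x. - \<beta> x / - \<alpha> x) \<longlongrightarrow> 0) F"
    proof (rule main[of "\<lambda>x. - a x" "\<lambda>x. - \<alpha> x" "\<lambda>x. - b x" "\<lambda>x. - \<beta> x"])
      show "((\<lambda>x. - a x) has_real_derivative - \<alpha> x / q x) (at x within S)" if "x \<in> S" for x
        using DERIV_minus[OF da[OF that]] by simp
      show "((\<lambda>x. - b x) has_real_derivative - \<beta> x / q x) (at x within S)" if "x \<in> S" for x
        using DERIV_minus[OF db[OF that]] by simp
      show "((\<lambda>x. - a x) \<longlongrightarrow> 0) F" using tendsto_minus[OF lim(1)] by simp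
      show "((\<lambda>x. - b x) \<longlongrightarrow> 0) F" using tendsto_minus[OF lim(2)] by simp
      show "((\<lambda>x. - b x / - a x) \<longlongrightarrow> 0) F" using lim(3) by simp
      show "eventually (\<lambda>x. 0 < - \<alpha> x) F" using neg by simp
      show "eventual_sign (\<lambda>x. - \<beta> x - c * - \<alpha> x)" for c
        using sign[of c] eventual_sign_minus[of "\<lambda>x. \<beta> x - c * \<alpha> x"] by (simp add: algebra_simps)
    qed
    then show ?thesis by simp
  qed
qed

end

locale chebyshev_scale = wronskian_system +
  assumes scale: "\<And>i. 1 \<le> i \<Longrightarrow> i < n \<Longrightarrow> ((\<lambda>x. \<phi> (Suc i) x / \<phi> i x) \<longlongrightarrow> 0) (at_end x0)"
begin

lemma M_limit_of_ratios:
  assumes r: "\<And>j. k < j \<Longrightarrow> j < n \<Longrightarrow> ((\<lambda>x. M k (\<phi> (Suc j)) x / M k (\<phi> j) x) \<longlongrightarrow> 0) F"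
    and "k < j" "j \<le> n"
  shows "(M k (\<phi> j) \<longlongrightarrow> (if j = Suc k then \<sigma> k else 0)) F"
proof -
  have "Suc k \<le> j" using \<open>k < j\<close> by simp
  then show ?thesis using \<open>j \<le> n\<close>
  proof (induction rule: dec_induct)
    case base
    have "eventually (\<lambda>x. \<sigma> k = M k (\<phi> (Suc k)) x) F"
      using eventually_S by eventually_elim (use M_basis_one base in auto)
    from tendsto_cong[OF this, THEN iffD1, OF tendsto_const] show ?case by simp
  next
    case (step j)
    then have l: "((\<lambda>x. M k (\<phi> (Suc j)) x / M k (\<phi> j) x * M k (\<phi> j) x) \<longlongrightarrow> 0) F"
      using tendsto_mult[OF r[of j] step.IH] by simp
    have "eventually (\<lambda>x. M k (\<phi> (Suc j)) x / M k (\<phi> j) x * M k (\<phi> j) x = M k (\<phi> (Suc j)) x) F"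
      using eventually_nonzero_M_basis'[of k j] step by (auto elim: eventually_mono)
    then show ?case using l step.hyps tendsto_cong by force
  qed
qed

text \<open>The scale property is passed on to the functions \<open>M k (\<phi> j)\<close> with
  \<open>k < j\<close>. The quotients at level k show that \<open>M k (\<phi> j)\<close> tends to 0
  for \<open>j > Suc k\<close>, and these zero limits are what \<open>ratio_step\<close> needs to
  reach the next level.\<close>

lemma M_ratio:
  assumes "k < n" "k < j" "j < n"
  shows "((\<lambda>x. M k (\<phi> (Suc j)) x / M k (\<phi> j) x) \<longlongrightarrow> 0) F"
  using assms
proof (induction k arbitrary: j)
  case 0
  have "eventually (\<lambda>x. \<phi> (Suc j) x / \<phi> j x = M 0 (\<phi> (Suc j)) x / M 0 (\<phi> j) x) F"
    using eventually_S by eventually_elim (use qw_pos[of 0] in force)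
  then show ?case using scale[of j] 0 tendsto_cong by force
next
  case (Suc k)
  have r: "((\<lambda>x. M k (\<phi> (Suc j)) x / M k (\<phi> j) x) \<longlongrightarrow> 0) F" if "k < j" "j < n" for j
    using Suc.IH[of j] Suc.prems that by auto
  have lim: "(M k (\<phi> i) \<longlongrightarrow> (if i = Suc k then \<sigma> k else 0)) F" if "k < i" "i \<le> n" for i
    by (rule M_limit_of_ratios[OF r that])
  show ?case
  proof (rule ratio_step[where q = "qw S \<phi> n (Suc k)" and a = "M k (\<phi> j)" and b = "M k (\<phi> (Suc j))"])
    show "eventual_sign (\<lambda>x. M (Suc k) (\<phi> (Suc j)) x - c * M (Suc k) (\<phi> j) x)" for c
    proof (rule eventual_sign_cong)
      show "eventual_sign (M (Suc k) (\<lambda>x. \<Sum>i\<in>{j, Suc j}. (if i = j then - c else 1) * \<phi> i x))"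
        by (rule eventual_sign_M_sum) (use Suc.prems in auto)
      show "M (Suc k) (\<lambda>x. \<Sum>i\<in>{j, Suc j}. (if i = j then - c else 1) * \<phi> i x) x
          = M (Suc k) (\<phi> (Suc j)) x - c * M (Suc k) (\<phi> j) x" if "x \<in> S" for x
        by (subst M_sum(2)) (use Suc.prems that in auto)
    qed
    show "0 < qw S \<phi> n (Suc k) x" if "x \<in> S" for x using qw_pos that Suc.prems by simp
    show "(M k (\<phi> j) has_real_derivative M (Suc k) (\<phi> j) x / qw S \<phi> n (Suc k) x) (at x within S)" if "x \<in> S" for x
      using M_derivative[OF _ AC that] Suc.prems by simp
    show "(M k (\<phi> (Suc j)) has_real_derivative M (Suc k) (\<phi> (Suc j)) x / qw S \<phi> n (Suc k) x) (at x within S)" if "x \<in> S" for x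
      using M_derivative[OF _ AC that] Suc.prems by simp
    show "(M k (\<phi> j) \<longlongrightarrow> 0) F" using lim[of j] Suc.prems by simp
    show "(M k (\<phi> (Suc j)) \<longlongrightarrow> 0) F" using lim[of "Suc j"] Suc.prems by simp
    show "((\<lambda>x. M k (\<phi> (Suc j)) x / M k (\<phi> j) x) \<longlongrightarrow> 0) F" using r[of j] Suc.prems by simp
    show "eventually (\<lambda>x. 0 < M (Suc k) (\<phi> j) x) F \<or> eventually (\<lambda>x. M (Suc k) (\<phi> j) x < 0) F"
      using eventually_nonzero_M_basis[of "Suc k" j] Suc.prems by simp
  qed
qed

lemma M_limit: "k < j \<Longrightarrow> j \<le> n \<Longrightarrow> (M k (\<phi> j) \<longlongrightarrow> (if j = Suc k then \<sigma> k else 0)) F"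
  by (rule M_limit_of_ratios[OF M_ratio]) auto

end

subsection \<open>Non-vanishing of the reversed Wronskians\<close>

text \<open>Sign changes are counted instead of zeros, which avoids multiplicities; s fixes the sign
  at the first of the \<open>m + 1\<close> points.\<close>

definition alternates :: "real set \<Rightarrow> real \<Rightarrow> (real \<Rightarrow> real) \<Rightarrow> nat \<Rightarrow> bool" where
  "alternates S c v m \<longleftrightarrow> (\<exists>X s. (\<forall>j\<le>m. X j \<in> S \<and> c < X j \<and> 0 < s * (-1) ^ j * v (X j)) \<and>
     (\<forall>j<m. X j < X (Suc j)))"

context wronskian_system begin

text \<open>Rolle's theorem: a zero at \<open>c\<close>, or a zero limit at the end point, gains one sign change.\<close>

lemma alternates_derivative:
  assumes der: "\<And>x. x \<in> S \<Longrightarrow> (v has_real_derivative w x / q x) (at x within S)"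
    and q: "\<And>x. x \<in> S \<Longrightarrow> 0 < q x"
    and c: "c \<in> S" and alt: "alternates S c v m"
    and a: "a = 0 \<or> a = 1 \<and> v c = 0" and b: "b = 0 \<or> b = 1 \<and> (v \<longlongrightarrow> 0) F" and ab: "1 \<le> m + a + b"
  shows "alternates S c w (m + a + b - 1)"
proof -
  obtain X s where X: "\<And>j. j \<le> m \<Longrightarrow> X j \<in> S \<and> c < X j \<and> 0 < s * (-1) ^ j * v (X j)"
    "\<And>j. j < m \<Longrightarrow> X j < X (Suc j)"
    using alt unfolding alternates_def by blast
  \<comment> \<open>If v has limit 0, there is a point beyond the last one where v is smaller in
    absolute value; the increment up to it has the sign opposite to that of \<open>v (X m)\<close>
    and counts as one more alternation.\<close>
  have "\<exists>y. y \<in> S \<and> X m < y \<and> (b = 1 \<longrightarrow> \<bar>v y\<bar> < \<bar>v (X m)\<bar>)"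
  proof (cases "b = 1")
    case True
    then have "(v \<longlongrightarrow> 0) F" using b by auto
    moreover have "\<bar>v (X m)\<bar> > 0" using X(1)[of m] by auto
    ultimately have "eventually (\<lambda>y. \<bar>v y\<bar> < \<bar>v (X m)\<bar>) F"
      unfolding tendsto_iff dist_real_def by force
    moreover have "eventually (\<lambda>y. y \<in> S \<and> X m < y) F"
      using eventually_greater[of "X m"] X(1)[of m] by simp
    ultimately have "eventually (\<lambda>y. (y \<in> S \<and> X m < y) \<and> \<bar>v y\<bar> < \<bar>v (X m)\<bar>) F"
      by eventually_elim simp
    then show ?thesis using eventually_happens'[OF F_nontrivial] by blast
  next
    case False
    then show ?thesis using ivl_greater[of "X m"] X(1)[of m] by auto
  qed
  then obtain y where y: "y \<in> S" "X m < y" "b = 1 \<Longrightarrow> \<bar>v y\<bar> < \<bar>v (X m)\<bar>" by blast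
  define Y where "Y j = (if j \<le> m then X j else y)" for j
  have Y: "Y j \<in> S" "c < Y j" if "j \<le> m + b" for j
    using X(1)[of j] X(1)[of m] y that by (auto simp: Y_def)
  have Yd: "Y j < Y (Suc j) \<and> 0 < s * (-1) ^ Suc j * (v (Y (Suc j)) - v (Y j))" if j: "j < m + b" for j
  proof (cases "j < m")
    case True
    have "0 < s * (-1) ^ j * v (X j)" "0 < s * (-1) ^ Suc j * v (X (Suc j))"
      using X(1)[of j] X(1)[of "Suc j"] True by auto
    then show ?thesis using X(2)[OF True] True by (simp add: Y_def algebra_simps)
  next
    case False
    then have jm: "j = m" "b = 1" using j b by auto
    define t where "t = s * (-1) ^ m"
    have t: "0 < t * v (X m)" using X(1)[of m] by (simp add: t_def)
    have "0 < t * (v (X m) - v y)"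
    proof (cases "0 < t")
      case True
      then have "0 < v (X m)" using t by (simp add: zero_less_mult_iff)
      then show ?thesis using True y(3)[OF jm(2)] by (intro mult_pos_pos) auto
    next
      case False
      then have "t < 0" "v (X m) < 0" using t by (auto simp: zero_less_mult_iff)
      then show ?thesis using y(3)[OF jm(2)] by (intro mult_neg_neg) auto
    qed
    then show ?thesis using y(2) jm by (simp add: Y_def t_def algebra_simps)
  qed
  \<comment> \<open>If v vanishes at c, then c is put in front; this shifts the indices by one and
    explains the two cases in the sign r.\<close>
  define Z where "Z j = (if a = 0 then Y j else (case j of 0 \<Rightarrow> c | Suc i \<Rightarrow> Y i))" for j
  have Z: "Z j \<in> S \<and> c \<le> Z j" if "j \<le> m + a + b" for j
    using Y[of j] Y[of "j - 1"] c that a by (auto simp: Z_def less_imp_le split: nat.splits)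
  define r where "r = (if a = 0 then - s else s)"
  have Zd: "Z j < Z (Suc j) \<and> 0 < r * (-1) ^ j * (v (Z (Suc j)) - v (Z j))" if j: "j < m + a + b" for j
  proof (cases "a = 0")
    case True
    then show ?thesis using Yd[of j] j by (simp add: Z_def r_def)
  next
    case False
    then have a1: "a = 1" "v c = 0" using a by auto
    show ?thesis
    proof (cases j)
      case 0
      then show ?thesis using a1 X(1)[of 0] Y(2)[of 0] by (simp add: Z_def r_def Y_def)
    next
      case (Suc i)
      then show ?thesis using Yd[of i] j a1 by (simp add: Z_def r_def)
    qed
  qed
  have "\<exists>z. Z j < z \<and> z < Z (Suc j) \<and> z \<in> S \<and> 0 < r * (-1) ^ j * w z" if j: "j < m + a + b" for j
  proof -
    have lt: "Z j < Z (Suc j)" and pos: "0 < r * (-1) ^ j * (v (Z (Suc j)) - v (Z j))" using Zd[OF j] by auto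
    have Zj: "Z j \<in> S" "Z (Suc j) \<in> S" using Z[of j] Z[of "Suc j"] j by auto
    obtain z where z: "Z j < z" "z < Z (Suc j)" "z \<in> S" "v (Z (Suc j)) - v (Z j) = (Z (Suc j) - Z j) * (w z / q z)"
      by (rule mean_value_ivl[OF Zj lt der])
    have "0 < (r * (-1) ^ j * w z) * ((Z (Suc j) - Z j) / q z)"
      using pos unfolding z(4) by (simp add: field_simps)
    moreover have "0 < (Z (Suc j) - Z j) / q z" using lt q[OF z(3)] by simp
    ultimately have "0 < r * (-1) ^ j * w z" by (rule zero_less_mult_pos2)
    then show ?thesis using z by blast
  qed
  then obtain z where z: "\<And>j. j < m + a + b \<Longrightarrow> Z j < z j \<and> z j < Z (Suc j) \<and> z j \<in> S \<and> 0 < r * (-1) ^ j * w (z j)"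
    by metis
  show ?thesis
    unfolding alternates_def
  proof (intro exI[of _ z] exI[of _ r] conjI allI impI)
    fix j assume "j \<le> m + a + b - 1"
    then have j: "j < m + a + b" using ab by simp
    show "z j \<in> S" "0 < r * (-1) ^ j * w (z j)" using z[OF j] by auto
    show "c < z j" using z[OF j] Z[of j] j by auto
  next
    fix j assume "j < m + a + b - 1"
    then have j: "j < m + a + b" "Suc j < m + a + b" by auto
    have "z j < Z (Suc j)" using z[OF j(1)] by blast
    also have "\<dots> < z (Suc j)" using z[OF j(2)] by blast
    finally show "z j < z (Suc j)" .
  qed
qed

end

text \<open>With k the least index of a nonzero coefficient, \<open>M (k - 1)\<close> of the
  combination tends to \<open>a k * \<sigma> (k - 1)\<close>, which is not 0.\<close>

lemma (in chebyshev_scale) not_eventually_zero_combination: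
  assumes A: "A \<subseteq> {1..n}" and "l \<in> A" "a l \<noteq> 0"
  shows "\<not> eventually (\<lambda>x. M 0 (\<lambda>x. \<Sum>i\<in>A. a i * \<phi> i x) x = 0) F"
proof
  let ?u = "\<lambda>x. \<Sum>i\<in>A. a i * \<phi> i x"
  assume z: "eventually (\<lambda>x. M 0 ?u x = 0) F"
  define k where "k = (LEAST i. i \<in> A \<and> a i \<noteq> 0)"
  have "k \<in> A \<and> a k \<noteq> 0"
    unfolding k_def by (rule LeastI[of _ l]) (use assms in simp)
  then have k: "k \<in> A" "a k \<noteq> 0" by auto
  have kmin: "a i = 0" if "i \<in> A" "i < k" for i
    using not_less_Least[of i "\<lambda>i. i \<in> A \<and> a i \<noteq> 0"] that unfolding k_def by simp
  have fin: "finite A" using A finite_subset by blast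
  obtain k' where k': "k = Suc k'" "k' < n" using k(1) A by (cases k) auto
  have "eventually (\<lambda>x. M k' ?u x = 0) F"
    using eventually_zero_M[OF M_sum(1)[OF A _ T_in] z] k' by auto
  moreover have "eventually (\<lambda>x. M k' ?u x = (\<Sum>i\<in>A. a i * M k' (\<phi> i) x)) F"
    using eventually_S by eventually_elim (use M_sum(2)[OF A k'(2)] in auto)
  ultimately have ev: "eventually (\<lambda>x. (\<Sum>i\<in>A. a i * M k' (\<phi> i) x) = 0) F"
    by eventually_elim simp
  have "((\<lambda>x. \<Sum>i\<in>A. a i * M k' (\<phi> i) x) \<longlongrightarrow> (\<Sum>i\<in>A. a i * (if i = k then \<sigma> k' else 0))) F"
  proof (rule tendsto_sum)
    fix i assume i: "i \<in> A"
    show "((\<lambda>x. a i * M k' (\<phi> i) x) \<longlongrightarrow> a i * (if i = k then \<sigma> k' else 0)) F"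
    proof (cases "i < k")
      case True
      then show ?thesis using kmin[OF i] by simp
    next
      case False
      then show ?thesis using M_limit[of k' i] i A k' by (intro tendsto_mult tendsto_const) auto
    qed
  qed
  from Lim_transform_eventually[OF this ev]
  have "((\<lambda>x. 0) \<longlongrightarrow> (\<Sum>i\<in>A. a i * (if i = k then \<sigma> k' else 0))) F" .
  then have "(\<Sum>i\<in>A. a i * (if i = k then \<sigma> k' else 0)) = 0"
    using tendsto_unique[OF F_nontrivial tendsto_const] by metis
  moreover have "(\<Sum>i\<in>A. a i * (if i = k then \<sigma> k' else 0)) = (\<Sum>i\<in>A. if i = k then a k * \<sigma> k' else 0)"
    by (rule sum.cong) auto
  ultimately have "a k * \<sigma> k' = 0" using k(1) fin by simp
  then show False using k(2) \<sigma>_nz[OF k'(2)] by simp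
qed

text \<open>A combination of the last \<open>i\<close> functions has zeros of total order \<open>n - i\<close> at the end point; a zero
  of order \<open>i\<close> elsewhere would force too many sign changes upon the constant \<open>M\<^sub>n\<^sub>-\<^sub>1 u\<close>.\<close>

lemma (in chebyshev_scale) Wf_reverse_nonzero:
  assumes i: "1 \<le> i" "i \<le> n" and c: "c \<in> S"
  shows "Wf S (\<lambda>j. \<phi> (Suc n - j)) i c \<noteq> 0"
proof
  let ?\<psi> = "\<lambda>j. \<phi> (Suc n - j)"
  assume "Wf S ?\<psi> i c = 0"
  then obtain d where d: "\<exists>j\<in>{1..i}. d j \<noteq> 0"
    "\<And>j. j < i \<Longrightarrow> (\<Sum>l=1..i. d l * hder S j (?\<psi> l) c) = 0"
    by (rule wronskian_zero_combination) (rule that)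
  define A where "A = {Suc n - i..n}"
  define a where "a l = d (Suc n - l)" for l
  have A: "A \<subseteq> {1..n}" using i by (auto simp: A_def)
  let ?u = "\<lambda>x. \<Sum>l\<in>A. a l * \<phi> l x"
  have bij: "bij_betw (\<lambda>l. Suc n - l) {1..i} A"
    by (rule bij_betw_byWitness[where f' = "\<lambda>l. Suc n - l"]) (use i in \<open>auto simp: A_def\<close>)
  have jet: "hder S j ?u c = 0" if "j < i" for j
  proof -
    have "hder S j ?u c = (\<Sum>l\<in>A. a l * hder S j (\<phi> l) c)"
      using hder_sum[OF A _ c] that i by auto
    also have "\<dots> = (\<Sum>l=1..i. a (Suc n - l) * hder S j (\<phi> (Suc n - l)) c)"
      by (rule sum.reindex_bij_betw[OF bij, symmetric])
    also have "\<dots> = (\<Sum>l=1..i. d l * hder S j (?\<psi> l) c)"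
      using i by (intro sum.cong) (auto simp: a_def)
    finally show ?thesis using d(2)[OF that] by simp
  qed
  obtain j0 where "j0 \<in> {1..i}" "d j0 \<noteq> 0" using d(1) by blast
  then have "Suc n - j0 \<in> A" "a (Suc n - j0) \<noteq> 0" using i by (auto simp: A_def a_def)
  then have nz: "\<not> eventually (\<lambda>x. M 0 ?u x = 0) F" by (rule not_eventually_zero_combination[OF A])
  have uAC: "AC_on S (n - 1) ?u" using M_sum(1)[OF A, of 0 T] T_in n2 by simp
  have zero: "M k ?u c = 0" if "k < i" for k
    by (rule M_zero_of_jet[OF _ uAC c]) (use that i jet in auto)
  have lim: "(M k ?u \<longlongrightarrow> 0) F" if "k < n - i" for k
  proof -
    have l: "((\<lambda>x. \<Sum>l\<in>A. a l * M k (\<phi> l) x) \<longlongrightarrow> (\<Sum>l\<in>A. a l * 0)) F"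
    proof (intro tendsto_sum tendsto_mult tendsto_const)
      fix l assume "l \<in> A"
      then have l: "l \<noteq> Suc k" "k < l" "l \<le> n" using that by (auto simp: A_def)
      show "(M k (\<phi> l) \<longlongrightarrow> 0) F" using M_limit[OF l(2,3)] l(1) by simp
    qed
    have "eventually (\<lambda>x. (\<Sum>l\<in>A. a l * M k (\<phi> l) x) = M k ?u x) F"
      using eventually_S by eventually_elim (use M_sum(2)[OF A] that in auto)
    from Lim_transform_eventually[OF l this] show ?thesis by simp
  qed
  \<comment> \<open>The zero at c adds a sign change for the first i members of the chain, the zero
    limit at the end point does so for the first \<open>n - i\<close>, and each differentiation
    takes one away.\<close>
  have alt: "alternates S c (M k ?u) (min i k + min (n - i) k - k)" if "k < n" for k
    using that
  proof (induction k)
    case 0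
    have "\<exists>x\<in>S. c < x \<and> M 0 ?u x \<noteq> 0"
      using nz unfolding eventually_F using c by blast
    then obtain x where x: "x \<in> S" "c < x" "M 0 ?u x \<noteq> 0" by blast
    moreover have "0 < M 0 ?u x * M 0 ?u x" using x(3) by (meson not_real_square_gt_zero)
    ultimately show ?case unfolding alternates_def
      by (intro exI[of _ "\<lambda>j. x"] exI[of _ "M 0 ?u x"]) (simp del: wop.simps)
  next
    case (Suc k)
    define p where "p = (if k < i then 1 else 0 :: nat)"
    define r where "r = (if k < n - i then 1 else 0 :: nat)"
    have m: "min i k + min (n - i) k - k + p + r = Suc (min i (Suc k) + min (n - i) (Suc k) - Suc k)"
      using Suc.prems i by (auto simp: p_def r_def min_def)
    have "alternates S c (M (Suc k) ?u) (min i k + min (n - i) k - k + p + r - 1)"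
    proof (rule alternates_derivative[where v = "M k ?u" and q = "qw S \<phi> n (Suc k)"])
      show "alternates S c (M k ?u) (min i k + min (n - i) k - k)" using Suc by simp
      show "p = 0 \<or> p = 1 \<and> M k ?u c = 0" using zero by (simp add: p_def)
      show "r = 0 \<or> r = 1 \<and> (M k ?u \<longlongrightarrow> 0) F" using lim by (simp add: r_def)
      show "1 \<le> min i k + min (n - i) k - k + p + r" unfolding m by simp
      show "(M k ?u has_real_derivative M (Suc k) ?u x / qw S \<phi> n (Suc k) x) (at x within S)" if "x \<in> S" for x
        by (rule M_derivative[OF Suc.prems uAC that])
      show "0 < qw S \<phi> n (Suc k) x" if "x \<in> S" for x using qw_pos[OF _ that] Suc.prems by simp
    qed (rule c)
    then show ?case unfolding m by simp
  qed
  note const = M_last_sum[OF A, where a = a]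
  have "alternates S c (M (n - 1) ?u) (min i (n - 1) + min (n - i) (n - 1) - (n - 1))"
    by (rule alt) (use n2 in simp)
  then obtain X s where X: "\<And>j. j \<le> min i (n - 1) + min (n - i) (n - 1) - (n - 1) \<Longrightarrow>
       X j \<in> S \<and> 0 < s * (-1) ^ j * M (n - 1) ?u (X j)"
    unfolding alternates_def by blast
  show False
  \<comment> \<open>For \<open>i < n\<close> the count leaves one sign change of a constant. For
    \<open>i = n\<close> it leaves none, but then the constant is 0 because the last member itself
    vanishes at c, and \<open>alternates\<close> still asserts a nonzero value.\<close>
  proof (cases "i = n")
    case True
    then have "M (n - 1) ?u c = 0" using zero n2 by simp
    then have "M (n - 1) ?u (X 0) = 0" using const[OF c] const[of "X 0"] X[of 0] by simp
    then show False using X[of 0] by simp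
  next
    case False
    then have 1: "(1::nat) \<le> min i (n - 1) + min (n - i) (n - 1) - (n - 1)" using i by (auto simp: min_def)
    have "M (n - 1) ?u (X 0) = M (n - 1) ?u (X 1)"
      using const[of "X 0"] const[of "X 1"] X[of 0] X[OF 1] by simp
    then show False using X[of 0] X[OF 1] by simp
  qed
qed

lemma Wr_eq_Wf: "i \<le> n \<Longrightarrow> Wr S \<phi> n i x = Wf S (\<lambda>j. \<phi> (Suc n - j)) i x"
proof -
  assume "i \<le> n"
  have "map (\<lambda>j. \<phi> (n - j)) [0..<i] = map (\<lambda>j. \<phi> (Suc n - j)) [1..<Suc i]"
    by (rule nth_equalityI) (auto simp del: upt_Suc)
  then show ?thesis by (simp add: Wr_def Wf_def del: upt_Suc)
qed

lemma pw_eq_qw: "i \<le> n \<Longrightarrow> pw S \<phi> n i x = qw S (\<lambda>j. \<phi> (Suc n - j)) n i x"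
  by (auto simp: pw_def qw_def Wr_eq_Wf)

lemma (in chebyshev_scale) reverse_system: "wronskian_system T x0 n (\<lambda>j. \<phi> (Suc n - j))"
  by unfold_locales (use T_less n2 AC Wf_reverse_nonzero in auto)

subsection \<open>Expansions under integral conditions\<close>

lemma nn_integral_Icc_split:
  fixes a b c :: real
  assumes [measurable]: "H \<in> borel_measurable borel" and "a \<le> b" "b \<le> c"
  shows "(\<integral>\<^sup>+t. H t * indicator {a..c} t \<partial>lborel)
     = (\<integral>\<^sup>+t. H t * indicator {a..b} t \<partial>lborel) + (\<integral>\<^sup>+t. H t * indicator {b..c} t \<partial>lborel)"
proof -
  have "(\<integral>\<^sup>+t. H t * indicator {a..b} t \<partial>lborel) + (\<integral>\<^sup>+t. H t * indicator {b..c} t \<partial>lborel)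
      = (\<integral>\<^sup>+t. H t * indicator {a..b} t + H t * indicator {b..c} t \<partial>lborel)"
    by (rule nn_integral_add[symmetric]) auto
  also have "\<dots> = (\<integral>\<^sup>+t. H t * indicator {a..c} t \<partial>lborel)"
    using AE_lborel_singleton[of b] by (intro nn_integral_cong_AE) (use assms(2,3) in \<open>auto simp: indicator_def elim!: eventually_mono\<close>)
  finally show ?thesis ..
qed

lemma nn_integral_derivative_bound:
  assumes der: "\<And>z. z \<in> ivl T x0 \<Longrightarrow> (v has_real_derivative d z) (at z within ivl T x0)"
    and cont: "continuous_on (ivl T x0) d" and xy: "x \<in> ivl T x0" "y \<in> ivl T x0" "x \<le> y"
  shows "ennreal \<bar>v y - v x\<bar> \<le> (\<integral>\<^sup>+t. ennreal \<bar>d t\<bar> * indicator {x..y} t \<partial>lborel)"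
proof -
  have sub: "{x..y} \<subseteq> ivl T x0" by (rule ivl_subset[OF xy(1,2)])
  have "(d has_integral (v y - v x)) {x..y}"
    by (rule fundamental_theorem_of_calculus[OF xy(3)])
      (use DERIV_subset[OF der sub] sub in \<open>auto simp: has_real_derivative_iff_has_vector_derivative[symmetric]\<close>)
  moreover have "d absolutely_integrable_on {x..y}"
    using continuous_on_subset[OF cont sub] by (rule absolutely_integrable_continuous_real)
  ultimately show ?thesis by (intro nn_integral_abs_cont_bound(1)[where k = d]) auto
qed

lemma iterA_antimono: "s \<le> s' \<Longrightarrow> iterA p g n x0 m s' \<le> iterA p g n x0 m s"
  by (cases m) (auto intro!: nn_integral_mono mult_left_mono simp: indicator_def)

context wronskian_system begin

lemma monotone_bounded_limit:
  assumes b: "b \<in> S" and mono: "\<And>x y. x \<in> S \<Longrightarrow> y \<in> S \<Longrightarrow> b \<le> x \<Longrightarrow> x \<le> y \<Longrightarrow> G x \<le> G y"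
    and bound: "\<And>x. x \<in> S \<Longrightarrow> b \<le> x \<Longrightarrow> G x \<le> B"
  obtains L :: real where "(G \<longlongrightarrow> L) F"
proof -
  define L where "L = (SUP x\<in>{x\<in>S. b \<le> x}. G x)"
  have bdd: "bdd_above (G ` {x\<in>S. b \<le> x})" using bound by (auto intro!: bdd_aboveI[of _ B])
  have ne: "{x\<in>S. b \<le> x} \<noteq> {}" using b by auto
  have "(G \<longlongrightarrow> L) F"
  proof (rule order_tendstoI)
    fix l assume "l < L"
    then obtain x where x: "x \<in> S" "b \<le> x" "l < G x"
      unfolding L_def using less_cSUP_iff[OF ne bdd] by auto
    show "eventually (\<lambda>y. l < G y) F"
      using eventually_greater[OF x(1)] by eventually_elim (use mono[OF x(1) _ x(2)] x(3) in force)
  next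
    fix l assume "L < l"
    show "eventually (\<lambda>y. G y < l) F"
      using eventually_greater[OF b]
    proof eventually_elim
      case (elim y)
      then have "G y \<le> L" unfolding L_def by (intro cSUP_upper bdd) auto
      then show ?case using \<open>L < l\<close> by simp
    qed
  qed
  then show ?thesis by (rule that)
qed

text \<open>With G the integral of H from a fixed point, both G and \<open>v + G\<close> are
  increasing and bounded, so v converges as their difference. The estimate of \<open>v x - L\<close>
  arises by letting y tend to the end point in the increment bound.\<close>

lemma limit_of_integrable_increments:
  assumes H: "H \<in> borel_measurable borel"
    and inc: "\<And>x y. x \<in> S \<Longrightarrow> y \<in> S \<Longrightarrow> x \<le> y \<Longrightarrow>
       ennreal \<bar>v y - v x\<bar> \<le> (\<integral>\<^sup>+t. H t * indicator {x..y} t \<partial>lborel)"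
    and fin: "\<And>x. x \<in> S \<Longrightarrow> T < x \<Longrightarrow> (\<integral>\<^sup>+t. H t * indicator {t. x \<le> t \<and> ereal t < x0} t \<partial>lborel) < \<infinity>"
  obtains L where "(v \<longlongrightarrow> L) F"
    "\<And>x. x \<in> S \<Longrightarrow> T < x \<Longrightarrow> ennreal \<bar>v x - L\<bar> \<le> (\<integral>\<^sup>+t. H t * indicator {t. x \<le> t \<and> ereal t < x0} t \<partial>lborel)"
proof -
  define tail where "tail x = (\<integral>\<^sup>+t. H t * indicator {t. x \<le> t \<and> ereal t < x0} t \<partial>lborel)" for x
  have le_tail: "(\<integral>\<^sup>+t. H t * indicator {x..y} t \<partial>lborel) \<le> tail x" if "y \<in> S" for x y
    unfolding tail_def using ivl_down[OF that] that
    by (intro nn_integral_mono mult_left_mono)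
      (auto simp: indicator_def mem_ivl intro: le_less_trans[OF ereal_less_eq(3)[THEN iffD2]])
  \<comment> \<open>The tails are assumed finite only for starting points beyond T, hence a base
    point other than T.\<close>
  obtain b where b: "b \<in> S" "T < b" using ivl_greater[OF T_in] by blast
  define I where "I x = (\<integral>\<^sup>+t. H t * indicator {b..x} t \<partial>lborel)" for x
  define G where "G x = enn2real (I x)" for x
  have Ifin: "I x < \<infinity>" "I x \<le> tail b" if "x \<in> S" for x
    using le_tail[OF that, of b] fin[OF b] unfolding I_def tail_def by auto
  have GI: "ennreal (G x) = I x" if "x \<in> S" for x
    unfolding G_def using Ifin[OF that] by simp
  have incG: "\<bar>v y - v x\<bar> \<le> G y - G x" if "x \<in> S" "y \<in> S" "b \<le> x" "x \<le> y" for x y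
  proof -
    have "ennreal (G x) + ennreal \<bar>v y - v x\<bar> \<le> I x + (\<integral>\<^sup>+t. H t * indicator {x..y} t \<partial>lborel)"
      using inc[OF that(1,2,4)] GI[OF that(1)] by (intro add_mono) auto
    also have "\<dots> = ennreal (G y)"
      using nn_integral_Icc_split[OF H that(3,4)] GI[OF that(2)] by (simp add: I_def)
    finally have "ennreal (G x + \<bar>v y - v x\<bar>) \<le> ennreal (G y)" by (simp add: G_def)
    then show ?thesis by (subst (asm) ennreal_le_iff) (auto simp: G_def)
  qed
  have Gb: "G x \<le> enn2real (tail b)" if "x \<in> S" for x
    unfolding G_def using Ifin(2)[OF that] fin[OF b] by (intro enn2real_mono) (auto simp: tail_def)
  have G0: "0 \<le> G x" for x by (simp add: G_def)
  obtain L1 where L1: "(G \<longlongrightarrow> L1) F"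
  proof (rule monotone_bounded_limit[OF b(1), of G "enn2real (tail b)"])
    show "G x \<le> G y" if "x \<in> S" "y \<in> S" "b \<le> x" "x \<le> y" for x y using incG[OF that] by simp
  qed (use Gb in auto)
  obtain L2 where L2: "((\<lambda>x. v x + G x) \<longlongrightarrow> L2) F"
  proof (rule monotone_bounded_limit[OF b(1), of "\<lambda>x. v x + G x" "v b + 2 * enn2real (tail b)"])
    show "v x + G x \<le> v y + G y" if "x \<in> S" "y \<in> S" "b \<le> x" "x \<le> y" for x y using incG[OF that] by simp
    show "v x + G x \<le> v b + 2 * enn2real (tail b)" if "x \<in> S" "b \<le> x" for x
      using incG[OF b(1) that(1) order_refl that(2)] Gb[OF that(1)] G0[of b] by simp
  qed
  have vL: "(v \<longlongrightarrow> L2 - L1) F" using tendsto_diff[OF L2 L1] by simp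
  show ?thesis
  proof (rule that[OF vL])
    fix x assume x: "x \<in> S" "T < x"
    have tf: "tail x < \<infinity>" using fin[OF x] by (simp add: tail_def)
    have "\<bar>v x - (L2 - L1)\<bar> \<le> enn2real (tail x)"
    proof (rule tendsto_upperbound[OF _ _ F_nontrivial])
      show "((\<lambda>y. \<bar>v x - v y\<bar>) \<longlongrightarrow> \<bar>v x - (L2 - L1)\<bar>) F" by (intro tendsto_intros vL)
      show "eventually (\<lambda>y. \<bar>v x - v y\<bar> \<le> enn2real (tail x)) F"
        using eventually_greater[OF x(1)]
      proof eventually_elim
        case (elim y)
        then have "ennreal \<bar>v y - v x\<bar> \<le> tail x"
          using order_trans[OF inc[OF x(1)] le_tail] by auto
        then have "\<bar>v y - v x\<bar> \<le> enn2real (tail x)" using tf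
          by (metis enn2real_ennreal enn2real_mono abs_ge_zero infinity_ennreal_def)
        then show ?case by (simp add: abs_minus_commute)
      qed
    qed
    then have "ennreal \<bar>v x - (L2 - L1)\<bar> \<le> ennreal (enn2real (tail x))" by (rule ennreal_leI)
    also have "\<dots> = tail x" using tf by simp
    finally show "ennreal \<bar>v x - (L2 - L1)\<bar> \<le> (\<integral>\<^sup>+t. H t * indicator {t. x \<le> t \<and> ereal t < x0} t \<partial>lborel)"
      unfolding tail_def .
  qed
qed

text \<open>Where both exist, the Borel derivative of \<open>M (n - 1) f\<close> and the one
  computed from \<open>Lop\<close> agree by uniqueness of derivatives.\<close>

lemma M_last_density:
  assumes f: "AC_on S (n - 1) f"
  obtains h where "h \<in> borel_measurable borel"
    "AE t in lborel. t \<in> S \<longrightarrow> \<bar>Lop S \<phi> n f t\<bar> / qw S \<phi> n n t = \<bar>h t\<bar>"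
    "\<And>x y. x \<in> S \<Longrightarrow> y \<in> S \<Longrightarrow> x \<le> y \<Longrightarrow>
      ennreal \<bar>M (n - 1) f y - M (n - 1) f x\<bar> \<le> (\<integral>\<^sup>+t. ennreal \<bar>h t\<bar> * indicator {x..y} t \<partial>lborel)"
    "\<And>x y. x \<in> S \<Longrightarrow> y \<in> S \<Longrightarrow> x \<le> y \<Longrightarrow>
      (\<integral>\<^sup>+t. ennreal \<bar>h t\<bar> * indicator {x..y} t \<partial>lborel) < \<infinity>"
proof (rule locally_abs_cont_on_derivative[OF M_last_locally_abs_cont[OF f]])
  fix h assume h: "h \<in> borel_measurable borel"
    "AE x in lborel. x \<in> S \<longrightarrow> (M (n - 1) f has_real_derivative h x) (at x)"
    "\<And>x y. x \<in> S \<Longrightarrow> y \<in> S \<Longrightarrow> x \<le> y \<Longrightarrow>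
      ennreal \<bar>M (n - 1) f y - M (n - 1) f x\<bar> \<le> (\<integral>\<^sup>+t. ennreal \<bar>h t\<bar> * indicator {x..y} t \<partial>lborel)"
    "\<And>x y. x \<in> S \<Longrightarrow> y \<in> S \<Longrightarrow> x \<le> y \<Longrightarrow>
      (\<integral>\<^sup>+t. ennreal \<bar>h t\<bar> * indicator {x..y} t \<partial>lborel) < \<infinity>"
  have ae: "AE t in lborel. t \<in> S \<longrightarrow> \<bar>Lop S \<phi> n f t\<bar> / qw S \<phi> n n t = \<bar>h t\<bar>"
    using h(2) M_last_derivative_ae[OF f]
  proof eventually_elim
    case (elim t)
    show ?case
    proof
      assume t: "t \<in> S"
      then obtain D where D: "(M (n - 1) f has_real_derivative D) (at t within S)"
        "\<bar>D\<bar> = \<bar>Lop S \<phi> n f t\<bar> / qw S \<phi> n n t" using elim by blast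
      have "(M (n - 1) f has_real_derivative h t) (at t within S)"
        using elim t by (blast intro: has_field_derivative_at_within)
      then have "D = h t" by (rule derivative_unique_ivl[OF t D(1)])
      then show "\<bar>Lop S \<phi> n f t\<bar> / qw S \<phi> n n t = \<bar>h t\<bar>" using D(2) by simp
    qed
  qed
  show thesis by (rule that[OF h(1) ae h(3,4)])
qed

lemma M_continuous:
  assumes "k < n" "AC_on S (n - 1) u"
  shows "continuous_on S (M k u)"
proof (cases "k = n - 1")
  case True
  then show ?thesis using locally_abs_cont_on_continuous[OF M_last_locally_abs_cont[OF assms(2)]] by simp
next
  case False
  then have "Suc k < n" using assms(1) by simp
  then show ?thesis
    using M_derivative[OF _ assms(2)] by (intro DERIV_continuous_on) blast
qed

abbreviation A :: "(real \<Rightarrow> real) \<Rightarrow> nat \<Rightarrow> real \<Rightarrow> ennreal" where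
  "A f \<equiv> iterA (qw S \<phi> n) (Lop S \<phi> n f) n x0"

text \<open>The inner integral decreases in its lower limit, so if it is infinite at s' it is
  infinite on all of \<open>{s..s'}\<close>, a set of positive measure with positive weight. The
  argument gives nothing at s itself, hence the strict inequality.\<close>

lemma A_finite_Suc:
  assumes fin: "A f (Suc m) s < \<infinity>" and m: "Suc m < n" and s: "s \<in> S" "s' \<in> S" "s < s'"
  shows "A f m s' < \<infinity>"
proof (rule ccontr)
  assume "\<not> ?thesis"
  then have top: "A f m s' = \<infinity>" by (auto simp: less_top[symmetric])
  have "\<infinity> = (\<integral>\<^sup>+t. \<infinity> * indicator {s..s'} t \<partial>lborel)"
    using s by (subst nn_integral_cmult) (auto simp: ennreal_top_mult ennreal_eq_0_iff)
  also have "\<dots> \<le> A f (Suc m) s"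
    unfolding iterA.simps
  proof (rule nn_integral_mono)
    fix t
    show "\<infinity> * indicator {s..s'} t \<le> ennreal (1 / qw S \<phi> n (n - Suc m) t) * A f m t *
       indicator {t. s \<le> t \<and> ereal t < x0} t"
    proof (cases "t \<in> {s..s'}")
      case True
      then have t: "t \<in> S" using ivl_subset[OF s(1,2)] by auto
      have "A f m s' \<le> A f m t" by (rule iterA_antimono) (use True in simp)
      then have "A f m t = \<infinity>" using top by (simp add: top_unique)
      moreover have "0 < 1 / qw S \<phi> n (n - Suc m) t" using qw_pos[OF _ t, of "n - Suc m"] by simp
      ultimately show ?thesis using True t by (simp add: ennreal_mult_top mem_ivl)
    qed simp
  qed
  finally show False using fin by simp
qed

lemma A_finite:
  assumes fin: "A f (n - 1) T < \<infinity>" and "m \<le> n - 1" and s: "s \<in> S" "T < s"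
  shows "A f m s < \<infinity>"
  using assms(2) s
proof (induction m arbitrary: s rule: inc_induct)
  case base
  then show ?case using iterA_antimono[of T s] fin by (meson le_less_trans less_imp_le)
next
  case (step m)
  \<comment> \<open>Each level moves the lower limit strictly to the right; the midpoint leaves room
    for that above T.\<close>
  define r where "r = (T + s) / 2"
  have r: "T < r" "r < s" using step by (auto simp: r_def)
  then have "r \<in> S" using ivl_down[OF step.prems(1), of r] by auto
  then show ?case using A_finite_Suc[OF step.IH[OF _ r(1)]] r(2) step by auto
qed

text \<open>Besides the zero limits, the induction carries the bound of the k-th remainder by the
  iterated tail \<open>A f (n - 1 - k)\<close>; this bound makes the derivative of the next lower
  member integrable. The limit L found there is removed by a multiple of
  \<open>\<phi> (Suc k0)\<close>, which the operators of index above k0 annihilate, so the earlier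
  limits persist.\<close>

theorem expansion_of_integrable:
  assumes f: "AC_on S (n - 1) f" and fin: "A f (n - 1) T < \<infinity>"
  obtains a where "\<And>k. k < n \<Longrightarrow> ((\<lambda>x. M k f x - (\<Sum>j=1..n. a j * M k (\<phi> j) x)) \<longlongrightarrow> 0) F"
proof -
  define E where "E a m k x = M k f x - (\<Sum>j=n-m..n. a j * M k (\<phi> j) x)" for a m k x
  have "\<exists>a. \<forall>k. n - 1 - m \<le> k \<longrightarrow> k < n \<longrightarrow> (E a m k \<longlongrightarrow> 0) F \<and>
      (\<forall>x\<in>S. T < x \<longrightarrow> ennreal \<bar>E a m k x\<bar> \<le> A f (n - 1 - k) x)" if "m \<le> n - 1" for m
    using that
  proof (induction m)
    case 0
    obtain h where h: "h \<in> borel_measurable borel"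
      "AE t in lborel. t \<in> S \<longrightarrow> \<bar>Lop S \<phi> n f t\<bar> / qw S \<phi> n n t = \<bar>h t\<bar>"
      "\<And>x y. x \<in> S \<Longrightarrow> y \<in> S \<Longrightarrow> x \<le> y \<Longrightarrow>
        ennreal \<bar>M (n - 1) f y - M (n - 1) f x\<bar> \<le> (\<integral>\<^sup>+t. ennreal \<bar>h t\<bar> * indicator {x..y} t \<partial>lborel)"
      by (rule M_last_density[OF f]) (rule that)
    have tail: "(\<integral>\<^sup>+t. ennreal \<bar>h t\<bar> * indicator {t. x \<le> t \<and> ereal t < x0} t \<partial>lborel) = A f 0 x"
      if x: "x \<in> S" for x
      unfolding iterA.simps
    proof (rule nn_integral_cong_AE)
      show "AE t in lborel. ennreal \<bar>h t\<bar> * indicator {t. x \<le> t \<and> ereal t < x0} t =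
        ennreal (\<bar>Lop S \<phi> n f t\<bar> / qw S \<phi> n n t) * indicator {t. x \<le> t \<and> ereal t < x0} t"
        using h(2) by eventually_elim (use x in \<open>auto simp: indicator_def mem_ivl\<close>)
    qed
    have finx: "(\<integral>\<^sup>+t. ennreal \<bar>h t\<bar> * indicator {t. x \<le> t \<and> ereal t < x0} t \<partial>lborel) < \<infinity>"
      if "x \<in> S" "T < x" for x
      unfolding tail[OF that(1)] by (rule A_finite[OF fin _ that]) simp
    have hm: "(\<lambda>t. ennreal \<bar>h t\<bar>) \<in> borel_measurable borel" using h(1) by measurable
    obtain L where L: "(M (n - 1) f \<longlongrightarrow> L) F"
      "\<And>x. x \<in> S \<Longrightarrow> T < x \<Longrightarrow> ennreal \<bar>M (n - 1) f x - L\<bar> \<le> A f 0 x"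
      by (rule limit_of_integrable_increments[OF hm h(3) finx]) (use tail in auto)
    \<comment> \<open>Only the value at n matters at this stage; the others are overwritten in later
      steps.\<close>
    define a where "a = (\<lambda>j::nat. L / \<sigma> (n - 1))"
    have eq: "E a 0 (n - 1) x = M (n - 1) f x - L" if "x \<in> S" for x
      using M_basis_one[of "n - 1" x] that \<sigma>_nz[of "n - 1"] n2 by (simp add: E_def a_def)
    show ?case
    proof (intro exI[of _ a] allI impI)
      fix k assume "n - 1 - 0 \<le> k" "k < n"
      then have k: "k = n - 1" by simp
      have "eventually (\<lambda>x. M (n - 1) f x - L = E a 0 k x) F"
        using eventually_S by eventually_elim (use eq k in auto)
      moreover have "((\<lambda>x. M (n - 1) f x - L) \<longlongrightarrow> 0) F" using tendsto_diff[OF L(1) tendsto_const[of L]] by simp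
      ultimately have "(E a 0 k \<longlongrightarrow> 0) F" by (rule Lim_transform_eventually[rotated])
      then show "(E a 0 k \<longlongrightarrow> 0) F \<and> (\<forall>x\<in>S. T < x \<longrightarrow> ennreal \<bar>E a 0 k x\<bar> \<le> A f (n - 1 - k) x)"
        using L(2) eq k by simp
    qed
  next
    case (Suc m)
    then obtain a where a: "\<And>k. n - 1 - m \<le> k \<Longrightarrow> k < n \<Longrightarrow> (E a m k \<longlongrightarrow> 0) F"
      "\<And>k x. n - 1 - m \<le> k \<Longrightarrow> k < n \<Longrightarrow> x \<in> S \<Longrightarrow> T < x \<Longrightarrow> ennreal \<bar>E a m k x\<bar> \<le> A f (n - 1 - k) x"
      by (metis Suc_leD)
    define k0 where "k0 = n - 1 - Suc m"
    have k0: "Suc k0 = n - 1 - m" "Suc k0 < n" "n - Suc m = Suc k0" "n - 1 - Suc k0 = m" "n - m = Suc (Suc k0)"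
      using Suc.prems n2 by (auto simp: k0_def)
    define r where "r x = f x - (\<Sum>j\<in>{n-m..n}. a j * \<phi> j x)" for x
    have sub: "{n-m..n} \<subseteq> {1..n}" using k0(5) by auto
    have rAC: "AC_on S (n - 1) r" and Mr: "\<And>k x. k < n \<Longrightarrow> x \<in> S \<Longrightarrow> M k r x = E a m k x"
      unfolding r_def E_def using AC_on_combination[OF _ sub f] by auto
    define d where "d x = M (Suc k0) r x / qw S \<phi> n (Suc k0) x" for x
    have der: "(M k0 r has_real_derivative d x) (at x within S)" if "x \<in> S" for x
      unfolding d_def using M_derivative[OF k0(2) rAC that] .
    have dc: "continuous_on S d"
      unfolding d_def using M_continuous[OF k0(2) rAC] qw_continuous[of "Suc k0"] qw_pos[of "Suc k0"] k0(2)
      by (intro continuous_on_divide) force+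
    define H where "H t = ennreal \<bar>d t\<bar> * indicator S t" for t
    have Hm: "H \<in> borel_measurable borel"
      unfolding H_def by (intro borel_measurable_ennreal_indicator_ivl continuous_intros dc)
    have inc: "ennreal \<bar>M k0 r y - M k0 r x\<bar> \<le> (\<integral>\<^sup>+t. H t * indicator {x..y} t \<partial>lborel)"
      if "x \<in> S" "y \<in> S" "x \<le> y" for x y
    proof -
      have "(\<integral>\<^sup>+t. ennreal \<bar>d t\<bar> * indicator {x..y} t \<partial>lborel) = (\<integral>\<^sup>+t. H t * indicator {x..y} t \<partial>lborel)"
        using ivl_subset[OF that(1,2)] by (intro nn_integral_cong) (auto simp: H_def indicator_def)
      then show ?thesis using nn_integral_derivative_bound[OF der dc that] by simp
    qed
    have tail: "(\<integral>\<^sup>+t. H t * indicator {t. x \<le> t \<and> ereal t < x0} t \<partial>lborel) \<le> A f (Suc m) x"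
      if x: "x \<in> S" "T < x" for x
      unfolding iterA.simps k0(3)
    proof (rule nn_integral_mono)
      fix t
      show "H t * indicator {t. x \<le> t \<and> ereal t < x0} t \<le>
        ennreal (1 / qw S \<phi> n (Suc k0) t) * A f m t * indicator {t. x \<le> t \<and> ereal t < x0} t"
      proof (cases "x \<le> t \<and> ereal t < x0")
        case True
        then have t: "t \<in> S" "T < t" using x by (auto simp: mem_ivl)
        have q: "0 < qw S \<phi> n (Suc k0) t" using qw_pos[OF _ t(1), of "Suc k0"] k0(2) by simp
        have "ennreal \<bar>d t\<bar> = ennreal (1 / qw S \<phi> n (Suc k0) t) * ennreal \<bar>E a m (Suc k0) t\<bar>"
          using q Mr[OF k0(2) t(1)] by (simp add: d_def ennreal_mult'[symmetric])
        also have "\<dots> \<le> ennreal (1 / qw S \<phi> n (Suc k0) t) * A f m t"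
        proof (rule mult_left_mono)
          have "n - 1 - m \<le> Suc k0" by (simp only: k0(1))
          from a(2)[OF this k0(2) t] show "ennreal \<bar>E a m (Suc k0) t\<bar> \<le> A f m t" unfolding k0(4) .
        qed simp
        finally show ?thesis using True t by (simp add: H_def)
      qed simp
    qed
    have finx: "(\<integral>\<^sup>+t. H t * indicator {t. x \<le> t \<and> ereal t < x0} t \<partial>lborel) < \<infinity>"
      if "x \<in> S" "T < x" for x
      using le_less_trans[OF tail[OF that] A_finite[OF fin Suc.prems that]] .
    obtain L where L: "(M k0 r \<longlongrightarrow> L) F"
      "\<And>x. x \<in> S \<Longrightarrow> T < x \<Longrightarrow>
        ennreal \<bar>M k0 r x - L\<bar> \<le> (\<integral>\<^sup>+t. H t * indicator {t. x \<le> t \<and> ereal t < x0} t \<partial>lborel)"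
      by (rule limit_of_integrable_increments[of H "M k0 r", OF Hm inc finx]) auto
    have L2: "ennreal \<bar>M k0 r x - L\<bar> \<le> A f (Suc m) x" if "x \<in> S" "T < x" for x
      using order_trans[OF L(2)[OF that] tail[OF that]] .
    \<comment> \<open>\<open>M k0 (\<phi> (Suc k0))\<close> is the constant
      \<open>\<sigma> k0\<close>, so this coefficient subtracts exactly L.\<close>
    define a' where "a' = a(Suc k0 := L / \<sigma> k0)"
    have E': "E a' (Suc m) k x = E a m k x - (L / \<sigma> k0) * M k (\<phi> (Suc k0)) x" for k x
    proof -
      have "{n - Suc m..n} = insert (Suc k0) {n-m..n}" using k0(2,3,5) by auto
      moreover have "Suc k0 \<notin> {n-m..n}" using k0(2,3,5) by auto
      moreover have "(\<Sum>j=n-m..n. a' j * M k (\<phi> j) x) = (\<Sum>j=n-m..n. a j * M k (\<phi> j) x)"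
        using k0(2,3,5) by (intro sum.cong) (auto simp: a'_def)
      ultimately show ?thesis by (simp add: E_def a'_def del: wop.simps)
    qed
    show ?case
    proof (intro exI[of _ a'] allI impI)
      fix k assume k: "n - 1 - Suc m \<le> k" "k < n"
      show "(E a' (Suc m) k \<longlongrightarrow> 0) F \<and> (\<forall>x\<in>S. T < x \<longrightarrow> ennreal \<bar>E a' (Suc m) k x\<bar> \<le> A f (n - 1 - k) x)"
      proof (cases "k = k0")
        case True
        have eq: "E a' (Suc m) k x = M k0 r x - L" if "x \<in> S" for x
          using E'[of k x] Mr[of k0 x] M_basis_one[of k0 x] \<sigma>_nz[of k0] True k0(2) that by (simp del: wop.simps)
        have "eventually (\<lambda>x. M k0 r x - L = E a' (Suc m) k x) F"
          using eventually_S by eventually_elim (use eq in auto)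
        moreover have "((\<lambda>x. M k0 r x - L) \<longlongrightarrow> 0) F" using tendsto_diff[OF L(1) tendsto_const[of L]] by simp
        ultimately have "(E a' (Suc m) k \<longlongrightarrow> 0) F" by (rule Lim_transform_eventually[rotated])
        moreover have "n - 1 - k = Suc m" using True k0(2,3) by simp
        ultimately show ?thesis using L2 eq by simp
      next
        case False
        then have k': "n - 1 - m \<le> k" using k k0(2,5) by (simp add: k0_def)
        have eq: "E a' (Suc m) k x = E a m k x" if "x \<in> S" for x
          using E'[of k x] M_basis_zero[of "Suc k0" k x] k' k0(1,2) k that by (simp del: wop.simps)
        have "eventually (\<lambda>x. E a m k x = E a' (Suc m) k x) F"
          using eventually_S by eventually_elim (use eq in auto)
        from Lim_transform_eventually[OF a(1)[OF k' k(2)] this] show ?thesis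
          using a(2)[OF k' k(2)] eq by simp
      qed
    qed
  qed
  from this[of "n - 1"] obtain a where "\<And>k. k < n \<Longrightarrow> (E a (n - 1) k \<longlongrightarrow> 0) F" by auto
  moreover have "n - (n - 1) = 1" using n2 by simp
  ultimately show ?thesis using that[of a] unfolding E_def by simp
qed

end

subsection \<open>Kernels of the iterated integrals\<close>

lemma tonelli_triangle:
  assumes [measurable]: "X \<in> borel_measurable borel" "K \<in> borel_measurable borel"
  shows "(\<integral>\<^sup>+t. X t * (\<integral>\<^sup>+s. K s * (if t \<le> s then 1 else 0) \<partial>lborel) \<partial>lborel)
    = (\<integral>\<^sup>+s. (\<integral>\<^sup>+t. X t * (if t \<le> s then 1 else 0) \<partial>lborel) * K s \<partial>(lborel :: real measure))"
proof -
  have "(\<integral>\<^sup>+t. X t * (\<integral>\<^sup>+s. K s * (if t \<le> s then 1 else 0) \<partial>lborel) \<partial>lborel)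
     = (\<integral>\<^sup>+t. (\<integral>\<^sup>+s. X t * (K s * (if t \<le> s then 1 else 0)) \<partial>lborel) \<partial>lborel)"
    by (intro nn_integral_cong nn_integral_cmult[symmetric]) measurable
  also have "\<dots> = (\<integral>\<^sup>+s. (\<integral>\<^sup>+t. X t * (K s * (if t \<le> s then 1 else 0)) \<partial>lborel) \<partial>lborel)"
    by (rule lborel_pair.Fubini'[symmetric]) measurable
  also have "\<dots> = (\<integral>\<^sup>+s. (\<integral>\<^sup>+t. (X t * (if t \<le> s then 1 else 0)) * K s \<partial>lborel) \<partial>lborel)"
    by (simp add: mult.assoc mult.left_commute mult.commute)
  also have "\<dots> = (\<integral>\<^sup>+s. (\<integral>\<^sup>+t. X t * (if t \<le> s then 1 else 0) \<partial>lborel) * K s \<partial>lborel)"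
    by (intro nn_integral_cong nn_integral_multc) measurable
  finally show ?thesis .
qed

text \<open>The integrands of \<open>iterA\<close> with the restriction to the interval absorbed
  into c and H. The only relation left between two variables is \<open>t \<le> s\<close>, which
  \<open>outer_kernel\<close> reads from the other side; in this form Tonelli's theorem
  applies.\<close>

primrec inner_kernel :: "(nat \<Rightarrow> real \<Rightarrow> ennreal) \<Rightarrow> nat \<Rightarrow> (real \<Rightarrow> ennreal) \<Rightarrow> nat \<Rightarrow> real \<Rightarrow> ennreal" where
  "inner_kernel c n H 0 = H"
| "inner_kernel c n H (Suc m) = (\<lambda>t. c (n - Suc m) t *
     (\<integral>\<^sup>+s. inner_kernel c n H m s * (if t \<le> s then 1 else 0) \<partial>lborel))"

primrec outer_kernel :: "(nat \<Rightarrow> real \<Rightarrow> ennreal) \<Rightarrow> nat \<Rightarrow> real \<Rightarrow> ennreal" where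
  "outer_kernel c 0 = (\<lambda>t. 1)"
| "outer_kernel c (Suc j) = (\<lambda>t. \<integral>\<^sup>+s. (outer_kernel c j s * c (Suc j) s) * (if s \<le> t then 1 else 0) \<partial>lborel)"

text \<open>The integral of \<open>outer_kernel c j\<close> times
  \<open>inner_kernel c n H (n - 1 - j)\<close> does not depend on j: one interchange of integrals
  moves one weight from the inner kernel to the outer one.\<close>

lemma inner_outer_kernel:
  assumes c: "\<And>i. 1 \<le> i \<Longrightarrow> i < n \<Longrightarrow> c i \<in> borel_measurable borel" and H: "H \<in> borel_measurable borel"
    and "1 \<le> n"
  shows "(\<integral>\<^sup>+t. inner_kernel c n H (n - 1) t \<partial>lborel) = (\<integral>\<^sup>+t. outer_kernel c (n - 1) t * H t \<partial>lborel)"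
proof -
  have mi: "inner_kernel c n H m \<in> borel_measurable borel" if "m < n" for m
    using that
  proof (induction m)
    case (Suc m)
    have [measurable]: "inner_kernel c n H m \<in> borel_measurable borel" "c (n - Suc m) \<in> borel_measurable borel"
      using Suc by (auto intro: c)
    show ?case unfolding inner_kernel.simps by measurable
  qed (use H in simp)
  have mo: "outer_kernel c j \<in> borel_measurable borel" if "j < n" for j
    using that
  proof (induction j)
    case (Suc j)
    have [measurable]: "outer_kernel c j \<in> borel_measurable borel" "c (Suc j) \<in> borel_measurable borel"
      using Suc by (auto intro: c)
    show ?case unfolding outer_kernel.simps by measurable
  qed simp
  have "(\<integral>\<^sup>+t. inner_kernel c n H (n - 1) t \<partial>lborel)
      = (\<integral>\<^sup>+t. outer_kernel c j t * inner_kernel c n H (n - 1 - j) t \<partial>lborel)" if "j \<le> n - 1" for j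
    using that
  proof (induction j)
    case (Suc j)
    define m where "m = n - 1 - Suc j"
    have m: "n - 1 - j = Suc m" "n - Suc m = Suc j" "m < n" using Suc.prems \<open>1 \<le> n\<close> by (auto simp: m_def)
    have [measurable]: "outer_kernel c j \<in> borel_measurable borel" "c (Suc j) \<in> borel_measurable borel"
      using Suc.prems by (auto intro: c mo)
    have "(\<integral>\<^sup>+t. inner_kernel c n H (n - 1) t \<partial>lborel)
      = (\<integral>\<^sup>+t. (outer_kernel c j t * c (Suc j) t) * (\<integral>\<^sup>+s. inner_kernel c n H m s * (if t \<le> s then 1 else 0) \<partial>lborel) \<partial>lborel)"
      using Suc.IH Suc.prems unfolding m(1) by (simp add: m(2) mult.assoc)
    also have "\<dots> = (\<integral>\<^sup>+s. outer_kernel c (Suc j) s * inner_kernel c n H m s \<partial>lborel)"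
      unfolding outer_kernel.simps by (rule tonelli_triangle[OF _ mi[OF m(3)]]) measurable
    finally show ?case unfolding m_def .
  qed simp
  from this[of "n - 1"] show ?thesis by simp
qed

text \<open>H is a Borel version of the integrand; it supplies the measurability on which the
  interchange of integrals relies.\<close>

lemma iterA_eq_integral_iterB:
  assumes T: "ereal T < x0" and n: "1 \<le> n"
    and pc: "\<And>i. 1 \<le> i \<Longrightarrow> i < n \<Longrightarrow> continuous_on (ivl T x0) (p i)"
    and pp: "\<And>i x. 1 \<le> i \<Longrightarrow> i < n \<Longrightarrow> x \<in> ivl T x0 \<Longrightarrow> 0 < p i x"
    and H: "H \<in> borel_measurable borel"
    and gH: "AE t in lborel. t \<in> ivl T x0 \<longrightarrow> ennreal (\<bar>g t\<bar> / p n t) = H t"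
  shows "iterA p g n x0 (n - 1) T = (\<integral>\<^sup>+t. (iterB p T (n - 1) t * ennreal (\<bar>g t\<bar> / p n t)) * indicator (ivl T x0) t \<partial>lborel)"
proof -
  let ?S = "ivl T x0"
  define c where "c i t = ennreal (1 / p i t) * indicator ?S t" for i t
  define K where "K t = H t * indicator ?S t" for t
  have cm: "c i \<in> borel_measurable borel" if "1 \<le> i" "i < n" for i
  proof -
    have "p i t \<noteq> 0" if "t \<in> ?S" for t
      using pp[OF \<open>1 \<le> i\<close> \<open>i < n\<close> that] by simp
    then have "continuous_on ?S (\<lambda>t. 1 / p i t)"
      by (intro continuous_on_divide continuous_on_const pc[OF that]) auto
    then show ?thesis unfolding c_def by (rule borel_measurable_ennreal_indicator_ivl)
  qed
  have cS: "c i t = (if t \<in> ?S then ennreal (1 / p i t) else 0)" for i t by (simp add: c_def)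
  have Km: "K \<in> borel_measurable borel" unfolding K_def using H by measurable
  have ind: "t \<in> ?S \<and> s \<le> t \<longleftrightarrow> s \<le> t \<and> ereal t < x0" if "s \<in> ?S" for s t
    using that by (auto simp: mem_ivl)
  have A: "iterA p g n x0 m s = (\<integral>\<^sup>+t. inner_kernel c n K m t * (if s \<le> t then 1 else 0) \<partial>lborel)"
    if "s \<in> ?S" for m s
    using that
  proof (induction m arbitrary: s)
    case 0
    show ?case unfolding iterA.simps inner_kernel.simps
      by (rule nn_integral_cong_AE, use gH in eventually_elim) (use ind[OF 0] in \<open>auto simp: K_def indicator_def\<close>)
  next
    case (Suc m)
    show ?case unfolding iterA.simps inner_kernel.simps
      by (rule nn_integral_cong) (use ind[OF Suc.prems] Suc.IH in \<open>auto simp: cS[of "n - Suc m"] indicator_def\<close>)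
  qed
  have B: "iterB p T j t = outer_kernel c j t" if "t \<in> ?S" for j t
    using that
  proof (induction j arbitrary: t)
    case (Suc j)
    have "s \<in> {T..t} \<longleftrightarrow> s \<in> ?S \<and> s \<le> t" for s
      using ivl_down[OF Suc.prems, of s] by (auto simp: mem_ivl)
    then show ?case unfolding iterB.simps outer_kernel.simps
      by (intro nn_integral_cong) (use Suc.IH in \<open>auto simp: cS[of "Suc j"] indicator_def\<close>)
  qed simp
  have TS: "T \<in> ?S" using T by (simp add: mem_ivl)
  have sup: "inner_kernel c n K m t = 0" if "\<not> T \<le> t" for m t
    using that by (cases m) (auto simp: K_def cS mem_ivl)
  have "iterA p g n x0 (n - 1) T = (\<integral>\<^sup>+t. inner_kernel c n K (n - 1) t \<partial>lborel)"
    unfolding A[OF TS] using sup by (intro nn_integral_cong) auto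
  also have "\<dots> = (\<integral>\<^sup>+t. outer_kernel c (n - 1) t * K t \<partial>lborel)"
    by (rule inner_outer_kernel[OF cm Km n])
  also have "\<dots> = (\<integral>\<^sup>+t. (iterB p T (n - 1) t * ennreal (\<bar>g t\<bar> / p n t)) * indicator ?S t \<partial>lborel)"
    by (rule nn_integral_cong_AE, use gH in eventually_elim) (use B in \<open>auto simp: K_def indicator_def\<close>)
  finally show ?thesis .
qed

lemma iterA_cong:
  assumes p: "\<And>i. 1 \<le> i \<Longrightarrow> i \<le> n \<Longrightarrow> p i = p' i" and g: "\<And>t. t \<in> ivl T x0 \<Longrightarrow> g t = g' t"
    and "m < n" "T \<le> s"
  shows "iterA p g n x0 m s = iterA p' g' n x0 m s"
  using assms(3,4)
proof (induction m arbitrary: s)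
  case 0
  then show ?case using p[of n] g by (auto intro!: nn_integral_cong simp: indicator_def mem_ivl)
next
  case (Suc m)
  then show ?case using p[of "n - Suc m"] by (auto intro!: nn_integral_cong simp: indicator_def)
qed

lemma iterB_cong:
  assumes p: "\<And>i. 1 \<le> i \<Longrightarrow> i \<le> n \<Longrightarrow> p i = p' i" and "j \<le> n"
  shows "iterB p T j t = iterB p' T j t"
  using assms(2) by (induction j arbitrary: t) (auto simp: p)

lemma wop_cong: "(\<And>i. i \<le> k \<Longrightarrow> w i = w' i) \<Longrightarrow> wop S w k u = wop S w' k u"
  by (induction k) simp_all

section \<open>The real-valued kernel and Lagrange's identity\<close>

context wronskian_system begin

text \<open>A counterpart of \<open>iterB\<close> that can be differentiated;
  \<open>iterB_eq_B\<close> identifies the two on the interval.\<close>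

primrec B :: "nat \<Rightarrow> real \<Rightarrow> real" where
  "B 0 = (\<lambda>t. 1)"
| "B (Suc k) = (\<lambda>t. integral {T..t} (\<lambda>s. B k s / qw S \<phi> n (Suc k) s))"

lemma B_derivative_of_continuous:
  assumes c: "continuous_on S (B k)" and k: "Suc k < n" and x: "x \<in> S"
  shows "(B (Suc k) has_real_derivative B k x / qw S \<phi> n (Suc k) x) (at x within S)"
proof -
  have d: "continuous_on S (\<lambda>s. B k s / qw S \<phi> n (Suc k) s)"
    using c qw_continuous[of "Suc k"] qw_pos[of "Suc k"] k by (intro continuous_on_divide) force+
  obtain y where y: "y \<in> S" "x < y" using ivl_greater[OF x] by blast
  have "continuous_on {T..y} (\<lambda>s. B k s / qw S \<phi> n (Suc k) s)"
    by (rule continuous_on_subset[OF d ivl_subset[OF T_in y(1)]])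
  from integral_has_real_derivative[OF this, of x]
  show ?thesis using at_within_Icc_ivl[OF x y] x y by (simp add: mem_ivl)
qed

lemma B_continuous: "k < n \<Longrightarrow> continuous_on S (B k)"
proof (induction k)
  case (Suc k)
  then show ?case using B_derivative_of_continuous[of k] by (intro DERIV_continuous_on) (auto simp del: B.simps)
qed simp

lemma B_derivative:
  "Suc k < n \<Longrightarrow> x \<in> S \<Longrightarrow> (B (Suc k) has_real_derivative B k x / qw S \<phi> n (Suc k) x) (at x within S)"
  using B_derivative_of_continuous B_continuous by simp

lemma B_T: "B (Suc k) T = 0"
  by simp

lemma B_pos: "k < n \<Longrightarrow> x \<in> S \<Longrightarrow> T < x \<Longrightarrow> 0 < B k x"
proof (induction k arbitrary: x)
  case (Suc k)
  obtain z where z: "T < z" "z < x" "z \<in> S" "B (Suc k) x - B (Suc k) T = (x - T) * (B k z / qw S \<phi> n (Suc k) z)"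
    by (rule mean_value_ivl[OF T_in Suc.prems(2,3) B_derivative[OF Suc.prems(1)]])
  have "0 < B k z / qw S \<phi> n (Suc k) z" using Suc.IH[of z] qw_pos[of "Suc k" z] z Suc.prems by simp
  then have "0 < (x - T) * (B k z / qw S \<phi> n (Suc k) z)" using Suc.prems(3) by (intro mult_pos_pos) auto
  then show ?case using z(4) unfolding B_T by simp
qed simp

lemma B_nonneg: "k < n \<Longrightarrow> x \<in> S \<Longrightarrow> 0 \<le> B k x"
  using B_pos[of k x] B_T by (cases "x = T"; cases k) (auto simp: mem_ivl simp del: B.simps(2) intro: less_imp_le)

lemma B_mono:
  assumes "k < n" "x \<in> S" "y \<in> S" "x \<le> y"
  shows "B k x \<le> B k y"
proof (cases "k = 0 \<or> x = y")
  case False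
  then obtain j where j: "k = Suc j" and xy: "x < y" using assms by (cases k) auto
  obtain z where z: "x < z" "z < y" "z \<in> S" "B (Suc j) y - B (Suc j) x = (y - x) * (B j z / qw S \<phi> n (Suc j) z)"
    by (rule mean_value_ivl[OF assms(2,3) xy B_derivative]) (use assms(1) j in auto)
  have "0 \<le> (y - x) * (B j z / qw S \<phi> n (Suc j) z)"
    using B_nonneg[of j z] qw_pos[of "Suc j" z] z(3) xy assms(1) j by simp
  then show ?thesis using z(4) j by simp
qed auto

lemma iterB_eq_B: "k < n \<Longrightarrow> t \<in> S \<Longrightarrow> iterB (qw S \<phi> n) T k t = ennreal (B k t)"
proof (induction k arbitrary: t)
  case (Suc k)
  have sub: "{T..t} \<subseteq> S" using ivl_subset[OF T_in Suc.prems(2)] .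
  have q: "0 < qw S \<phi> n (Suc k) s" if "s \<in> S" for s using qw_pos[OF _ that] Suc.prems by simp
  have d: "continuous_on S (\<lambda>s. B k s / qw S \<phi> n (Suc k) s)"
    using B_continuous[of k] qw_continuous[of "Suc k"] q Suc.prems by (intro continuous_on_divide) force+
  have nn: "0 \<le> B k s / qw S \<phi> n (Suc k) s" if "s \<in> S" for s
    using B_nonneg[OF _ that, of k] q[OF that] Suc.prems by simp
  have "iterB (qw S \<phi> n) T (Suc k) t
      = (\<integral>\<^sup>+s. ennreal \<bar>B k s / qw S \<phi> n (Suc k) s\<bar> * indicator {T..t} s \<partial>lborel)"
    unfolding iterB.simps
  proof (rule nn_integral_cong)
    fix s
    show "iterB (qw S \<phi> n) T k s * ennreal (1 / qw S \<phi> n (Suc k) s) * indicator {T..t} s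
        = ennreal \<bar>B k s / qw S \<phi> n (Suc k) s\<bar> * indicator {T..t} s"
    proof (cases "s \<in> {T..t}")
      case True
      then have s: "s \<in> S" using sub by blast
      have "iterB (qw S \<phi> n) T k s * ennreal (1 / qw S \<phi> n (Suc k) s) = ennreal (B k s * (1 / qw S \<phi> n (Suc k) s))"
        using Suc.IH[OF _ s] Suc.prems B_nonneg[OF _ s, of k] q[OF s] by (simp add: ennreal_mult del: times_divide_eq_right)
      then show ?thesis using abs_of_nonneg[OF nn[OF s]] by (simp only:) simp
    qed simp
  qed
  also have "\<dots> = ennreal (integral {T..t} (\<lambda>s. \<bar>B k s / qw S \<phi> n (Suc k) s\<bar>))"
    by (rule nn_integral_abs_eq_integral[OF absolutely_integrable_continuous_real[OF continuous_on_subset[OF d sub]]])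
  also have "integral {T..t} (\<lambda>s. \<bar>B k s / qw S \<phi> n (Suc k) s\<bar>) = B (Suc k) t"
    unfolding B.simps by (intro integral_cong abs_of_nonneg nn) (use sub in auto)
  finally show ?case .
qed simp

text \<open>Lagrange's identity for the bilinear form pairing \<open>B\<close> with the chain \<open>M\<^sub>k u\<close>.\<close>

lemma pairing_constant:
  assumes u: "AC_on S (n - 1) u" and const: "\<And>x. x \<in> S \<Longrightarrow> M (n - 1) u x = C"
    and t: "t \<in> S" and zero: "\<And>k. k < n - 1 \<Longrightarrow> M k u t = 0"
  shows "\<bar>M 0 u T\<bar> = B (n - 1) t * \<bar>M (n - 1) u t\<bar>"
proof -
  \<comment> \<open>The derivative of \<open>M k u\<close>; for the last member it is 0 because that
    member is constant.\<close>
  define d where "d k x = (if Suc k < n then M (Suc k) u x / qw S \<phi> n (Suc k) x else 0)" for k x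
  have dM: "(M k u has_real_derivative d k x) (at x within S)" if "k < n" "x \<in> S" for k x
  proof (cases "Suc k < n")
    case True
    then show ?thesis unfolding d_def using M_derivative[OF True u that(2)] by simp
  next
    case False
    then have "k = n - 1" using that(1) by simp
    have "((\<lambda>x. C) has_real_derivative 0) (at x within S)" by simp
    then have "(M k u has_real_derivative 0) (at x within S)"
      by (rule has_real_derivative_cong_on[OF _ that(2)]) (simp only: const \<open>k = n - 1\<close>)
    then show ?thesis using False by (simp only: d_def if_False)
  qed
  \<comment> \<open>The derivative of this alternating sum telescopes to a single term, which
    vanishes for \<open>m = n - 1\<close>. At T all terms but the first vanish by
    \<open>B_T\<close>, at t all but the last by \<open>zero\<close>.\<close>
  define D where "D m x = (\<Sum>k\<le>m. (-1) ^ k * (B k x * M k u x))" for m x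
  have dD: "(D m has_real_derivative (-1) ^ m * (B m x * d m x)) (at x within S)" if "m < n" "x \<in> S" for m x
    using that
  proof (induction m)
    case 0
    then show ?case using dM[of 0 x] by (simp add: D_def del: wop.simps)
  next
    case (Suc m)
    have "((\<lambda>x. D m x + (-1) ^ Suc m * (B (Suc m) x * M (Suc m) u x)) has_real_derivative
       (-1) ^ m * (B m x * d m x) + (-1) ^ Suc m *
         (B m x / qw S \<phi> n (Suc m) x * M (Suc m) u x + d (Suc m) x * B (Suc m) x)) (at x within S)"
      using Suc by (intro DERIV_add DERIV_cmult DERIV_mult B_derivative dM) auto
    moreover have "(\<lambda>x. D m x + (-1) ^ Suc m * (B (Suc m) x * M (Suc m) u x)) = D (Suc m)"
      by (simp add: D_def fun_eq_iff)
    moreover have "(-1) ^ m * (B m x * d m x) + (-1) ^ Suc m *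
         (B m x / qw S \<phi> n (Suc m) x * M (Suc m) u x + d (Suc m) x * B (Suc m) x)
       = (-1) ^ Suc m * (B (Suc m) x * d (Suc m) x)"
    proof -
      have "d m x = M (Suc m) u x / qw S \<phi> n (Suc m) x" using Suc.prems by (simp only: d_def if_True)
      then have "B m x * d m x = B m x / qw S \<phi> n (Suc m) x * M (Suc m) u x" by (simp del: wop.simps B.simps)
      then show ?thesis by (simp add: distrib_left mult.commute del: wop.simps B.simps)
    qed
    ultimately show ?case by (simp only:)
  qed
  have Dconst: "D (n - 1) T = D (n - 1) t"
  proof (cases "T = t")
    case False
    then have "T < t" using t by (simp add: mem_ivl)
    obtain z where z: "T < z" "z < t" "z \<in> S"
      "D (n - 1) t - D (n - 1) T = (t - T) * ((-1) ^ (n - 1) * (B (n - 1) z * d (n - 1) z))"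
      by (rule mean_value_ivl[OF T_in t \<open>T < t\<close> dD]) (use n2 in auto)
    moreover have "d (n - 1) z = 0" using n2 by (simp add: d_def)
    ultimately show ?thesis by simp
  qed simp
  have "D (n - 1) T = (\<Sum>k\<in>{0}. (-1) ^ k * (B k T * M k u T))"
    unfolding D_def
  proof (rule sum.mono_neutral_right)
    show "\<forall>k\<in>{..n - 1} - {0}. (-1) ^ k * (B k T * M k u T) = 0"
    proof
      fix k assume "k \<in> {..n - 1} - {0}"
      then obtain j where "k = Suc j" by (cases k) auto
      then show "(-1) ^ k * (B k T * M k u T) = 0" using B_T[of j] by (simp del: B.simps wop.simps)
    qed
  qed auto
  moreover have "D (n - 1) t = (\<Sum>k\<in>{n-1}. (-1) ^ k * (B k t * M k u t))"
    unfolding D_def by (rule sum.mono_neutral_right) (use zero in auto)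
  ultimately have "M 0 u T = (-1) ^ (n - 1) * (B (n - 1) t * M (n - 1) u t)"
    using Dconst by simp
  then have "\<bar>M 0 u T\<bar> = \<bar>B (n - 1) t\<bar> * \<bar>M (n - 1) u t\<bar>" by (simp add: abs_mult power_abs)
  then show ?thesis using B_nonneg[of "n - 1" t] t n2 by simp
qed

lemma kernel_value:
  assumes t: "t \<in> S"
    and jet: "\<And>j. j < n \<Longrightarrow> (\<Sum>i=1..n. c i * hder S j (\<phi> i) t) = (if j = n - 1 then 1 else 0)"
  shows "\<bar>\<Sum>i=1..n. c i * \<phi> i T\<bar> / \<bar>\<phi> 1 T\<bar> = B (n - 1) t / qw S \<phi> n n t"
proof -
  let ?u = "\<lambda>x. \<Sum>i=1..n. c i * \<phi> i x"
  have u: "AC_on S (n - 1) ?u" using M_sum(1)[of "{1..n}" 0 T] n2 T_in by simp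
  have h: "hder S j ?u t = (if j = n - 1 then 1 else 0)" if "j < n" for j
    using hder_sum[OF order_refl that t] jet[OF that] by simp
  have "\<bar>M 0 ?u T\<bar> = B (n - 1) t * \<bar>M (n - 1) ?u t\<bar>"
  proof (rule pairing_constant[OF u M_last_sum[OF order_refl] t])
    show "M k ?u t = 0" if "k < n - 1" for k
      by (rule M_zero_of_jet[OF _ u t]) (use that h in auto)
  qed
  also have "\<bar>M (n - 1) ?u t\<bar> = 1 / qw S \<phi> n n t"
    by (rule M_last_of_jet[OF u t]) (use h n2 in auto)
  finally show ?thesis by (simp add: qw_def abs_mult)
qed

text \<open>The weight is bounded above, but below only from b on, since the kernel to be inserted
  for G vanishes at T; on \<open>{T..b}\<close> the integral of H is finite by
  \<open>fin\<close>.\<close>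

lemma finite_weighted_integral_iff:
  assumes H[measurable]: "H \<in> borel_measurable borel" and b: "b \<in> S"
    and G: "continuous_on S G" "\<And>t. t \<in> S \<Longrightarrow> 0 \<le> G t \<and> G t \<le> C"
      "\<And>t. t \<in> S \<Longrightarrow> b \<le> t \<Longrightarrow> G b \<le> G t" "0 < G b"
    and fin: "(\<integral>\<^sup>+t. H t * indicator {T..b} t \<partial>lborel) < \<infinity>"
  shows "(\<integral>\<^sup>+t. (ennreal (G t) * H t) * indicator S t \<partial>lborel) < \<infinity> \<longleftrightarrow>
    (\<integral>\<^sup>+t. H t * indicator S t \<partial>lborel) < \<infinity>"
proof
  have [measurable]: "(\<lambda>t. (ennreal (G t) * H t) * indicator S t) \<in> borel_measurable borel"
    using borel_measurable_times_ennreal[OF borel_measurable_ennreal_indicator_ivl[OF G(1)] H] by (simp add: mult_ac)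
  assume f: "(\<integral>\<^sup>+t. (ennreal (G t) * H t) * indicator S t \<partial>lborel) < \<infinity>"
  have "(\<integral>\<^sup>+t. H t * indicator S t \<partial>lborel) \<le>
     (\<integral>\<^sup>+t. H t * indicator {T..b} t + ennreal (1 / G b) * ((ennreal (G t) * H t) * indicator S t) \<partial>lborel)"
  proof (rule nn_integral_mono)
    fix t
    show "H t * indicator S t \<le> H t * indicator {T..b} t + ennreal (1 / G b) * ((ennreal (G t) * H t) * indicator S t)"
    proof (cases "t \<in> S \<and> b \<le> t")
      case True
      then have "ennreal 1 \<le> ennreal ((1 / G b) * G t)" using G(3)[of t] G(4) by (intro ennreal_leI) auto
      also have "\<dots> = ennreal (1 / G b) * ennreal (G t)" using G(2)[of t] G(4) True by (intro ennreal_mult) auto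
      finally have "1 * H t \<le> (ennreal (1 / G b) * ennreal (G t)) * H t" by (intro mult_right_mono) auto
      then have "H t * indicator S t \<le> ennreal (1 / G b) * ((ennreal (G t) * H t) * indicator S t)"
        using True by (simp add: mult.assoc)
      then show ?thesis by (rule order_trans) (simp add: add_increasing)
    next
      case False
      then have "H t * indicator S t \<le> H t * indicator {T..b} t" by (auto simp: indicator_def mem_ivl)
      then show ?thesis by (rule order_trans) (simp add: add_increasing2)
    qed
  qed
  also have "\<dots> = (\<integral>\<^sup>+t. H t * indicator {T..b} t \<partial>lborel)
     + ennreal (1 / G b) * (\<integral>\<^sup>+t. (ennreal (G t) * H t) * indicator S t \<partial>lborel)"
    by (subst nn_integral_add) (auto simp: nn_integral_cmult)
  also have "\<dots> < \<infinity>" using f fin by (simp add: ennreal_mult_less_top)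
  finally show "(\<integral>\<^sup>+t. H t * indicator S t \<partial>lborel) < \<infinity>" .
next
  assume f: "(\<integral>\<^sup>+t. H t * indicator S t \<partial>lborel) < \<infinity>"
  have "(\<integral>\<^sup>+t. (ennreal (G t) * H t) * indicator S t \<partial>lborel) \<le> (\<integral>\<^sup>+t. ennreal C * (H t * indicator S t) \<partial>lborel)"
    using G(2) by (intro nn_integral_mono) (auto simp: indicator_def intro!: mult_right_mono ennreal_leI)
  also have "\<dots> = ennreal C * (\<integral>\<^sup>+t. H t * indicator S t \<partial>lborel)"
    by (rule nn_integral_cmult) auto
  also have "\<dots> < \<infinity>" using f by (simp add: ennreal_mult_less_top)
  finally show "(\<integral>\<^sup>+t. (ennreal (G t) * H t) * indicator S t \<partial>lborel) < \<infinity>" .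
qed

end

subsection \<open>Asymptotic expansions\<close>

context wronskian_system begin

text \<open>Both \<open>e * a + r\<close> and \<open>e * a - r\<close> increase to 0 near the end
  point and are therefore nonpositive there.\<close>

lemma bound_integrate:
  assumes q: "\<And>x. x \<in> S \<Longrightarrow> 0 < q x"
    and dr: "\<And>x. x \<in> S \<Longrightarrow> (r has_real_derivative \<rho> x / q x) (at x within S)"
    and da: "\<And>x. x \<in> S \<Longrightarrow> (a has_real_derivative \<alpha> x / q x) (at x within S)"
    and lim: "(r \<longlongrightarrow> 0) F" "(a \<longlongrightarrow> 0) F"
    and e: "0 < e" and le: "eventually (\<lambda>x. \<bar>\<rho> x\<bar> \<le> e * \<alpha> x) F"
  shows "eventually (\<lambda>x. \<bar>r x\<bar> \<le> e * \<bar>a x\<bar>) F"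
proof -
  obtain t where t: "t \<in> S" "\<And>x. x \<in> S \<Longrightarrow> t < x \<Longrightarrow> \<bar>\<rho> x\<bar> \<le> e * \<alpha> x"
    using eventually_upto[OF le] by metis
  have nonpos: "e * a x + s * r x \<le> 0" if x: "x \<in> S" "t < x" and s: "\<bar>s\<bar> = 1" for x s
  proof (rule nonpos_of_increasing_to_zero(1)[where d = "\<lambda>x. e * (\<alpha> x / q x) + s * (\<rho> x / q x)", OF _ _ t(1) x])
    show "((\<lambda>x. e * a x + s * r x) \<longlongrightarrow> 0) F"
      using tendsto_add[OF tendsto_mult_left[OF lim(2), of e] tendsto_mult_left[OF lim(1), of s]] by simp
    show "((\<lambda>x. e * a x + s * r x) has_real_derivative e * (\<alpha> x / q x) + s * (\<rho> x / q x)) (at x within S)"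
      if "x \<in> S" for x using that by (intro DERIV_add DERIV_cmult da dr)
    show "0 \<le> e * (\<alpha> x / q x) + s * (\<rho> x / q x)" if "x \<in> S" "t < x" for x
    proof -
      have "\<bar>s * \<rho> x\<bar> \<le> e * \<alpha> x" using t(2)[OF that] s by (simp add: abs_mult)
      then have "0 \<le> (e * \<alpha> x + s * \<rho> x) / q x" using q[OF that(1)] by (intro divide_nonneg_pos) auto
      then show ?thesis by (simp add: add_divide_distrib)
    qed
  qed
  show ?thesis using eventually_greater[OF t(1)]
  proof eventually_elim
    case (elim x)
    have "e * a x + r x \<le> 0" "e * a x - r x \<le> 0" using nonpos[of x 1] nonpos[of x "-1"] elim by auto
    moreover have "- (e * a x) \<le> e * \<bar>a x\<bar>" using e by (metis abs_ge_minus_self abs_mult abs_of_pos)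
    ultimately show ?case by linarith
  qed
qed

text \<open>L'Hopital's rule for functions tending to 0, the direction opposite to
  \<open>ratio_step\<close>.\<close>

lemma ratio_integrate:
  assumes q: "\<And>x. x \<in> S \<Longrightarrow> 0 < q x"
    and dr: "\<And>x. x \<in> S \<Longrightarrow> (r has_real_derivative \<rho> x / q x) (at x within S)"
    and da: "\<And>x. x \<in> S \<Longrightarrow> (a has_real_derivative \<alpha> x / q x) (at x within S)"
    and lim: "(r \<longlongrightarrow> 0) F" "(a \<longlongrightarrow> 0) F"
    and \<alpha>: "eventually (\<lambda>x. 0 < \<alpha> x) F \<or> eventually (\<lambda>x. \<alpha> x < 0) F"
    and a: "eventually (\<lambda>x. a x \<noteq> 0) F" and ratio: "((\<lambda>x. \<rho> x / \<alpha> x) \<longlongrightarrow> 0) F"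
  shows "((\<lambda>x. r x / a x) \<longlongrightarrow> 0) F"
  unfolding tendsto_iff
proof (intro allI impI)
  fix e :: real assume "e > 0"
  then have e2: "e / 2 > 0" by simp
  have small: "eventually (\<lambda>x. \<bar>\<rho> x / \<alpha> x\<bar> < e / 2) F"
    using tendstoD[OF ratio e2] by (simp add: dist_real_def)
  have "eventually (\<lambda>x. \<bar>r x\<bar> \<le> e / 2 * \<bar>a x\<bar>) F"
    using \<alpha>
  proof
    assume pos: "eventually (\<lambda>x. 0 < \<alpha> x) F"
    have le: "eventually (\<lambda>x. \<bar>\<rho> x\<bar> \<le> e / 2 * \<alpha> x) F"
      using small pos by eventually_elim (simp add: abs_divide divide_less_eq)
    show ?thesis by (rule bound_integrate[OF q dr da lim e2 le])
  next
    assume neg: "eventually (\<lambda>x. \<alpha> x < 0) F"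
    have "eventually (\<lambda>x. \<bar>\<rho> x\<bar> \<le> e / 2 * (- \<alpha> x)) F"
      using small neg
    proof eventually_elim
      case (elim x)
      then have "\<bar>\<rho> x\<bar> / (- \<alpha> x) < e / 2" by (simp add: abs_divide)
      then show ?case using elim by (simp only: divide_less_eq) simp
    qed
    moreover have "((\<lambda>x. - a x) has_real_derivative - \<alpha> x / q x) (at x within S)" if "x \<in> S" for x
      using DERIV_minus[OF da[OF that]] by simp
    moreover have "((\<lambda>x. - a x) \<longlongrightarrow> 0) F" using tendsto_minus[OF lim(2)] by simp
    ultimately show ?thesis
      using bound_integrate[OF q dr _ lim(1) _ e2, where a = "\<lambda>x. - a x" and \<alpha> = "\<lambda>x. - \<alpha> x"] by simp
  qed
  then show "eventually (\<lambda>x. dist (r x / a x) 0 < e) F"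
    using a
  proof eventually_elim
    case (elim x)
    have "\<bar>r x\<bar> / \<bar>a x\<bar> \<le> e / 2" using elim by (subst divide_le_eq) simp
    then have "\<bar>r x\<bar> / \<bar>a x\<bar> < e" using \<open>e > 0\<close> by linarith
    then show ?case by (simp add: dist_real_def abs_divide)
  qed
qed

end

section \<open>Comparison of the two chains\<close>

context chebyshev_scale begin

sublocale reverse: wronskian_system T x0 n "\<lambda>j. \<phi> (Suc n - j)"
  by (rule reverse_system)

text \<open>Both operators have leading coefficient 1 and annihilate every \<open>\<phi> i\<close>,
  so they agree as functionals of the jet by \<open>jets_independent\<close>; the sign of the
  reversing permutation never enters. The argument is algebraic and holds at every x of the
  interval, even where derivatives of order n do not exist.\<close>

lemma Lop_reverse:
  assumes x: "x \<in> S"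
  shows "Lop S (\<lambda>j. \<phi> (Suc n - j)) n u x = Lop S \<phi> n u x"
proof -
  let ?\<psi> = "\<lambda>j. \<phi> (Suc n - j)"
  define d where "d j = wcoeff S \<phi> n j x / Wf S \<phi> n x - wcoeff S ?\<psi> n j x / Wf S ?\<psi> n x" for j
  have nz: "Wf S \<phi> n x \<noteq> 0" "Wf S ?\<psi> n x \<noteq> 0"
    using W_nz[OF order_refl x] reverse.W_nz[OF order_refl x] by auto
  have top: "d n = 0" using nz by (simp add: d_def wcoeff_top)
  have "d j = 0" if "j < n" for j
  proof (rule jets_independent[OF nz(1) _ that])
    fix i assume i: "1 \<le> i" "i \<le> n"
    have "(\<Sum>j<n. d j * hder S j (\<phi> i) x) = (\<Sum>j\<le>n. d j * hder S j (\<phi> i) x)"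
      using top by (simp add: lessThan_Suc_atMost[symmetric])
    also have "\<dots> = (\<Sum>j\<le>n. wcoeff S \<phi> n j x * hder S j (\<phi> i) x) / Wf S \<phi> n x
       - (\<Sum>j\<le>n. wcoeff S ?\<psi> n j x * hder S j (?\<psi> (Suc n - i)) x) / Wf S ?\<psi> n x"
      using i by (simp add: d_def left_diff_distrib sum_subtractf sum_divide_distrib)
    also have "\<dots> = 0"
      using wcoeff_annihilates[OF i, of S \<phi> x] wcoeff_annihilates[of "Suc n - i" n S ?\<psi> x] i by simp
    finally show "(\<Sum>j<n. d j * hder S j (\<phi> i) x) = 0" .
  qed
  then have d0: "d j = 0" if "j \<le> n" for j using that top by (cases "j = n") auto
  have "Lop S \<phi> n u x - Lop S ?\<psi> n u x = (\<Sum>j\<le>n. d j * hder S j u x)"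
    unfolding Lop_eq reverse.Lop_eq by (simp add: d_def left_diff_distrib sum_subtractf sum_divide_distrib)
  also have "\<dots> = 0" using d0 by simp
  finally show ?thesis by simp
qed

lemma B_bounded: "k < n \<Longrightarrow> \<exists>C. \<forall>t\<in>S. B k t \<le> C"
proof (induction k)
  case (Suc k)
  then obtain C where C: "\<And>t. t \<in> S \<Longrightarrow> B k t \<le> C" by auto
  have C0: "0 \<le> C" using C[OF T_in] B_nonneg[OF _ T_in, of k] Suc.prems by simp
  \<comment> \<open>The sign makes the derivative of V equal to
    \<open>1 / qw S \<phi> n (Suc k)\<close>, since \<open>M (Suc k) (\<phi> (Suc (Suc k)))\<close>
    is the constant \<open>\<sigma> (Suc k)\<close> of square 1. As V increases to 0, the integral
    of this derivative from T is at most \<open>- V T\<close>.\<close>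
  define V where "V x = \<sigma> (Suc k) * M k (\<phi> (Suc (Suc k))) x" for x
  have q: "0 < qw S \<phi> n (Suc k) x" if "x \<in> S" for x using qw_pos[OF _ that] Suc.prems by simp
  have dV: "(V has_real_derivative 1 / qw S \<phi> n (Suc k) x) (at x within S)" if x: "x \<in> S" for x
  proof -
    have "\<sigma> (Suc k) * \<sigma> (Suc k) = 1" using \<sigma>_abs[OF Suc.prems] by (metis abs_mult_self_eq mult_1)
    moreover have "M (Suc k) (\<phi> (Suc (Suc k))) x = \<sigma> (Suc k)" by (rule M_basis_one[OF Suc.prems x])
    moreover have "(V has_real_derivative \<sigma> (Suc k) * (M (Suc k) (\<phi> (Suc (Suc k))) x / qw S \<phi> n (Suc k) x)) (at x within S)"
      unfolding V_def by (intro DERIV_cmult M_derivative AC) (use Suc.prems x in auto)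
    ultimately show ?thesis by (metis times_divide_eq_right)
  qed
  have limV: "(V \<longlongrightarrow> 0) F"
    unfolding V_def using tendsto_mult_left[OF M_limit[of k "Suc (Suc k)"], of "\<sigma> (Suc k)"] Suc.prems by simp
  show ?case
  \<comment> \<open>The maximum with 0 covers \<open>t = T\<close>, where the kernel vanishes,
    without a statement on the sign of \<open>V T\<close>.\<close>
  proof (intro exI[of _ "max 0 (- (C * V T))"] ballI)
    fix t assume t: "t \<in> S"
    show "B (Suc k) t \<le> max 0 (- (C * V T))"
    proof (cases "t = T")
      case False
      then have Tt: "T < t" using t by (simp add: mem_ivl)
      have "V t \<le> 0"
        by (rule nonpos_of_increasing_to_zero(1)[OF dV limV T_in t Tt]) (use q in \<open>auto intro: less_imp_le\<close>)
      have dW: "((\<lambda>x. B (Suc k) x - C * V x) has_real_derivative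
          B k z / qw S \<phi> n (Suc k) z - C * (1 / qw S \<phi> n (Suc k) z)) (at z within S)" if "z \<in> S" for z
        by (intro DERIV_diff DERIV_cmult B_derivative[OF Suc.prems] dV that)
      obtain z where z: "T < z" "z < t" "z \<in> S" "(B (Suc k) t - C * V t) - (B (Suc k) T - C * V T)
         = (t - T) * (B k z / qw S \<phi> n (Suc k) z - C * (1 / qw S \<phi> n (Suc k) z))"
        by (rule mean_value_ivl[OF T_in t Tt dW])
      have "B k z / qw S \<phi> n (Suc k) z - C * (1 / qw S \<phi> n (Suc k) z) = (B k z - C) / qw S \<phi> n (Suc k) z"
        by (simp add: diff_divide_distrib)
      also have "\<dots> \<le> 0" using C[OF z(3)] q[OF z(3)] by (intro divide_nonpos_pos) auto
      finally have "(t - T) * (B k z / qw S \<phi> n (Suc k) z - C * (1 / qw S \<phi> n (Suc k) z)) \<le> 0"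
        using Tt by (intro mult_nonneg_nonpos) auto
      then have "B (Suc k) t \<le> C * V t - C * V T" using z(4) B_T[of k] by linarith
      moreover have "C * V t \<le> 0" using C0 \<open>V t \<le> 0\<close> by (rule mult_nonneg_nonpos)
      ultimately show ?thesis by linarith
    qed simp
  qed
qed auto

lemma sum_reverse: "(\<Sum>i=1..n. g (Suc n - i)) = (\<Sum>i=1..n. g i)" for g :: "nat \<Rightarrow> real"
  by (rule sum.reindex_bij_betw, rule bij_betw_byWitness[where f' = "\<lambda>i. Suc n - i"]) auto

lemma \<phi>n_nz: "x \<in> S \<Longrightarrow> \<phi> n x \<noteq> 0"
  using reverse.\<phi>1_nz[of x] by simp

text \<open>Both kernels are the value at \<open>T\<close>, up to the normalisation by \<open>\<phi>\<^sub>1\<close> resp. \<open>\<phi>\<^sub>n\<close>, of the same solution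
  with vanishing jet of order \<open>n - 1\<close> at \<open>t\<close>.\<close>

lemma kernels_proportional:
  assumes t: "t \<in> S"
  shows "reverse.B (n - 1) t / qw S (\<lambda>j. \<phi> (Suc n - j)) n n t
    = \<bar>\<phi> 1 T\<bar> / \<bar>\<phi> n T\<bar> * (B (n - 1) t / qw S \<phi> n n t)"
proof -
  obtain c where c: "\<And>j. j < n \<Longrightarrow> (\<Sum>i=1..n. c i * hder S j (\<phi> i) t) = (if j = n - 1 then 1 else 0)"
    using combination_with_prescribed_jet[OF W_nz[OF order_refl t], of "n - 1"] n2 by auto
  have 1: "\<bar>\<Sum>i=1..n. c i * \<phi> i T\<bar> / \<bar>\<phi> 1 T\<bar> = B (n - 1) t / qw S \<phi> n n t"
    by (rule kernel_value[OF t c])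
  have "\<bar>\<Sum>i=1..n. c (Suc n - i) * \<phi> (Suc n - i) T\<bar> / \<bar>\<phi> (Suc n - 1) T\<bar>
      = reverse.B (n - 1) t / qw S (\<lambda>j. \<phi> (Suc n - j)) n n t"
  proof (rule reverse.kernel_value[OF t])
    show "(\<Sum>i=1..n. c (Suc n - i) * hder S j (\<phi> (Suc n - i)) t) = (if j = n - 1 then 1 else 0)" if "j < n" for j
      using c[OF that] sum_reverse[of "\<lambda>i. c i * hder S j (\<phi> i) t"] by simp
  qed
  then have 2: "\<bar>\<Sum>i=1..n. c i * \<phi> i T\<bar> / \<bar>\<phi> n T\<bar> = reverse.B (n - 1) t / qw S (\<lambda>j. \<phi> (Suc n - j)) n n t"
    using sum_reverse[of "\<lambda>i. c i * \<phi> i T"] by simp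
  show ?thesis unfolding 1[symmetric] 2[symmetric] using \<phi>1_nz[OF T_in] by simp
qed

text \<open>Conditions (a) and (b) are equal integrals, and both are \<kappa> times J, the
  corresponding integral for the weights q. J is finite together with the integral in (c), because
  its kernel is bounded above and, away from T, bounded below by a positive number.\<close>

theorem integral_conditions:
  assumes f: "AC_on S (n - 1) f"
  shows "iterA (pw S \<phi> n) (Lop S \<phi> n f) n x0 (n - 1) T = reverse.A f (n - 1) T"
    and "iterA (pw S \<phi> n) (Lop S \<phi> n f) n x0 (n - 1) T =
      (\<integral>\<^sup>+t. (iterB (pw S \<phi> n) T (n - 1) t * ennreal (\<bar>Lop S \<phi> n f t\<bar> / pw S \<phi> n n t)) * indicator S t \<partial>lborel)"
    and "iterA (pw S \<phi> n) (Lop S \<phi> n f) n x0 (n - 1) T < \<infinity> \<longleftrightarrow>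
      (\<integral>\<^sup>+t. ennreal (\<bar>Lop S \<phi> n f t\<bar> / qw S \<phi> n n t) * indicator S t \<partial>lborel) < \<infinity>"
    and "iterA (pw S \<phi> n) (Lop S \<phi> n f) n x0 (n - 1) T < \<infinity> \<longleftrightarrow> A f (n - 1) T < \<infinity>"
proof -
  let ?\<psi> = "\<lambda>j. \<phi> (Suc n - j)"
  let ?L = "Lop S \<phi> n f"
  let ?Ap = "iterA (pw S \<phi> n) ?L n x0 (n - 1) T"
  have pq: "pw S \<phi> n i = qw S ?\<psi> n i" if "i \<le> n" for i
    using pw_eq_qw[OF that] by (simp add: fun_eq_iff)
  show A1: "?Ap = reverse.A f (n - 1) T"
    by (rule iterA_cong) (use pq Lop_reverse n2 in auto)
  obtain h where h: "h \<in> borel_measurable borel"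
    "AE t in lborel. t \<in> S \<longrightarrow> \<bar>?L t\<bar> / qw S \<phi> n n t = \<bar>h t\<bar>"
    "\<And>x y. x \<in> S \<Longrightarrow> y \<in> S \<Longrightarrow> x \<le> y \<Longrightarrow>
      (\<integral>\<^sup>+t. ennreal \<bar>h t\<bar> * indicator {x..y} t \<partial>lborel) < \<infinity>"
    by (rule M_last_density[OF f]) (rule that)
  obtain h' where h': "h' \<in> borel_measurable borel"
    "AE t in lborel. t \<in> S \<longrightarrow> \<bar>Lop S ?\<psi> n f t\<bar> / qw S ?\<psi> n n t = \<bar>h' t\<bar>"
    by (rule reverse.M_last_density[OF f]) (rule that)
  define H where "H t = ennreal \<bar>h t\<bar>" for t
  have Hm[measurable]: "H \<in> borel_measurable borel" unfolding H_def using h(1) by measurable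
  define J where "J = (\<integral>\<^sup>+t. (ennreal (B (n - 1) t) * H t) * indicator S t \<partial>lborel)"
  have n1: "1 \<le> n" "n - 1 < n" using n2 by auto
  have Aq: "A f (n - 1) T = J"
  proof -
    have "A f (n - 1) T = (\<integral>\<^sup>+t. (iterB (qw S \<phi> n) T (n - 1) t * ennreal (\<bar>?L t\<bar> / qw S \<phi> n n t)) * indicator S t \<partial>lborel)"
    proof (rule iterA_eq_integral_iterB[OF T_less n1(1) _ _ Hm])
      show "AE t in lborel. t \<in> S \<longrightarrow> ennreal (\<bar>?L t\<bar> / qw S \<phi> n n t) = H t"
        using h(2) by eventually_elim (simp add: H_def)
    qed (use qw_continuous qw_pos in auto)
    also have "\<dots> = J"
      unfolding J_def
    proof (rule nn_integral_cong_AE)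
      show "AE t in lborel. iterB (qw S \<phi> n) T (n - 1) t * ennreal (\<bar>?L t\<bar> / qw S \<phi> n n t) * indicator S t
         = ennreal (B (n - 1) t) * H t * indicator S t"
        using h(2) by eventually_elim (use iterB_eq_B[OF n1(2)] in \<open>auto simp: H_def indicator_def\<close>)
    qed
    finally show ?thesis .
  qed
  have Ap: "reverse.A f (n - 1) T = (\<integral>\<^sup>+t. (iterB (qw S ?\<psi> n) T (n - 1) t *
      ennreal (\<bar>Lop S ?\<psi> n f t\<bar> / qw S ?\<psi> n n t)) * indicator S t \<partial>lborel)"
  proof (rule iterA_eq_integral_iterB[OF T_less n1(1), of _ "\<lambda>t. ennreal \<bar>h' t\<bar>"])
    show "AE t in lborel. t \<in> S \<longrightarrow> ennreal (\<bar>Lop S ?\<psi> n f t\<bar> / qw S ?\<psi> n n t) = ennreal \<bar>h' t\<bar>"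
      using h'(2) by eventually_elim simp
    show "(\<lambda>t. ennreal \<bar>h' t\<bar>) \<in> borel_measurable borel" using h'(1) by measurable
  qed (use reverse.qw_continuous reverse.qw_pos in auto)
  show "?Ap = (\<integral>\<^sup>+t. (iterB (pw S \<phi> n) T (n - 1) t * ennreal (\<bar>?L t\<bar> / pw S \<phi> n n t)) * indicator S t \<partial>lborel)"
    unfolding A1 Ap
  proof (rule nn_integral_cong)
    fix t
    have "iterB (pw S \<phi> n) T (n - 1) t = iterB (qw S ?\<psi> n) T (n - 1) t"
      by (rule iterB_cong[of n]) (use pq in auto)
    then show "iterB (qw S ?\<psi> n) T (n - 1) t * ennreal (\<bar>Lop S ?\<psi> n f t\<bar> / qw S ?\<psi> n n t) * indicator S t
      = iterB (pw S \<phi> n) T (n - 1) t * ennreal (\<bar>?L t\<bar> / pw S \<phi> n n t) * indicator S t"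
      using Lop_reverse[of t f] pq[of n] by (cases "t \<in> S") auto
  qed
  define \<kappa> where "\<kappa> = \<bar>\<phi> 1 T\<bar> / \<bar>\<phi> n T\<bar>"
  have \<kappa>: "0 < \<kappa>" using \<phi>1_nz[OF T_in] \<phi>n_nz[OF T_in] by (simp add: \<kappa>_def)
  have Bm: "(\<lambda>t. (ennreal (B (n - 1) t) * H t) * indicator S t) \<in> borel_measurable borel"
    using borel_measurable_times_ennreal[OF borel_measurable_ennreal_indicator_ivl[OF B_continuous[OF n1(2)]] Hm]
    by (simp add: mult_ac)
  have "?Ap = (\<integral>\<^sup>+t. ennreal \<kappa> * ((ennreal (B (n - 1) t) * H t) * indicator S t) \<partial>lborel)"
    unfolding A1 Ap
  proof (rule nn_integral_cong_AE)
    show "AE t in lborel. iterB (qw S ?\<psi> n) T (n - 1) t * ennreal (\<bar>Lop S ?\<psi> n f t\<bar> / qw S ?\<psi> n n t) * indicator S t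
       = ennreal \<kappa> * ((ennreal (B (n - 1) t) * H t) * indicator S t)"
      using h(2)
    proof eventually_elim
      case (elim t)
      show ?case
      proof (cases "t \<in> S")
        case True
        have nonneg: "0 \<le> reverse.B (n - 1) t" "0 \<le> B (n - 1) t"
          using reverse.B_nonneg[OF n1(2) True] B_nonneg[OF n1(2) True] by auto
        have qp: "0 < qw S ?\<psi> n n t" using reverse.qw_pos[OF order_refl True] .
        have "iterB (qw S ?\<psi> n) T (n - 1) t * ennreal (\<bar>Lop S ?\<psi> n f t\<bar> / qw S ?\<psi> n n t)
           = ennreal (reverse.B (n - 1) t * (\<bar>?L t\<bar> / qw S ?\<psi> n n t))"
          using reverse.iterB_eq_B[OF n1(2) True] Lop_reverse[OF True, of f] nonneg qp
          by (simp add: ennreal_mult del: times_divide_eq_right)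
        also have "reverse.B (n - 1) t * (\<bar>?L t\<bar> / qw S ?\<psi> n n t) = reverse.B (n - 1) t / qw S ?\<psi> n n t * \<bar>?L t\<bar>"
          by simp
        also have "\<dots> = \<kappa> * (B (n - 1) t * (\<bar>?L t\<bar> / qw S \<phi> n n t))"
          unfolding kernels_proportional[OF True] \<kappa>_def by simp
        also have "\<dots> = \<kappa> * (B (n - 1) t * \<bar>h t\<bar>)" using elim True by simp
        also have "ennreal \<dots> = ennreal \<kappa> * (ennreal (B (n - 1) t) * ennreal \<bar>h t\<bar>)"
          using \<kappa> nonneg by (simp add: ennreal_mult)
        finally show ?thesis using True by (simp add: H_def)
      qed simp
    qed
  qed
  also have "\<dots> = ennreal \<kappa> * J"
    unfolding J_def by (rule nn_integral_cmult) (use Bm in simp)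
  finally have ApJ: "?Ap = ennreal \<kappa> * J" .
  have ApJ': "?Ap < \<infinity> \<longleftrightarrow> J < \<infinity>"
    unfolding ApJ using \<kappa> by (auto simp: ennreal_mult_less_top ennreal_eq_0_iff)
  then show "?Ap < \<infinity> \<longleftrightarrow> A f (n - 1) T < \<infinity>" unfolding Aq .
  obtain b where b: "b \<in> S" "T < b" using ivl_greater[OF T_in] by blast
  obtain C where C: "\<And>t. t \<in> S \<Longrightarrow> B (n - 1) t \<le> C" using B_bounded[OF n1(2)] by blast
  have "J < \<infinity> \<longleftrightarrow> (\<integral>\<^sup>+t. H t * indicator S t \<partial>lborel) < \<infinity>"
    unfolding J_def
  proof (rule finite_weighted_integral_iff[OF Hm b(1) B_continuous[OF n1(2)]])
    show "0 \<le> B (n - 1) t \<and> B (n - 1) t \<le> C" if "t \<in> S" for t using B_nonneg[OF n1(2) that] C[OF that] by simp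
    show "B (n - 1) b \<le> B (n - 1) t" if "t \<in> S" "b \<le> t" for t by (rule B_mono[OF n1(2) b(1) that])
    show "0 < B (n - 1) b" by (rule B_pos[OF n1(2) b])
    show "(\<integral>\<^sup>+t. H t * indicator {T..b} t \<partial>lborel) < \<infinity>"
      unfolding H_def using h(3)[OF T_in b(1)] b(2) by simp
  qed
  also have "(\<integral>\<^sup>+t. H t * indicator S t \<partial>lborel) = (\<integral>\<^sup>+t. ennreal (\<bar>?L t\<bar> / qw S \<phi> n n t) * indicator S t \<partial>lborel)"
  proof (rule nn_integral_cong_AE)
    show "AE t in lborel. H t * indicator S t = ennreal (\<bar>?L t\<bar> / qw S \<phi> n n t) * indicator S t"
      using h(2) by eventually_elim (auto simp: H_def indicator_def)
  qed
  finally show "?Ap < \<infinity> \<longleftrightarrow> (\<integral>\<^sup>+t. ennreal (\<bar>?L t\<bar> / qw S \<phi> n n t) * indicator S t \<partial>lborel) < \<infinity>"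
    using ApJ' by simp
qed

text \<open>At level \<open>n - 1\<close> the denominator is a nonzero constant. L'Hopital's rule
  then carries the limit down the chain, since for \<open>k < n - 1\<close> both numerator and
  denominator tend to 0.\<close>

lemma remainder_ratio:
  assumes u: "AC_on S (n - 1) u" and lim: "\<And>k. k < n \<Longrightarrow> (M k u \<longlongrightarrow> 0) F" and "k < n"
  shows "((\<lambda>x. M k u x / M k (\<phi> n) x) \<longlongrightarrow> 0) F"
proof -
  have "k \<le> n - 1" using \<open>k < n\<close> by simp
  then show ?thesis
  proof (induction k rule: inc_induct)
    case base
    have "((\<lambda>x. M (n - 1) u x / \<sigma> (n - 1)) \<longlongrightarrow> 0) F"
      using tendsto_divide[OF lim[of "n - 1"] tendsto_const[of "\<sigma> (n - 1)"]] \<sigma>_nz[of "n - 1"] n2 by simp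
    moreover have "eventually (\<lambda>x. M (n - 1) u x / \<sigma> (n - 1) = M (n - 1) u x / M (n - 1) (\<phi> n) x) F"
      using eventually_S
    proof eventually_elim
      case (elim x)
      then show ?case using M_basis_one[of "n - 1" x] n2 by simp
    qed
    ultimately show ?case by (rule Lim_transform_eventually)
  next
    case (step k)
    then have k: "Suc k < n" by simp
    show ?case
    proof (rule ratio_integrate[where q = "qw S \<phi> n (Suc k)" and \<rho> = "M (Suc k) u" and \<alpha> = "M (Suc k) (\<phi> n)"])
      show "0 < qw S \<phi> n (Suc k) x" if "x \<in> S" for x using qw_pos[OF _ that] k by simp
      show "(M k u has_real_derivative M (Suc k) u x / qw S \<phi> n (Suc k) x) (at x within S)" if "x \<in> S" for x
        by (rule M_derivative[OF k u that])
      show "(M k (\<phi> n) has_real_derivative M (Suc k) (\<phi> n) x / qw S \<phi> n (Suc k) x) (at x within S)" if "x \<in> S" for x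
        using M_derivative[OF k AC that] n2 by simp
      show "(M k u \<longlongrightarrow> 0) F" using lim k by simp
      show "(M k (\<phi> n) \<longlongrightarrow> 0) F" using M_limit[of k n] k by simp
      show "eventually (\<lambda>x. 0 < M (Suc k) (\<phi> n) x) F \<or> eventually (\<lambda>x. M (Suc k) (\<phi> n) x < 0) F"
        by (rule eventually_nonzero_M_basis[OF k order_refl])
      show "eventually (\<lambda>x. M k (\<phi> n) x \<noteq> 0) F" using eventually_nonzero_M_basis'[of k n] k by simp
    qed (rule step.IH)
  qed
qed

lemma M_0_ratio:
  "eventually (\<lambda>x. M 0 u x / M 0 v x = u x / v x) F"
  using eventually_S
proof eventually_elim
  case (elim x)
  then show ?case using qw_pos[of 0 x] by simp
qed

lemma basis_eventually_nonzero: "1 \<le> j \<Longrightarrow> j \<le> n \<Longrightarrow> eventually (\<lambda>x. \<phi> j x \<noteq> 0) F"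
  using eventually_nonzero_M_basis'[of 0 j] by (auto elim!: eventually_mono)

lemma basis_ratio:
  assumes "1 \<le> k" "k < j" "j \<le> n"
  shows "((\<lambda>x. \<phi> j x / \<phi> k x) \<longlongrightarrow> 0) F"
proof -
  have "Suc k \<le> j" using assms by simp
  then show ?thesis using assms(3)
  proof (induction rule: dec_induct)
    case base
    then show ?case using scale[of k] assms by simp
  next
    case (step j)
    then have l: "((\<lambda>x. \<phi> (Suc j) x / \<phi> j x * (\<phi> j x / \<phi> k x)) \<longlongrightarrow> 0) F"
      using tendsto_mult[OF scale[of j] step.IH] by simp
    have "eventually (\<lambda>x. \<phi> (Suc j) x / \<phi> j x * (\<phi> j x / \<phi> k x) = \<phi> (Suc j) x / \<phi> k x) F"
      using basis_eventually_nonzero[of j] step by (auto elim!: eventually_mono)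
    with l show ?case by (rule Lim_transform_eventually)
  qed
qed

text \<open>Divided by \<open>\<phi> k\<close> instead, with k the least index of a nonzero
  coefficient, the sum tends to \<open>d k\<close>; but this limit is also 0, because
  \<open>\<phi> n / \<phi> k\<close> converges.\<close>

lemma coefficients_unique:
  assumes l: "((\<lambda>x. (\<Sum>j=1..n. d j * \<phi> j x) / \<phi> n x) \<longlongrightarrow> 0) F" and "i \<in> {1..n}"
  shows "d i = 0"
proof (rule ccontr)
  assume "d i \<noteq> 0"
  define k where "k = (LEAST i. i \<in> {1..n} \<and> d i \<noteq> 0)"
  have "k \<in> {1..n} \<and> d k \<noteq> 0"
    unfolding k_def by (rule LeastI[of _ i]) (use \<open>d i \<noteq> 0\<close> assms(2) in simp)
  then have k: "1 \<le> k" "k \<le> n" "d k \<noteq> 0" by auto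
  have kmin: "d i = 0" if "i \<in> {1..n}" "i < k" for i
    using not_less_Least[of i "\<lambda>i. i \<in> {1..n} \<and> d i \<noteq> 0"] that unfolding k_def by blast
  have nzk: "eventually (\<lambda>x. \<phi> k x \<noteq> 0) F" by (rule basis_eventually_nonzero[OF k(1,2)])
  have "((\<lambda>x. \<Sum>j=1..n. d j * (\<phi> j x / \<phi> k x)) \<longlongrightarrow> (\<Sum>j=1..n. if j = k then d k else 0)) F"
  proof (rule tendsto_sum)
    fix j assume j: "j \<in> {1..n}"
    consider "j < k" | "j = k" | "k < j" by linarith
    then show "((\<lambda>x. d j * (\<phi> j x / \<phi> k x)) \<longlongrightarrow> (if j = k then d k else 0)) F"
    proof cases
      case 1
      then show ?thesis using kmin[OF j] by simp
    next
      case 2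
      have "eventually (\<lambda>x. d k = d j * (\<phi> j x / \<phi> k x)) F"
        using nzk by eventually_elim (simp add: 2)
      from Lim_transform_eventually[OF tendsto_const this] show ?thesis using 2 by simp
    next
      case 3
      then show ?thesis using tendsto_mult_left[OF basis_ratio[OF k(1) 3], of "d j"] j by simp
    qed
  qed
  then have 1: "((\<lambda>x. \<Sum>j=1..n. d j * (\<phi> j x / \<phi> k x)) \<longlongrightarrow> d k) F" using k by simp
  have "\<exists>c. ((\<lambda>x. \<phi> n x / \<phi> k x) \<longlongrightarrow> c) F"
  proof (cases "k = n")
    case True
    have "eventually (\<lambda>x. 1 = \<phi> n x / \<phi> k x) F" using nzk by eventually_elim (simp add: True)
    from Lim_transform_eventually[OF tendsto_const this] show ?thesis by blast
  next
    case False
    then show ?thesis using basis_ratio[OF k(1), of n] k by auto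
  qed
  then obtain c where c: "((\<lambda>x. \<phi> n x / \<phi> k x) \<longlongrightarrow> c) F" by blast
  have 2: "((\<lambda>x. (\<Sum>j=1..n. d j * \<phi> j x) / \<phi> n x * (\<phi> n x / \<phi> k x)) \<longlongrightarrow> 0) F"
    using tendsto_mult[OF l c] by simp
  have "eventually (\<lambda>x. (\<Sum>j=1..n. d j * \<phi> j x) / \<phi> n x * (\<phi> n x / \<phi> k x) = (\<Sum>j=1..n. d j * (\<phi> j x / \<phi> k x))) F"
  proof -
    have "eventually (\<lambda>x. \<phi> n x \<noteq> 0) F" using basis_eventually_nonzero[of n] n2 by simp
    then show ?thesis
    proof eventually_elim
      case (elim x)
      then have "(\<Sum>j=1..n. d j * \<phi> j x) / \<phi> n x * (\<phi> n x / \<phi> k x) = (\<Sum>j=1..n. d j * \<phi> j x) / \<phi> k x" by simp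
      then show ?case by (simp add: sum_divide_distrib)
    qed
  qed
  from Lim_transform_eventually[OF 2 this] have "d k = 0"
    using tendsto_unique[OF F_nontrivial 1] by blast
  then show False using k(3) by simp
qed

theorem asymptotic_expansions:
  assumes f: "AC_on S (n - 1) f"
    and fin: "iterA (pw S \<phi> n) (Lop S \<phi> n f) n x0 (n - 1) T < \<infinity>"
  shows "\<exists>a :: nat \<Rightarrow> real. (\<lambda>x. f x - (\<Sum>j=1..n. a j * \<phi> j x)) \<in> o[at_end x0](\<phi> n)
    \<and> (\<forall>k\<in>{1..n-1}. ((\<lambda>x. wop S (pw S \<phi> n) k f x
          - (\<Sum>j=1..n-k. a j * wop S (pw S \<phi> n) k (\<phi> j) x)) \<longlongrightarrow> 0) (at_end x0))
    \<and> (\<forall>k\<in>{1..n-1}. (\<lambda>x. wop S (qw S \<phi> n) k f x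
          - (\<Sum>j=k+1..n. a j * wop S (qw S \<phi> n) k (\<phi> j) x)) \<in> o[at_end x0](wop S (qw S \<phi> n) k (\<phi> n)))"
proof -
  let ?\<psi> = "\<lambda>j. \<phi> (Suc n - j)"
  have finq: "A f (n - 1) T < \<infinity>" using fin integral_conditions(4)[OF f] by simp
  obtain a where a: "\<And>k. k < n \<Longrightarrow> ((\<lambda>x. M k f x - (\<Sum>j=1..n. a j * M k (\<phi> j) x)) \<longlongrightarrow> 0) F"
    by (rule expansion_of_integrable[OF f finq]) (rule that)
  have finp: "reverse.A f (n - 1) T < \<infinity>" using fin integral_conditions(1)[OF f] by simp
  obtain b where b: "\<And>k. k < n \<Longrightarrow>
      ((\<lambda>x. reverse.M k f x - (\<Sum>j=1..n. b j * reverse.M k (?\<psi> j) x)) \<longlongrightarrow> 0) F"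
    by (rule reverse.expansion_of_integrable[OF f finp]) (rule that)
  define u where "u x = f x - (\<Sum>j\<in>{1..n}. a j * \<phi> j x)" for x
  have uAC: "AC_on S (n - 1) u" and Mu: "\<And>k x. k < n \<Longrightarrow> x \<in> S \<Longrightarrow> M k u x = M k f x - (\<Sum>j=1..n. a j * M k (\<phi> j) x)"
    unfolding u_def using AC_on_combination[OF _ order_refl f, where a = a] by auto
  have ulim: "(M k u \<longlongrightarrow> 0) F" if "k < n" for k
  proof (rule Lim_transform_eventually[OF a[OF that]])
    show "eventually (\<lambda>x. M k f x - (\<Sum>j=1..n. a j * M k (\<phi> j) x) = M k u x) F"
      using eventually_S by eventually_elim (simp only: Mu[OF that])
  qed
  have ratio: "((\<lambda>x. M k u x / M k (\<phi> n) x) \<longlongrightarrow> 0) F" if "k < n" for k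
    by (rule remainder_ratio[OF uAC ulim that])
  have u0: "((\<lambda>x. u x / \<phi> n x) \<longlongrightarrow> 0) F"
    using Lim_transform_eventually[OF ratio M_0_ratio] n2 by simp
  define b' where "b' j = b (Suc n - j)" for j
  have sum_b: "(\<Sum>j=1..n. b j * reverse.M k (?\<psi> j) x) = (\<Sum>j=1..n. b' j * reverse.M k (\<phi> j) x)" for k x
  proof -
    have "(\<Sum>j=1..n. b' j * reverse.M k (\<phi> j) x) = (\<Sum>j=1..n. b' (Suc n - j) * reverse.M k (?\<psi> j) x)"
      by (rule sum_reverse[symmetric])
    also have "\<dots> = (\<Sum>j=1..n. b j * reverse.M k (?\<psi> j) x)" by (intro sum.cong) (auto simp: b'_def)
    finally show ?thesis ..
  qed
  have eq: "a j = b' j" if "j \<in> {1..n}" for j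
  proof -
    have 1: "((\<lambda>x. reverse.M 0 f x - (\<Sum>j=1..n. b' j * reverse.M 0 (\<phi> j) x)) \<longlongrightarrow> 0) F"
      using b[of 0] n2 unfolding sum_b by simp
    \<comment> \<open>The weight of index 0 is \<open>1 / \<bar>\<phi> n\<bar>\<close>; absolute
      values remove the unknown sign of \<open>\<phi> n\<close>, to which a limit 0 is
      insensitive.\<close>
    have "((\<lambda>x. \<bar>(f x - (\<Sum>j=1..n. b' j * \<phi> j x)) / \<phi> n x\<bar>) \<longlongrightarrow> 0) F"
    proof (rule Lim_transform_eventually[OF tendsto_rabs_zero[OF 1]], rule always_eventually, rule allI)
      fix x
      have "reverse.M 0 f x - (\<Sum>j=1..n. b' j * reverse.M 0 (\<phi> j) x) = (f x - (\<Sum>j=1..n. b' j * \<phi> j x)) / \<bar>\<phi> n x\<bar>"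
        by (simp add: qw_def diff_divide_distrib sum_divide_distrib)
      then show "\<bar>reverse.M 0 f x - (\<Sum>j=1..n. b' j * reverse.M 0 (\<phi> j) x)\<bar> = \<bar>(f x - (\<Sum>j=1..n. b' j * \<phi> j x)) / \<phi> n x\<bar>"
        by (simp add: abs_divide)
    qed
    then have 2: "((\<lambda>x. (f x - (\<Sum>j=1..n. b' j * \<phi> j x)) / \<phi> n x) \<longlongrightarrow> 0) F"
      by (rule tendsto_rabs_zero_cancel)
    have "((\<lambda>x. (f x - (\<Sum>j=1..n. b' j * \<phi> j x)) / \<phi> n x - u x / \<phi> n x) \<longlongrightarrow> 0) F"
      using tendsto_diff[OF 2 u0] by simp
    moreover have "(f x - (\<Sum>j=1..n. b' j * \<phi> j x)) / \<phi> n x - u x / \<phi> n x = (\<Sum>j=1..n. (a j - b' j) * \<phi> j x) / \<phi> n x" for x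
      by (simp add: u_def left_diff_distrib sum_subtractf diff_divide_distrib)
    ultimately have "((\<lambda>x. (\<Sum>j=1..n. (a j - b' j) * \<phi> j x) / \<phi> n x) \<longlongrightarrow> 0) F" by simp
    from coefficients_unique[OF this that] show ?thesis by simp
  qed
  show ?thesis
  proof (intro exI[of _ a] conjI ballI)
    show "(\<lambda>x. f x - (\<Sum>j=1..n. a j * \<phi> j x)) \<in> o[at_end x0](\<phi> n)"
      using smalloI_tendsto[OF u0 basis_eventually_nonzero[of n]] n2 unfolding u_def by simp
  next
    fix k assume k: "k \<in> {1..n-1}"
    then have kn: "k < n" using n2 by auto
    have pq: "wop S (pw S \<phi> n) k v = reverse.M k v" for v
      using pw_eq_qw[of _ n S \<phi>] kn by (intro wop_cong) (auto simp: fun_eq_iff)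
    show "((\<lambda>x. wop S (pw S \<phi> n) k f x - (\<Sum>j=1..n-k. a j * wop S (pw S \<phi> n) k (\<phi> j) x)) \<longlongrightarrow> 0) (at_end x0)"
      unfolding pq
    proof (rule Lim_transform_eventually[OF b[OF kn]])
      show "eventually (\<lambda>x. reverse.M k f x - (\<Sum>j=1..n. b j * reverse.M k (?\<psi> j) x)
          = reverse.M k f x - (\<Sum>j=1..n-k. a j * reverse.M k (\<phi> j) x)) F"
        using eventually_S
      proof eventually_elim
        case (elim x)
        \<comment> \<open>The reversed operator of index k annihilates the last k functions, which
          are the first k of the reversed list.\<close>
        have "(\<Sum>j=1..n. b' j * reverse.M k (\<phi> j) x) = (\<Sum>j=1..n-k. b' j * reverse.M k (\<phi> j) x)"
        proof (rule sum.mono_neutral_right)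
          show "\<forall>j\<in>{1..n} - {1..n - k}. b' j * reverse.M k (\<phi> j) x = 0"
          proof
            fix j assume "j \<in> {1..n} - {1..n - k}"
            then have "1 \<le> Suc n - j" "Suc n - j \<le> k" "Suc n - (Suc n - j) = j" by auto
            then show "b' j * reverse.M k (\<phi> j) x = 0"
              using reverse.M_basis_zero[of "Suc n - j" k x] kn elim by simp
          qed
        qed auto
        also have "\<dots> = (\<Sum>j=1..n-k. a j * reverse.M k (\<phi> j) x)" using eq by (intro sum.cong) auto
        finally show ?case unfolding sum_b by simp
      qed
    qed
  next
    fix k assume k: "k \<in> {1..n-1}"
    then have kn: "k < n" using n2 by auto
    have "((\<lambda>x. (M k f x - (\<Sum>j=k+1..n. a j * M k (\<phi> j) x)) / M k (\<phi> n) x) \<longlongrightarrow> 0) F"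
    proof (rule Lim_transform_eventually[OF ratio[OF kn]])
      show "eventually (\<lambda>x. M k u x / M k (\<phi> n) x = (M k f x - (\<Sum>j=k+1..n. a j * M k (\<phi> j) x)) / M k (\<phi> n) x) F"
        using eventually_S
      proof eventually_elim
        case (elim x)
        have "(\<Sum>j=1..n. a j * M k (\<phi> j) x) = (\<Sum>j=k+1..n. a j * M k (\<phi> j) x)"
          by (rule sum.mono_neutral_right) (use M_basis_zero[of _ k x] kn elim in auto)
        then show ?case using Mu[OF kn elim] by simp
      qed
    qed
    then show "(\<lambda>x. M k f x - (\<Sum>j=k+1..n. a j * M k (\<phi> j) x)) \<in> o[at_end x0](M k (\<phi> n))"
      by (rule smalloI_tendsto) (rule eventually_nonzero_M_basis'[OF kn order_refl])
  qed
qed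

end

theorem theorem6p2:
  fixes T :: real and x0 :: ereal and n :: nat
    and \<phi> :: "nat \<Rightarrow> real \<Rightarrow> real" and f :: "real \<Rightarrow> real"
  assumes "ereal T < x0" and "n \<ge> 2"
    and "cheb_scale T x0 n \<phi>"
    and "\<forall>i\<in>{1..n}. AC_on (ivl T x0) (n - 1) (\<phi> i)"
    and "AC_on (ivl T x0) (n - 1) f"
  shows
    "(iterA (pw (ivl T x0) \<phi> n) (Lop (ivl T x0) \<phi> n f) n x0 (n - 1) T < \<infinity>
        \<longleftrightarrow>
      (\<integral>\<^sup>+ t. (iterB (pw (ivl T x0) \<phi> n) T (n - 1) t
                 * ennreal (\<bar>Lop (ivl T x0) \<phi> n f t\<bar> / pw (ivl T x0) \<phi> n n t))
               * indicator (ivl T x0) t \<partial>lborel) < \<infinity>)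
   \<and> (iterA (pw (ivl T x0) \<phi> n) (Lop (ivl T x0) \<phi> n f) n x0 (n - 1) T < \<infinity>
        \<longleftrightarrow>
      (\<integral>\<^sup>+ t. ennreal (\<bar>Lop (ivl T x0) \<phi> n f t\<bar> / qw (ivl T x0) \<phi> n n t)
               * indicator (ivl T x0) t \<partial>lborel) < \<infinity>)
   \<and> (iterA (pw (ivl T x0) \<phi> n) (Lop (ivl T x0) \<phi> n f) n x0 (n - 1) T < \<infinity>
        \<longrightarrow>
      (\<exists>(a::nat \<Rightarrow> real).
         (\<lambda>x. f x - (\<Sum>j=1..n. a j * \<phi> j x)) \<in> o[at_end x0](\<phi> n)
       \<and> (\<forall>k\<in>{1..n-1}.
            ((\<lambda>x. wop (ivl T x0) (pw (ivl T x0) \<phi> n) k f x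
                  - (\<Sum>j=1..n-k. a j * wop (ivl T x0) (pw (ivl T x0) \<phi> n) k (\<phi> j) x))
               \<longlongrightarrow> 0) (at_end x0))
       \<and> (\<forall>k\<in>{1..n-1}.
            (\<lambda>x. wop (ivl T x0) (qw (ivl T x0) \<phi> n) k f x
                  - (\<Sum>j=k+1..n. a j * wop (ivl T x0) (qw (ivl T x0) \<phi> n) k (\<phi> j) x))
              \<in> o[at_end x0](wop (ivl T x0) (qw (ivl T x0) \<phi> n) k (\<phi> n)))))"
proof -
  interpret chebyshev_scale T x0 n \<phi>
    using assms(1-4) unfolding cheb_scale_def by unfold_locales auto
  show ?thesis
    using integral_conditions(2,3)[OF assms(5)] asymptotic_expansions[OF assms(5)] by simp
qed

end
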